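(* Let $\hat\Phi_F$ be a quantum thick morphism from $M_1$ to $M_2$ and $\hat\Phi_G$ one from $M_2$ to $M_3$, with quantum generating functions $$F_\hbar(x,q)=F^0_\hbar(x)+\varphi^i_\hbar(x)q_i+F^{ij}_\hbar(x)q_iq_j+\cdots,\qquad G_\hbar(y,r)=G^0_\hbar(y)+\gamma^i_\hbar(y)r_i+G^{ij}_\hbar(y)r_ir_j+\cdots$$ in local coordinates. Let $H_\hbar(x,r)$ be the generating function of the composition $\hat\Phi_G\circ\hat\Phi_F$, i.e. $$e^{\frac i\hbar H_\hbar(x,r)}=\int dy\,\frac{dq}{(2\pi\hbar)^d}\;e^{\frac i\hbar\left(G_\hbar(y,r)+F_\hbar(x,q)-y^\alpha q_\alpha\right)},\qquad d=\dim M_2.$$ Then $$e^{\frac i\hbar H_\hbar(x,r)}=\exp\left(\frac i\hbar\sum_{\gamma\in[\Gamma^\circ]_{\infty/2}}\frac{r_{I_\gamma}}{|\mathrm{sym}(\gamma)|}\left(\frac\hbar i\right)^{b_\gamma}\langle F_\hbar,G_\hbar;\gamma\rangle^{I_\gamma}(x)\right),$$ and $$H_\hbar(x,r)=\sum_{\gamma\in[\Gamma^\circ]_{\infty/2}}\frac{r_{I_\gamma}}{|\mathrm{sym}(\gamma)|}\left(\frac\hbar i\right)^{b_\gamma}\langle F_\hbar,G_\hbar;\gamma\rangle^{I_\gamma}(x).$$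
   Context: Manifolds are ordinary (non-super); $x,y,z$ are local coordinates on $M_1,M_2,M_3$ with momenta $p,q,r$. A quantum generating function is a formal power series in the target momenta whose coefficients are smooth functions of the source coordinates and formal power series in $\hbar$, symmetric in their indices; a quantum thick morphism is a collection of such functions in each coordinate system. Repeated indices are summed. $F_\hbar^{a_1\dots a_m}(x)$ is the coefficient of $q_{a_1}\cdots q_{a_m}$ ($F^i_\hbar=\varphi^i_\hbar$; no indices: $F^0_\hbar$); $G_\hbar^{a_1\dots a_\ell}(y)$ is the coefficient of $r_{a_1}\cdots r_{a_\ell}$ ($G_\hbar^i=\gamma_\hbar^i$; no indices: $G_\hbar^0$); $\varphi_\hbar(x)=(\varphi^i_\hbar(x))$. The integral is formal: $e^{\frac i\hbar F_\hbar^+(x,q)}$, where $F_\hbar^+$ is the part of $F_\hbar$ of order $\ge2$ in $q$, is expanded in powers of $q$ and each term is evaluated by Fourier inversion, $\int dy\frac{dq}{(2\pi\hbar)^d}e^{\frac i\hbar(c^\alpha-y^\alpha)q_\alpha}q_{a_1}\cdots q_{a_m}f(y)=(\hbar/i)^m\partial_{a_1}\cdots\partial_{a_m}f(c)$ with $c=\varphi_\hbar(x)$; functions at $\varphi_\hbar(x)$ are Taylor expanded in $\hbar$ about the $\hbar^0$ term. $H_\hbar$ is the formal logarithm. Equalities are of formal series in $r$ and $\hbar$, compared degree by degree, where $F_\hbar^{a_1\dots a_m}$ with $m\ge2$ has degree $m$. A bipartite graph is $\gamma=(B_\gamma,W_\gamma,E_\gamma)$ with black vertices $B_\gamma=\{1,\dots,n\}$,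 white vertices $W_\gamma=\{-1,\dots,-m\}$ and a finite multiset $E_\gamma$ of elements of $B_\gamma\times W_\gamma$ (edges; parallel edges are allowed but not distinguished). $|\gamma|$ is the number of vertices, $b_\gamma:=|E_\gamma|-|\gamma|+1$. $\Gamma^\circ$ is the set of nonempty connected bipartite graphs whose leaves (vertices attached to exactly one edge) are all white, including the one-vertex graphs $\bullet$ and $\circ$. A white-weighted graph carries in addition a map $L_\gamma:W_\gamma\to\mathbb{Z}_{\ge0}$, $\ell_w=L_\gamma(w)$. Isomorphisms are pairs of permutations of black and white vertices preserving edge multiplicities and weights; $\mathrm{sym}(\gamma)$ is the automorphism group (permutations of parallel edges not counted); $[\Gamma^\circ]_{\infty/2}$ is the set of isomorphism classes of white-weighted graphs with underlying graph in $\Gamma^\circ$. To $\gamma$ is attached the multi-index $I_\gamma=\prod_{w\in W_\gamma}a_{w,1}\cdots a_{w,\ell_w}$ of dummy labels, and $r_{I_\gamma}=\prod_{w}r_{a_{w,1}}\cdots r_{a_{w,\ell_w}}$. For a vertex $v$ let $e^v_1,\dots,e^v_{m_v}$ be the edges attached to it, used as dummy summation indices, and for black $v$ let $k^v_i$ be the number of white vertices with which $v$ shares exactly $i$ edges. Define $$\langle F_\hbar,G_\hbar;\gamma\rangle^{I_\gamma}(x):=\Big(\prod_{v\in B_\gamma}\frac{m_v!}{(1!)^{k^v_1}(2!)^{k^v_2}\cdots(m_v!)^{k^v_{m_v}}}F_\hbar^{e^v_1\dots e^v_{m_v}}(x)\Big)\Big(\prod_{w\in W_\gamma}\frac{\partial}{\partial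 y^{e^w_1}}\cdots\frac{\partial}{\partial y^{e^w_{m_w}}}G_\hbar^{a_{w,1}\dots a_{w,\ell_w}}(\varphi_\hbar(x))\Big).$$ In the formulas all labels $a_{w,k}$ are summed over. *)

theory Defs
  imports
    "HOL-Analysis.Analysis"
    "HOL-Computational_Algebra.Formal_Laurent_Series"
begin

section \<open>Formal power series in several commuting variables\<close>

text \<open>The exponents of monomials are multisets of variables.\<close>

typedef ('v, 'a) mfps = "UNIV :: ('v multiset \<Rightarrow> 'a) set"
  morphisms mfps_nth Abs_mfps ..

lemma mfps_nth_Abs [simp]: "mfps_nth (Abs_mfps f) M = f M"
  by (simp add: Abs_mfps_inverse)

lemma mfps_eqI: "(\<And>M. mfps_nth f M = mfps_nth g M) \<Longrightarrow> f = g"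
  by (metis mfps_nth_inject ext)

lemma finite_submultisets: "finite {A. A \<subseteq># M}"
proof (induction M)
  case (add x M)
  have "{A. A \<subseteq># add_mset x M} \<subseteq> {A. A \<subseteq># M} \<union> add_mset x ` {A. A \<subseteq># M}"
  proof
    fix A assume "A \<in> {A. A \<subseteq># add_mset x M}"
    then have A: "A \<subseteq># add_mset x M" by simp
    show "A \<in> {A. A \<subseteq># M} \<union> add_mset x ` {A. A \<subseteq># M}"
    proof (cases "x \<in># A")
      case True
      then obtain B where "A = add_mset x B" by (metis multi_member_split)
      with A show ?thesis by auto
    next
      case False
      with A have "A \<subseteq># M"
        by (metis add_mset_remove_trivial diff_single_trivial subset_eq_diff_conv
            add_mset_add_single mset_subset_eq_exists_conv union_single_eq_member
            subset_mset.add_diff_inverse union_iff)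
      then show ?thesis by simp
    qed
  qed
  then show ?case using add by (meson finite_UnI finite_imageI finite_subset)
qed auto

instantiation mfps :: (type, zero) zero
begin
definition "0 = Abs_mfps (\<lambda>_. 0)"
instance ..
end

instantiation mfps :: (type, "{zero, one}") one
begin
definition "1 = Abs_mfps (\<lambda>M. if M = {#} then 1 else 0)"
instance ..
end

instantiation mfps :: (type, plus) plus
begin
definition "f + g = Abs_mfps (\<lambda>M. mfps_nth f M + mfps_nth g M)"
instance ..
end

instantiation mfps :: (type, minus) minus
begin
definition "f - g = Abs_mfps (\<lambda>M. mfps_nth f M - mfps_nth g M)"
instance ..
end

instantiation mfps :: (type, uminus) uminus
begin
definition "- f = Abs_mfps (\<lambda>M. - mfps_nth f M)"
instance ..
end

instantiation mfps :: (type, "{comm_monoid_add, times}") times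
begin
definition "f * g = Abs_mfps (\<lambda>M. \<Sum>A | A \<subseteq># M. mfps_nth f A * mfps_nth g (M - A))"
instance ..
end

lemma mfps_nth_zero [simp]: "mfps_nth 0 M = 0"
  and mfps_nth_one: "mfps_nth 1 M = (if M = {#} then 1 else 0)"
  and mfps_nth_plus [simp]: "mfps_nth (f + g) M = mfps_nth f M + mfps_nth g M"
  and mfps_nth_minus [simp]: "mfps_nth (h - k) M = mfps_nth h M - mfps_nth k M"
  and mfps_nth_uminus [simp]: "mfps_nth (- l) M = - mfps_nth l M"
  and mfps_nth_times:
    "mfps_nth (p * q) M = (\<Sum>A | A \<subseteq># M. mfps_nth p A * mfps_nth q (M - A))"
  by (simp_all add: zero_mfps_def one_mfps_def plus_mfps_def minus_mfps_def
      uminus_mfps_def times_mfps_def)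

instance mfps :: (type, comm_ring_1) comm_ring_1
proof
  fix f g h :: "('a, 'b) mfps"
  show "f * g * h = f * (g * h)"
  proof (rule mfps_eqI)
    fix M
    have "mfps_nth (f * g * h) M =
      (\<Sum>(A, B) \<in> (SIGMA A:{A. A \<subseteq># M}. {B. B \<subseteq># A}).
         mfps_nth f B * mfps_nth g (A - B) * mfps_nth h (M - A))"
      by (simp add: mfps_nth_times sum_distrib_right sum.Sigma finite_submultisets)
    also have "\<dots> = (\<Sum>(B, C) \<in> (SIGMA B:{B. B \<subseteq># M}. {C. C \<subseteq># M - B}).
         mfps_nth f B * (mfps_nth g C * mfps_nth h (M - B - C)))"
      by (rule sum.reindex_bij_witness[where i = "\<lambda>(B, C). (B + C, B)"
            and j = "\<lambda>(A, B). (B, A - B)"])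
        (auto simp: mult.assoc subset_mset.add_diff_inverse subset_mset.le_diff_conv2
          subset_eq_diff_conv add.commute intro: subset_mset.order_trans)
    also have "\<dots> = mfps_nth (f * (g * h)) M"
      by (simp add: mfps_nth_times sum_distrib_left sum.Sigma finite_submultisets)
    finally show "mfps_nth (f * g * h) M = mfps_nth (f * (g * h)) M" .
  qed
  show "f * g = g * f"
  proof (rule mfps_eqI)
    fix M
    show "mfps_nth (f * g) M = mfps_nth (g * f) M"
      unfolding mfps_nth_times
      by (rule sum.reindex_bij_witness[where i = "\<lambda>A. M - A" and j = "\<lambda>A. M - A"])
        (auto simp: mult.commute double_diff subset_mset.diff_diff_right)
  qed
  show "1 * f = f"
  proof (rule mfps_eqI)
    fix M
    have "mfps_nth (1 * f) M = (\<Sum>A | A \<subseteq># M. if A = {#} then mfps_nth f M else 0)"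
      unfolding mfps_nth_times by (rule sum.cong) (auto simp: mfps_nth_one)
    also have "\<dots> = mfps_nth f M"
      by (simp add: finite_submultisets)
    finally show "mfps_nth (1 * f) M = mfps_nth f M" .
  qed
  show "(f + g) * h = f * h + g * h"
    by (rule mfps_eqI) (simp add: mfps_nth_times distrib_right sum.distrib)
  show "(0 :: ('a, 'b) mfps) \<noteq> 1"
    by (metis mfps_nth_one mfps_nth_zero zero_neq_one)
qed (rule mfps_eqI, simp add: algebra_simps)+

definition mfps_monom :: "'v multiset \<Rightarrow> 'a::zero \<Rightarrow> ('v, 'a) mfps" where
  "mfps_monom M a = Abs_mfps (\<lambda>N. if N = M then a else 0)"

abbreviation mfps_const :: "'a::zero \<Rightarrow> ('v, 'a) mfps" where
  "mfps_const \<equiv> mfps_monom {#}"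

definition mfps_map :: "('a \<Rightarrow> 'b) \<Rightarrow> ('v, 'a) mfps \<Rightarrow> ('v, 'b) mfps" where
  "mfps_map h f = Abs_mfps (\<lambda>M. h (mfps_nth f M))"

text \<open>
  The formal series of the composition formula are series in a bookkeeping degree (the outer
  \<^typ>\<open>'a fps\<close>; \<open>F\<^sup>a\<^sup>1\<^sup>\<dots>\<^sup>a\<^sup>m\<close> with \<open>m \<ge> 2\<close> has degree \<open>m\<close>) whose components are formal
  power series in the variables \<open>'v\<close> (momenta) over formal Laurent series in Planck's constant.
\<close>

type_synonym 'v series = "('v, complex fls) mfps fps"

abbreviation hbar :: "complex fls" where
  "hbar \<equiv> fls_X"

abbreviation i_over_hbar :: "complex fls" where
  "i_over_hbar \<equiv> fls_const \<i> / hbar"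

abbreviation hbar_over_i :: "complex fls" where
  "hbar_over_i \<equiv> hbar / fls_const \<i>"

abbreviation scalar :: "complex fls \<Rightarrow> 'v series" where
  "scalar c \<equiv> fps_const (mfps_const c)"

text \<open>Exponential of a series without term of degree 0, and logarithm of a series whose
  term of degree 0 is 1; the sums over \<open>k\<close> may be cut off at the degree considered.\<close>

definition series_exp :: "'v series \<Rightarrow> 'v series" where
  "series_exp Z = Abs_fps (\<lambda>n. \<Sum>k\<le>n. mfps_const (1 / fact k) * fps_nth (Z ^ k) n)"

definition series_ln :: "'v series \<Rightarrow> 'v series" where
  "series_ln A = Abs_fps (\<lambda>n. \<Sum>k=1..n.
     mfps_const ((- 1) ^ (k + 1) / of_nat k) * fps_nth ((A - 1) ^ k) n)"

definition formal_sum :: "('a \<Rightarrow> 'v series) \<Rightarrow> 'a set \<Rightarrow> 'v series" where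
  "formal_sum f A = Abs_fps (\<lambda>n. Abs_mfps (\<lambda>M.
     \<Sum>a | a \<in> A \<and> mfps_nth (fps_nth (f a) n) M \<noteq> 0. mfps_nth (fps_nth (f a) n) M))"


section \<open>Oscillatory series\<close>

text \<open>
  \<open>Osc S A\<close> stands for \<open>exp (i/\<hbar> S) A\<close>. The exponential of the degree 0 phase \<open>S\<close> is not a
  formal series in \<open>\<hbar>\<close> and is kept as a symbol; everything of positive degree is expanded.
  Since \<open>S\<close> has degree 0, the pair \<open>(S, A)\<close> is a normal form.
\<close>

datatype 'v osc = Osc (osc_phase: "('v, complex fls) mfps") (osc_amplitude: "'v series")

definition osc_exp :: "'v series \<Rightarrow> 'v osc" where
  "osc_exp H = Osc (fps_nth H 0)
     (series_exp (scalar i_over_hbar * (H - fps_const (fps_nth H 0))))"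

definition osc_ln :: "'v osc \<Rightarrow> 'v series" where
  "osc_ln \<Psi> = fps_const (osc_phase \<Psi>) + scalar hbar_over_i * series_ln (osc_amplitude \<Psi>)"


section \<open>Derivatives, and values at a formal point\<close>

definition partial :: "'b::finite \<Rightarrow> (real^'b \<Rightarrow> complex) \<Rightarrow> real^'b \<Rightarrow> complex" where
  "partial a f y = frechet_derivative f (at y) (axis a 1)"

definition partial_fps :: "'b::finite \<Rightarrow> (real^'b \<Rightarrow> complex fps) \<Rightarrow> real^'b \<Rightarrow> complex fps" where
  "partial_fps a f y = Abs_fps (\<lambda>n. partial a (\<lambda>z. fps_nth (f z) n) y)"

definition partial_mfps ::
    "'b::finite \<Rightarrow> (real^'b \<Rightarrow> ('c, complex fps) mfps) \<Rightarrow> real^'b \<Rightarrow> ('c, complex fps) mfps" where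
  "partial_mfps a f y = Abs_mfps (\<lambda>M. partial_fps a (\<lambda>z. mfps_nth (f z) M) y)"

definition smooth_on :: "(real^'b::finite) set \<Rightarrow> (real^'b \<Rightarrow> complex) \<Rightarrow> bool" where
  "smooth_on U f \<longleftrightarrow> (\<forall>J. foldr partial J f differentiable_on U)"

text \<open>A formal point is a vector of power series in \<open>\<hbar>\<close> whose \<open>\<hbar>\<^sup>0\<close> terms are the real
  coordinates of its base point.\<close>

definition base_point :: "('b::finite \<Rightarrow> complex fps) \<Rightarrow> real^'b" where
  "base_point c = (\<chi> a. Re (fps_nth (c a) 0))"

text \<open>Taylor expansion in \<open>\<hbar>\<close> about the base point. The product has order at least
  \<open>length J\<close> in \<open>\<hbar>\<close>, so longer \<open>J\<close> do not contribute to the coefficient of \<open>\<hbar>\<^sup>n\<close>.\<close>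

definition taylor_at :: "('b::finite \<Rightarrow> complex fps) \<Rightarrow> (real^'b \<Rightarrow> complex fps) \<Rightarrow> complex fps" where
  "taylor_at c f = Abs_fps (\<lambda>n. \<Sum>J | length J \<le> n. fps_nth
     (fps_const (1 / fact (length J)) * foldr partial_fps J f (base_point c) *
      (\<Prod>a\<leftarrow>J. c a - fps_const (fps_nth (c a) 0))) n)"

definition taylor_at_mfps ::
    "('b::finite \<Rightarrow> complex fps) \<Rightarrow> (real^'b \<Rightarrow> ('c, complex fps) mfps) \<Rightarrow> ('c, complex fls) mfps" where
  "taylor_at_mfps c f = Abs_mfps (\<lambda>M. fps_to_fls (taylor_at c (\<lambda>y. mfps_nth (f y) M)))"

definition list_of_mset :: "'a multiset \<Rightarrow> 'a list" where
  "list_of_mset M = (SOME xs. mset xs = M)"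


section \<open>Quantum thick morphisms in local coordinates\<close>

text \<open>
  \<open>F x [a\<^sub>1, \<dots>, a\<^sub>m]\<close> is the coefficient \<open>F\<^sub>\<hbar>\<^sup>a\<^sup>1\<^sup>\<dots>\<^sup>a\<^sup>m(x)\<close> of \<open>q\<^sub>a\<^sub>1 \<cdots> q\<^sub>a\<^sub>m\<close>, a power series in \<open>\<hbar>\<close>;
  \<open>F x []\<close> is \<open>F\<^sub>\<hbar>\<^sup>0(x)\<close>. The coefficients are complex because those of a composition are; only
  the underlying map \<open>\<phi>\<^sub>0\<close> of the manifolds has to be real.
\<close>

definition quantum_generating_function ::
    "(real^'a::finite) set \<Rightarrow> (real^'a \<Rightarrow> 'b list \<Rightarrow> complex fps) \<Rightarrow> bool" where
  "quantum_generating_function U F \<longleftrightarrow>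
     (\<forall>I n. smooth_on U (\<lambda>x. fps_nth (F x I) n)) \<and>
     (\<forall>x\<in>U. \<forall>I J. mset I = mset J \<longrightarrow> F x I = F x J)"

definition formal_map :: "(real^'a::finite \<Rightarrow> 'b list \<Rightarrow> complex fps) \<Rightarrow> real^'a \<Rightarrow> 'b \<Rightarrow> complex fps" where
  "formal_map F x a = F x [a]"

definition quantum_thick_morphism ::
    "(real^'a::finite) set \<Rightarrow> (real^'b::finite) set \<Rightarrow> (real^'a \<Rightarrow> 'b list \<Rightarrow> complex fps) \<Rightarrow> bool" where
  "quantum_thick_morphism U V F \<longleftrightarrow> quantum_generating_function U F \<and>
     (\<forall>x\<in>U. (\<forall>a. fps_nth (formal_map F x a) 0 \<in> \<real>) \<and> base_point (formal_map F x) \<in> V)"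

text \<open>\<open>G\<^sub>\<hbar>(y, r)\<close> as a power series in \<open>r\<close>.\<close>

definition momentum_series :: "('c::finite list \<Rightarrow> complex fps) \<Rightarrow> ('c, complex fps) mfps" where
  "momentum_series g = Abs_mfps (\<lambda>M. \<Sum>I | mset I = M. g I)"

text \<open>\<open>F\<^sub>\<hbar>\<^sup>+(x, q)\<close>, the part of order at least 2 in \<open>q\<close>, graded by degree.\<close>

definition higher_part :: "('b::finite list \<Rightarrow> complex fps) \<Rightarrow> 'b series" where
  "higher_part f = Abs_fps (\<lambda>m. if m \<ge> 2
     then \<Sum>I | length I = m. mfps_monom (mset I) (fps_to_fls (f I)) else 0)"


section \<open>The formal integral and the generating function of the composition\<close>

text \<open>The operator \<open>exp (- i/\<hbar> S) (\<hbar>/i \<partial>\<^sub>a) exp (i/\<hbar> S)\<close> on amplitudes.\<close>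

definition twisted_partial ::
    "(real^'b::finite \<Rightarrow> ('c, complex fps) mfps) \<Rightarrow> 'b \<Rightarrow>
     (real^'b \<Rightarrow> ('c, complex fps) mfps) \<Rightarrow> real^'b \<Rightarrow> ('c, complex fps) mfps" where
  "twisted_partial S a u y =
     partial_mfps a S y * u y + mfps_const (fps_const (1 / \<i>) * fps_X) * partial_mfps a u y"

text \<open>
  Fourier inversion: the integral of \<open>exp (i/\<hbar> (c\<^sup>\<alpha> - y\<^sup>\<alpha>) q\<^sub>\<alpha>) q\<^sub>a\<^sub>1 \<cdots> q\<^sub>a\<^sub>m f(y)\<close> is
  \<open>(\<hbar>/i)\<^sup>m \<partial>\<^sub>a\<^sub>1 \<cdots> \<partial>\<^sub>a\<^sub>m f(c)\<close>, here with \<open>f = exp (i/\<hbar> S)\<close>; this is the amplitude of the result in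
  front of \<open>exp (i/\<hbar> S(c))\<close>. The order of the indices does not matter for smooth \<open>S\<close>.
\<close>

definition fourier_inversion ::
    "('b::finite \<Rightarrow> complex fps) \<Rightarrow> (real^'b \<Rightarrow> ('c, complex fps) mfps) \<Rightarrow> 'b multiset \<Rightarrow>
     ('c, complex fls) mfps" where
  "fourier_inversion c S M =
     taylor_at_mfps c (foldr (twisted_partial S) (list_of_mset M) (\<lambda>_. 1))"

text \<open>
  The integral of \<open>exp (i/\<hbar> (G(y,r) + F(x,q) - y\<^sup>\<alpha> q\<^sub>\<alpha>))\<close>, with \<open>exp (i/\<hbar> F\<^sup>+(x,q))\<close> expanded in
  powers of \<open>q\<close>. Its component of degree \<open>n\<close> is homogeneous of degree \<open>n\<close> in \<open>q\<close>.
\<close>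

definition composition_integral ::
    "(real^'a::finite \<Rightarrow> 'b::finite list \<Rightarrow> complex fps) \<Rightarrow>
     (real^'b \<Rightarrow> 'c::finite list \<Rightarrow> complex fps) \<Rightarrow> real^'a \<Rightarrow> 'c osc" where
  "composition_integral F G x =
     (let c = formal_map F x;
          S = (\<lambda>y. momentum_series (G y));
          E = series_exp (scalar i_over_hbar * higher_part (F x))
      in Osc (mfps_const (fps_to_fls (F x [])) + taylor_at_mfps c S)
           (Abs_fps (\<lambda>n. \<Sum>M | size M = n.
              mfps_const (mfps_nth (fps_nth E n) M) * fourier_inversion c S M)))"

definition composition_generating_function ::
    "(real^'a::finite \<Rightarrow> 'b::finite list \<Rightarrow> complex fps) \<Rightarrow>
     (real^'b \<Rightarrow> 'c::finite list \<Rightarrow> complex fps) \<Rightarrow> real^'a \<Rightarrow> 'c series" where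
  "composition_generating_function F G x = osc_ln (composition_integral F G x)"


section \<open>White-weighted bipartite graphs\<close>

record wgraph =
  num_black :: nat
  num_white :: nat
  edges :: "(int \<times> int) multiset"
  weight :: "int \<Rightarrow> nat"

definition blacks :: "wgraph \<Rightarrow> int set" where
  "blacks g = {1..int (num_black g)}"

definition whites :: "wgraph \<Rightarrow> int set" where
  "whites g = {- int (num_white g)..- 1}"

definition verts :: "wgraph \<Rightarrow> int set" where
  "verts g = blacks g \<union> whites g"

text \<open>The weight is a function on the white vertices, so it is normalised elsewhere.\<close>

definition is_wgraph :: "wgraph \<Rightarrow> bool" where
  "is_wgraph g \<longleftrightarrow> set_mset (edges g) \<subseteq> blacks g \<times> whites g \<and>
     (\<forall>w. w \<notin> whites g \<longrightarrow> weight g w = 0)"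

definition attached :: "int \<Rightarrow> int \<times> int \<Rightarrow> bool" where
  "attached v e \<longleftrightarrow> v = fst e \<or> v = snd e"

definition valency :: "wgraph \<Rightarrow> int \<Rightarrow> nat" where
  "valency g v = size (filter_mset (attached v) (edges g))"

definition connected_wgraph :: "wgraph \<Rightarrow> bool" where
  "connected_wgraph g \<longleftrightarrow> (\<forall>u\<in>verts g. \<forall>v\<in>verts g.
     (u, v) \<in> (set_mset (edges g) \<union> (set_mset (edges g))\<inverse>)\<^sup>*)"

text \<open>White-weighted graphs with underlying graph in \<open>\<Gamma>\<^sup>\<circ>\<close>.\<close>

definition Gamma_circ :: "wgraph set" where
  "Gamma_circ = {g. is_wgraph g \<and> verts g \<noteq> {} \<and> connected_wgraph g \<and>
     (\<forall>v\<in>verts g. valency g v = 1 \<longrightarrow> v \<in> whites g)}"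

definition isos :: "wgraph \<Rightarrow> wgraph \<Rightarrow> ((int \<Rightarrow> int) \<times> (int \<Rightarrow> int)) set" where
  "isos g h = {(\<pi>, \<rho>). num_black g = num_black h \<and> num_white g = num_white h \<and>
     \<pi> permutes blacks g \<and> \<rho> permutes whites g \<and>
     image_mset (map_prod \<pi> \<rho>) (edges g) = edges h \<and>
     (\<forall>w\<in>whites g. weight h (\<rho> w) = weight g w)}"

abbreviation sym_group :: "wgraph \<Rightarrow> ((int \<Rightarrow> int) \<times> (int \<Rightarrow> int)) set" where
  "sym_group g \<equiv> isos g g"

definition Gamma_circ_classes :: "wgraph set set" where
  "Gamma_circ_classes = Gamma_circ //
     {(g, h). g \<in> Gamma_circ \<and> h \<in> Gamma_circ \<and> isos g h \<noteq> {}}"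

definition betti :: "wgraph \<Rightarrow> int" where
  "betti g = int (size (edges g)) - int (card (verts g)) + 1"

text \<open>\<open>k\<^sup>v\<^sub>i\<close>\<close>

definition num_neighbours :: "wgraph \<Rightarrow> int \<Rightarrow> nat \<Rightarrow> nat" where
  "num_neighbours g v i = card {w \<in> whites g. count (edges g) (v, w) = i}"


section \<open>Amplitudes of graphs\<close>

text \<open>
  Every edge (parallel ones included) carries a summation index in \<open>'b\<close>. The edges are enumerated
  by \<open>list_of_mset\<close>, the \<open>j\<close>-th edge carrying the index \<open>\<sigma> ! j\<close>; \<open>indices_at g \<sigma> v\<close> is then
  \<open>e\<^sup>v\<^sub>1, \<dots>, e\<^sup>v\<^sub>m\<^sub>v\<close>. The enumeration does not matter, the coefficients being symmetric and the
  derivatives commuting.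
\<close>

definition indices_at :: "wgraph \<Rightarrow> 'b list \<Rightarrow> int \<Rightarrow> 'b list" where
  "indices_at g \<sigma> v = map snd (filter (\<lambda>(e, a). attached v e) (zip (list_of_mset (edges g)) \<sigma>))"

text \<open>\<open>\<langle>F, G; \<gamma>\<rangle>\<^sup>I(x)\<close>, where \<open>\<alpha> w\<close> is the list of labels \<open>a\<^sub>w\<^sub>,\<^sub>1, \<dots>, a\<^sub>w\<^sub>,\<^sub>l\<close> at the white vertex \<open>w\<close>.\<close>

definition graph_bracket ::
    "(real^'a::finite \<Rightarrow> 'b::finite list \<Rightarrow> complex fps) \<Rightarrow>
     (real^'b \<Rightarrow> 'c::finite list \<Rightarrow> complex fps) \<Rightarrow> wgraph \<Rightarrow> (int \<Rightarrow> 'c list) \<Rightarrow> real^'a \<Rightarrow> complex fps" where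
  "graph_bracket F G g \<alpha> x = (\<Sum>\<sigma> | length \<sigma> = size (edges g).
     (\<Prod>v\<in>blacks g.
        fps_const (fact (valency g v) / (\<Prod>i=1..valency g v. fact i ^ num_neighbours g v i)) *
        F x (indices_at g \<sigma> v)) *
     (\<Prod>w\<in>whites g.
        taylor_at (formal_map F x) (foldr partial_fps (indices_at g \<sigma> w) (\<lambda>y. G y (\<alpha> w)))))"

definition labellings :: "wgraph \<Rightarrow> (int \<Rightarrow> 'c list) set" where
  "labellings g = (\<Pi>\<^sub>E w\<in>whites g. {I. length I = weight g w})"

definition graph_degree :: "wgraph \<Rightarrow> nat" where
  "graph_degree g = (\<Sum>v | v \<in> blacks g \<and> valency g v \<ge> 2. valency g v)"

definition graph_term ::
    "(real^'a::finite \<Rightarrow> 'b::finite list \<Rightarrow> complex fps) \<Rightarrow>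
     (real^'b \<Rightarrow> 'c::finite list \<Rightarrow> complex fps) \<Rightarrow> real^'a \<Rightarrow> wgraph \<Rightarrow> 'c series" where
  "graph_term F G x g = fps_X ^ graph_degree g * fps_const (\<Sum>\<alpha>\<in>labellings g.
     mfps_monom (\<Sum>w\<in>whites g. mset (\<alpha> w))
       (1 / of_nat (card (sym_group g)) * hbar_over_i powi betti g * fps_to_fls (graph_bracket F G g \<alpha> x)))"

definition graph_sum ::
    "(real^'a::finite \<Rightarrow> 'b::finite list \<Rightarrow> complex fps) \<Rightarrow>
     (real^'b \<Rightarrow> 'c::finite list \<Rightarrow> complex fps) \<Rightarrow> real^'a \<Rightarrow> 'c series" where
  "graph_sum F G x = formal_sum (\<lambda>C. graph_term F G x (SOME g. g \<in> C)) Gamma_circ_classes"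

end

theory Submission
  imports Defs "HOL-Combinatorics.Multiset_Permutations"
begin

text \<open>
  Label the edges of a bipartite graph by \<open>1, \<dots>, n\<close>. A graph without isolated vertices is then the
  same as a pair of set partitions of \<open>{1, \<dots>, n}\<close>, whose blocks are the black and the white vertices.
  Expanding \<open>exp (i/\<hbar> F\<^sup>+)\<close> gives a sum over the partition into black vertices, and the Fourier
  inversion formula, by Faa di Bruno applied to \<open>exp (i/\<hbar> S)\<close>, gives a sum over the partition into
  white vertices. So the amplitude of the integral is the exponential generating function of all pairs of
  partitions, weighted multiplicatively over connected components, and its logarithm is the generating
  function of the connected pairs. The orbit-stabilizer theorem for relabellings of vertices and the
  multinomial count of edge labellings turn the latter into the sum over isomorphism classes
  with the weights \<open>1/|sym|\<close>; the factors \<open>1!\<^bsup>k\<^sub>1\<^esup>2!\<^bsup>k\<^sub>2\<^esup>\<cdots>\<close> of the brackets account for parallel edges.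
\<close>

section \<open>Sums over set partitions\<close>

text \<open>The linear part of \<open>F\<close> in the momenta is spent on localizing the integral
  at \<open>\<phi>(x)\<close>; only the part of order at least 2 is expanded. So a black block with
  a single edge has weight 0, which is why black leaves are absent and why the degree of a graph is
  its number of edges. The powers of \<hbar> add up to \<open>b_\<gamma>\<close>: a black vertex
  contributes \<open>i/\<hbar>\<close>, a white vertex with \<open>m\<close> edges
  \<open>(\<hbar>/i)^(m - 1)\<close>, and the logarithm is multiplied once by
  \<open>\<hbar>/i\<close>. The one-vertex graphs have no edge to label; they make up the phase, the
  term of degree 0, and are treated apart. A coordinate index of the middle manifold runs along
  every edge, so the weight of a pair of partitions depends on a colouring of the edges. After
  summation over all colourings it depends on the number of edges alone, as an exponential
  generating function requires. The sum over classes is infinite and uses arbitrary representatives;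
  identities are proved coefficient by coefficient, with finitely many graphs for each.\<close>

definition part_sum :: "('a set \<Rightarrow> 'r::comm_ring_1) \<Rightarrow> 'a set \<Rightarrow> 'r" where
  "part_sum u X = (\<Sum>P | partition_on X P. \<Prod>B\<in>P. u B)"

lemma part_sum_empty [simp]: "part_sum u {} = 1"
  by (simp add: part_sum_def partition_on_empty)

text \<open>A set that no block crosses cuts a partition in two. It is applied with a single block
  for \<open>C\<close> and with a connected component.\<close>

lemma partition_on_split:
  assumes "partition_on X P" "\<And>B. B \<in> P \<Longrightarrow> B \<inter> C \<noteq> {} \<Longrightarrow> B \<subseteq> C" "C \<subseteq> X"
  shows "partition_on C {B \<in> P. B \<subseteq> C}" "partition_on (X - C) {B \<in> P. \<not> B \<subseteq> C}"
proof -
  have U: "X = \<Union>P" and D: "disjoint P" and E: "{} \<notin> P"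
    using assms(1) by (auto simp: partition_on_def)
  show "partition_on C {B \<in> P. B \<subseteq> C}"
  proof (rule partition_onI)
    show "\<Union>{B \<in> P. B \<subseteq> C} = C"
    proof
      show "C \<subseteq> \<Union>{B \<in> P. B \<subseteq> C}"
      proof
        fix y assume y: "y \<in> C"
        then obtain B where "B \<in> P" "y \<in> B" using assms(3) U by blast
        with assms(2)[of B] y show "y \<in> \<Union>{B \<in> P. B \<subseteq> C}" by blast
      qed
    qed auto
  next
    fix p q assume "p \<in> {B \<in> P. B \<subseteq> C}" "q \<in> {B \<in> P. B \<subseteq> C}" "p \<noteq> q"
    then show "disjnt p q" using D by (auto simp: disjoint_def disjnt_def)
  next
    show "{} \<notin> {B \<in> P. B \<subseteq> C}" using E by auto
  qed
  show "partition_on (X - C) {B \<in> P. \<not> B \<subseteq> C}"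
  proof (rule partition_onI)
    show "\<Union>{B \<in> P. \<not> B \<subseteq> C} = X - C"
    proof
      show "\<Union>{B \<in> P. \<not> B \<subseteq> C} \<subseteq> X - C" using assms(2) U by blast
      show "X - C \<subseteq> \<Union>{B \<in> P. \<not> B \<subseteq> C}" using U by blast
    qed
  next
    fix p q assume "p \<in> {B \<in> P. \<not> B \<subseteq> C}" "q \<in> {B \<in> P. \<not> B \<subseteq> C}" "p \<noteq> q"
    then show "disjnt p q" using D by (auto simp: disjoint_def disjnt_def)
  next
    show "{} \<notin> {B \<in> P. \<not> B \<subseteq> C}" using E by auto
  qed
qed

text \<open>Inverse of the cutting. The subset test recovers both halves because a block of
  \<open>Q\<close> is nonempty and disjoint from \<open>C\<close>.\<close>

lemma partition_on_join:
  assumes "partition_on C P" "partition_on D Q" "C \<inter> D = {}"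
  shows "partition_on (C \<union> D) (P \<union> Q)"
    "{B \<in> P \<union> Q. B \<subseteq> C} = P" "{B \<in> P \<union> Q. \<not> B \<subseteq> C} = Q"
proof -
  have P: "C = \<Union>P" "disjoint P" "{} \<notin> P" and Q: "D = \<Union>Q" "disjoint Q" "{} \<notin> Q"
    using assms(1,2) by (auto simp: partition_on_def)
  have PQ: "p \<inter> q = {}" if "p \<in> P" "q \<in> Q" for p q
    using that assms(3) P(1) Q(1) by blast
  have QC: "\<not> q \<subseteq> C" if "q \<in> Q" for q
  proof
    assume "q \<subseteq> C"
    then have "q \<subseteq> C \<inter> D" using that Q(1) by blast
    then have "q = {}" using assms(3) by auto
    then show False using that Q(3) by simp
  qed
  show "partition_on (C \<union> D) (P \<union> Q)"
  proof (rule partition_onI)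
    fix p q assume "p \<in> P \<union> Q" "q \<in> P \<union> Q" "p \<noteq> q"
    then show "disjnt p q"
      using P(2) Q(2) PQ unfolding disjoint_def disjnt_def by (metis Int_commute Un_iff)
  qed (use P Q in auto)
  show "{B \<in> P \<union> Q. B \<subseteq> C} = P" using P(1) QC by blast
  show "{B \<in> P \<union> Q. \<not> B \<subseteq> C} = Q" using P(1) QC by blast
qed

text \<open>Partitions are sorted by the block \<open>insert a Y\<close> that contains the
  distinguished element. Inductive evaluations of partition sums go through this recursion.\<close>

lemma part_sum_insert:
  assumes "finite X" "a \<notin> X"
  shows "part_sum u (insert a X) = (\<Sum>Y\<in>Pow X. u (insert a Y) * part_sum u (X - Y))"
proof -
  have "(\<Sum>Y\<in>Pow X. u (insert a Y) * part_sum u (X - Y)) =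
     (\<Sum>(Y, P)\<in>(SIGMA Y:Pow X. {P. partition_on (X - Y) P}). u (insert a Y) * (\<Prod>B\<in>P. u B))"
    unfolding part_sum_def sum_distrib_left
    by (rule sum.Sigma) (use assms finitely_many_partition_on in auto)
  also have "\<dots> = part_sum u (insert a X)"
    unfolding part_sum_def
  \<comment> \<open>The blocks containing \<open>a\<close> form a one-element family, so the union
    of that family names the block without a choice operator.\<close>
  proof (rule sum.reindex_bij_witness[where
        j = "\<lambda>(Y, P). insert (insert a Y) P"
        and i = "\<lambda>Q. (\<Union>{B \<in> Q. a \<in> B} - {a}, {B \<in> Q. a \<notin> B})"])
    fix YP assume "YP \<in> (SIGMA Y:Pow X. {P. partition_on (X - Y) P})"
    then obtain Y P where YP: "YP = (Y, P)" "Y \<subseteq> X" "partition_on (X - Y) P" by auto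
    have aP: "a \<notin> B" if "B \<in> P" for B
      using that YP(3) assms(2) by (auto simp: partition_on_def)
    have nP: "insert a Y \<notin> P" using aP by blast
    have e1: "{B \<in> insert (insert a Y) P. a \<in> B} = {insert a Y}" using aP by auto
    have e2: "{B \<in> insert (insert a Y) P. a \<notin> B} = P" using aP by auto
    show "(case case YP of (Y, P) \<Rightarrow> insert (insert a Y) P of
         Q \<Rightarrow> (\<Union>{B \<in> Q. a \<in> B} - {a}, {B \<in> Q. a \<notin> B})) = YP"
      using YP(2) assms(2) unfolding YP(1) prod.case e1 e2 by auto
    have "partition_on (insert a Y \<union> (X - Y)) ({insert a Y} \<union> P)"
      by (rule partition_on_join) (use YP assms in \<open>auto intro: partition_on_space\<close>)
    moreover have "insert a Y \<union> (X - Y) = insert a X" using YP(2) by auto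
    ultimately show "(case YP of (Y, P) \<Rightarrow> insert (insert a Y) P) \<in> {P. partition_on (insert a X) P}"
      by (simp add: YP(1))
    have "finite P" using YP(3) assms(1) finite_elements by blast
    then show "(\<Prod>B\<in>(case YP of (Y, P) \<Rightarrow> insert (insert a Y) P). u B) =
        (case YP of (Y, P) \<Rightarrow> u (insert a Y) * (\<Prod>B\<in>P. u B))"
      using nP by (simp add: YP(1))
  next
    fix Q assume "Q \<in> {P. partition_on (insert a X) P}"
    then have Q: "partition_on (insert a X) Q" by simp
    then obtain C where C: "C \<in> Q" "a \<in> C" by (auto simp: partition_on_def)
    have un: "B = C" if "B \<in> Q" "a \<in> B" for B
      using that C Q by (auto simp: partition_on_def disjoint_def)
    have e1: "{B \<in> Q. a \<in> B} = {C}" using C un by blast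
    have CX: "C \<subseteq> insert a X" using Q C by (auto simp: partition_on_def)
    have cl: "B \<inter> C \<noteq> {} \<Longrightarrow> B \<subseteq> C" if "B \<in> Q" for B
      using that C Q unfolding partition_on_def disjoint_def by (metis order_refl)
    have e2: "{B \<in> Q. a \<notin> B} = {B \<in> Q. \<not> B \<subseteq> C}"
    proof -
      have "a \<notin> B \<longleftrightarrow> \<not> B \<subseteq> C" if "B \<in> Q" for B
      proof
        assume "a \<notin> B"
        moreover have "B \<noteq> {}" using Q that by (auto simp: partition_on_def)
        ultimately show "\<not> B \<subseteq> C"
          using Q C that unfolding partition_on_def disjoint_def by blast
      next
        assume "\<not> B \<subseteq> C"
        then show "a \<notin> B" using un[OF that] by blast
      qed
      then show ?thesis by blast
    qed
    have "partition_on (insert a X - C) {B \<in> Q. a \<notin> B}"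
      unfolding e2 by (rule partition_on_split(2)[OF Q cl CX])
    moreover have "insert a X - C = X - (C - {a})" using C(2) assms(2) by auto
    ultimately show "(\<Union>{B \<in> Q. a \<in> B} - {a}, {B \<in> Q. a \<notin> B})
        \<in> (SIGMA Y:Pow X. {P. partition_on (X - Y) P})"
      using CX unfolding e1 by auto
    show "(case (\<Union>{B \<in> Q. a \<in> B} - {a}, {B \<in> Q. a \<notin> B}) of (Y, P) \<Rightarrow> insert (insert a Y) P) = Q"
          proof -
      have "insert a (C - {a}) = C" using C(2) by auto
      moreover have "Q = {B \<in> Q. a \<in> B} \<union> {B \<in> Q. a \<notin> B}" by blast
      ultimately show ?thesis unfolding e1 by simp
    qed
  qed
  finally show ?thesis ..
qed

lemma part_sum_cong:
  assumes "\<And>B. B \<subseteq> X \<Longrightarrow> u B = v B"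
  shows "part_sum u X = part_sum v X"
  unfolding part_sum_def
  by (rule sum.cong[OF refl], rule prod.cong[OF refl], rule assms) (auto simp: partition_on_def)

lemma sum_Pow_image:
  assumes "inj_on h X"
  shows "(\<Sum>Y\<in>Pow (h ` X). f Y) = (\<Sum>Y\<in>Pow X. f (h ` Y))"
proof -
  have "Pow (h ` X) = (`) h ` Pow X" by (auto simp: subset_image_iff)
  moreover have "inj_on ((`) h) (Pow X)" using assms inj_on_image_Pow by blast
  ultimately show ?thesis by (simp add: sum.reindex)
qed

text \<open>The recursion \<open>part_sum_insert\<close> has the same shape on both sides, so no
  partition has to be transported along \<open>h\<close>.\<close>

lemma part_sum_image:
  assumes "finite X" "inj_on h X"
  shows "part_sum u (h ` X) = part_sum (\<lambda>B. u (h ` B)) X"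
  using assms
proof (induction "card X" arbitrary: X rule: less_induct)
  case less
  show ?case
  proof (cases "X = {}")
    case False
    then obtain a Z where aZ: "X = insert a Z" "a \<notin> Z" by (metis Set.set_insert ex_in_conv)
    have fin: "finite Z" and inj: "inj_on h Z" and ha: "h a \<notin> h ` Z"
      using less.prems aZ by auto
    have "part_sum u (h ` X) = (\<Sum>Y\<in>Pow Z. u (h ` insert a Y) * part_sum u (h ` Z - h ` Y))"
      using part_sum_insert[of "h ` Z" "h a" u] fin ha aZ by (simp add: sum_Pow_image[OF inj])
    also have "\<dots> = (\<Sum>Y\<in>Pow Z. u (h ` insert a Y) * part_sum (\<lambda>B. u (h ` B)) (Z - Y))"
    proof (rule sum.cong[OF refl])
      fix Y assume Y: "Y \<in> Pow Z"
      have "h ` Z - h ` Y = h ` (Z - Y)" using Y inj by (simp add: inj_on_image_set_diff)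
      moreover have "card (Z - Y) < card X"
        using fin aZ by (metis Diff_subset card_insert_disjoint card_mono le_imp_less_Suc)
      moreover have "inj_on h (Z - Y)" using inj by (meson Diff_subset inj_on_subset)
      ultimately show "u (h ` insert a Y) * part_sum u (h ` Z - h ` Y) =
          u (h ` insert a Y) * part_sum (\<lambda>B. u (h ` B)) (Z - Y)"
        using less.hyps[of "Z - Y"] fin by simp
    qed
    also have "\<dots> = part_sum (\<lambda>B. u (h ` B)) X"
      using part_sum_insert[of Z a "\<lambda>B. u (h ` B)"] fin aZ by simp
    finally show ?thesis .
  qed simp
qed

section \<open>Connected pairs of partitions\<close>

text \<open>With elements read as edges and members of \<open>K\<close> as vertices, these are the
  sets that contain every edge adjacent to one of their own, that is, unions of connected
  components.\<close>

definition closed_under :: "'a set set \<Rightarrow> 'a set \<Rightarrow> bool" where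
  "closed_under K Y \<longleftrightarrow> (\<forall>B\<in>K. B \<inter> Y \<noteq> {} \<longrightarrow> B \<subseteq> Y)"

text \<open>
  For partitions \<open>P\<close> and \<open>Q\<close> of a set \<open>X\<close> of edges, \<open>connected_on X (P \<union> Q)\<close> says that the bipartite
  graph with vertices \<open>P\<close> and \<open>Q\<close> is connected.
\<close>

definition connected_on :: "'a set \<Rightarrow> 'a set set \<Rightarrow> bool" where
  "connected_on X K \<longleftrightarrow> (\<forall>Y\<subseteq>X. Y \<noteq> {} \<longrightarrow> closed_under K Y \<longrightarrow> Y = X)"

definition conn_sum :: "('a set \<Rightarrow> 'r::comm_ring_1) \<Rightarrow> ('a set \<Rightarrow> 'r) \<Rightarrow> 'a set \<Rightarrow> 'r" where
  "conn_sum u v X = (\<Sum>(P, Q) | partition_on X P \<and> partition_on X Q \<and> connected_on X (P \<union> Q).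
     (\<Prod>B\<in>P. u B) * (\<Prod>B\<in>Q. v B))"

text \<open>The least closed set containing \<open>a\<close>, taken over all sets of the type; the
  family is nonempty because the universe is closed. Minimality replaces arguments with
  paths.\<close>

definition component :: "'a set set \<Rightarrow> 'a \<Rightarrow> 'a set" where
  "component K a = \<Inter>{Y. a \<in> Y \<and> closed_under K Y}"

lemma closed_component: "closed_under K (component K a)"
  unfolding closed_under_def component_def by blast

lemma in_component: "a \<in> component K a"
  by (auto simp: component_def)

lemma component_subset: "a \<in> Y \<Longrightarrow> closed_under K Y \<Longrightarrow> component K a \<subseteq> Y"
  by (auto simp: component_def)

lemma closed_under_whole: "partition_on X P \<Longrightarrow> partition_on X Q \<Longrightarrow> closed_under (P \<union> Q) X"
  by (auto simp: closed_under_def partition_on_def)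

lemma finite_partition_pairs:
  "finite X \<Longrightarrow> finite {(P, Q). partition_on X P \<and> partition_on X Q \<and> R P Q}"
  by (rule finite_subset[of _ "{P. partition_on X P} \<times> {P. partition_on X P}"])
    (auto simp: finitely_many_partition_on)

text \<open>Both partitions are cut along the component of \<open>a\<close>: inside it the pair is
  connected, outside it is arbitrary. This is the recursion (component of a point times the rest)
  that \<open>exponential_formula\<close> turns into an exponential.\<close>

lemma part_sum_mult_insert:
  fixes u v :: "'a set \<Rightarrow> 'r::comm_ring_1"
  assumes "finite X" "a \<notin> X"
  shows "part_sum u (insert a X) * part_sum v (insert a X) =
    (\<Sum>Y\<in>Pow X. conn_sum u v (insert a Y) * (part_sum u (X - Y) * part_sum v (X - Y)))"
proof -
  let ?D = "{(P, Q). partition_on (insert a X) P \<and> partition_on (insert a X) Q}"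
  let ?C = "\<lambda>Y. {(P, Q). partition_on (insert a Y) P \<and> partition_on (insert a Y) Q \<and>
      connected_on (insert a Y) (P \<union> Q)}"
  let ?E = "\<lambda>Y. {(P, Q). partition_on (X - Y) P \<and> partition_on (X - Y) Q}"
  let ?w = "\<lambda>(P, Q). (\<Prod>B\<in>P. u B) * (\<Prod>B\<in>Q. v B)"
  have prod_eq: "part_sum u Z * part_sum v Z = sum ?w {(P, Q). partition_on Z P \<and> partition_on Z Q}" for Z
  proof -
    have "part_sum u Z * part_sum v Z = sum ?w ({P. partition_on Z P} \<times> {P. partition_on Z P})"
      unfolding part_sum_def sum_product sum.cartesian_product by simp
    moreover have "{P. partition_on Z P} \<times> {P. partition_on Z P} =
       {(P, Q). partition_on Z P \<and> partition_on Z Q}" by auto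
    ultimately show ?thesis by (simp only:)
  qed
  have finC: "finite (?C Y)" if "Y \<subseteq> X" for Y
  proof -
    have "finite (insert a Y)" using that assms(1) finite_subset by auto
    then show ?thesis by (rule finite_partition_pairs)
  qed
  have finE: "finite (?E Y)" for Y
    using finite_partition_pairs[of "X - Y" "\<lambda>_ _. True"] assms(1) by simp
  define j where "j = (\<lambda>(Y :: 'a set, (P :: 'a set set, Q :: 'a set set), (P', Q')). (P \<union> P', Q \<union> Q'))"
  define i where "i = (\<lambda>(P, Q). let C = component (P \<union> Q) a in (C - {a},
            ({B \<in> P. B \<subseteq> C}, {B \<in> Q. B \<subseteq> C}), ({B \<in> P. \<not> B \<subseteq> C}, {B \<in> Q. \<not> B \<subseteq> C})))"
  have "(\<Sum>Y\<in>Pow X. conn_sum u v (insert a Y) * (part_sum u (X - Y) * part_sum v (X - Y))) =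
    (\<Sum>Y\<in>Pow X. \<Sum>(s, t)\<in>?C Y \<times> ?E Y. ?w s * ?w t)"
    unfolding prod_eq conn_sum_def sum_product sum.cartesian_product by simp
  also have "\<dots> = (\<Sum>(Y, s, t)\<in>(SIGMA Y:Pow X. ?C Y \<times> ?E Y). ?w s * ?w t)"
    by (rule sum.Sigma) (use assms finC finE in \<open>simp_all add: finite_cartesian_product\<close>)
  also have "\<dots> = sum ?w ?D"
  proof (rule sum.reindex_bij_witness[where j = j and i = i])
    fix z assume "z \<in> (SIGMA Y:Pow X. ?C Y \<times> ?E Y)"
    then obtain Y P Q P' Q' where z: "z = (Y, (P, Q), (P', Q'))" "Y \<subseteq> X"
      and P: "partition_on (insert a Y) P" and Q: "partition_on (insert a Y) Q"
      and conn: "connected_on (insert a Y) (P \<union> Q)"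
      and P': "partition_on (X - Y) P'" and Q': "partition_on (X - Y) Q'" by auto
    have disj: "insert a Y \<inter> (X - Y) = {}" using assms(2) by auto
    have un: "insert a Y \<union> (X - Y) = insert a X" using z by auto
    note jP = partition_on_join[OF P P' disj] and jQ = partition_on_join[OF Q Q' disj]
    let ?K = "(P \<union> P') \<union> (Q \<union> Q')"
    \<comment> \<open>No block of the joined pair crosses \<open>insert a Y\<close>, so the
      component of \<open>a\<close> stays inside; connectedness of the inner pair then forces it to
      be all of \<open>insert a Y\<close>.\<close>
    have cl: "closed_under ?K (insert a Y)"
      using P Q P' Q' disj unfolding closed_under_def partition_on_def by blast
    have sub: "component ?K a \<subseteq> insert a Y" by (rule component_subset[OF _ cl]) simp
    moreover have "closed_under (P \<union> Q) (component ?K a)"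
      using closed_component[of ?K a] by (auto simp: closed_under_def)
    ultimately have comp: "component ?K a = insert a Y"
      using conn in_component[of a ?K] unfolding connected_on_def by blast
    have aY: "insert a Y - {a} = Y" using z assms by auto
    show "i (j z) = z"
      by (simp only: i_def j_def z(1) prod.case Let_def comp jP(2,3) jQ(2,3) aY)
    show "j z \<in> ?D"
      using jP(1) jQ(1) un by (simp add: z(1) j_def)
    have split: "prod f (A \<union> A') = prod f A * prod f A'" 
      if "partition_on (insert a Y) A" "partition_on (X - Y) A'" for f :: "'a set \<Rightarrow> 'r" and A A'
    proof -
      have "finite (insert a Y)" "finite (X - Y)"
        using z(2) assms(1) finite_subset by auto
      then have "finite A" "finite A'" using that finite_elements by blast+
      moreover have "A \<inter> A' = {}"
      proof -
        note J = partition_on_join(2,3)[OF that disj]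
        have "A \<inter> A' = {B \<in> A \<union> A'. B \<subseteq> insert a Y} \<inter> {B \<in> A \<union> A'. \<not> B \<subseteq> insert a Y}"
          by (simp only: J)
        also have "\<dots> = {}" by auto
        finally show ?thesis .
      qed
      ultimately show ?thesis by (rule prod.union_disjoint)
    qed
    show "?w (j z) = (case z of (Y, s, t) \<Rightarrow> ?w s * ?w t)"
      by (simp add: z(1) j_def split P Q P' Q' mult_ac)
  next
    fix z assume "z \<in> ?D"
    then obtain P Q where z: "z = (P, Q)" and P: "partition_on (insert a X) P"
      and Q: "partition_on (insert a X) Q" by auto
    define C where "C = component (P \<union> Q) a"
    have CX: "C \<subseteq> insert a X"
      unfolding C_def by (rule component_subset[OF _ closed_under_whole[OF P Q]]) simp
    have aC: "a \<in> C" by (simp add: C_def in_component)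
    have cl: "closed_under (P \<union> Q) C" by (simp add: C_def closed_component)
    then have clP: "B \<in> P \<Longrightarrow> B \<inter> C \<noteq> {} \<Longrightarrow> B \<subseteq> C" and clQ: "B \<in> Q \<Longrightarrow> B \<inter> C \<noteq> {} \<Longrightarrow> B \<subseteq> C" for B
      by (auto simp: closed_under_def)
    note sP = partition_on_split[OF P clP CX] and sQ = partition_on_split[OF Q clQ CX]
    have CC: "insert a (C - {a}) = C" and XC: "X - (C - {a}) = insert a X - C"
      using aC assms(2) by auto
    have conn: "connected_on C ({B \<in> P. B \<subseteq> C} \<union> {B \<in> Q. B \<subseteq> C})"
      unfolding connected_on_def
    proof (intro allI impI)
      fix Y assume Y: "Y \<subseteq> C" "Y \<noteq> {}" and clY: "closed_under ({B \<in> P. B \<subseteq> C} \<union> {B \<in> Q. B \<subseteq> C}) Y"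
      have cl1: "closed_under (P \<union> Q) Y"
        unfolding closed_under_def
      proof (intro ballI impI)
        fix B assume B: "B \<in> P \<union> Q" "B \<inter> Y \<noteq> {}"
        then have "B \<subseteq> C" using clP clQ Y by blast
        with B clY show "B \<subseteq> Y" by (auto simp: closed_under_def)
      qed
      \<comment> \<open>The complement of \<open>Y\<close> in \<open>C\<close> is closed too, so
        whichever of the two contains \<open>a\<close> is all of \<open>C\<close> by minimality of
        the component.\<close>
      have cl2: "closed_under (P \<union> Q) (C - Y)"
        unfolding closed_under_def
      proof (intro ballI impI)
        fix B assume B: "B \<in> P \<union> Q" "B \<inter> (C - Y) \<noteq> {}"
        then have "B \<subseteq> C" using clP clQ by blast
        moreover have "B \<inter> Y = {}" using B cl1 by (auto simp: closed_under_def)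
        ultimately show "B \<subseteq> C - Y" by blast
      qed
      show "Y = C"
      proof (cases "a \<in> Y")
        case True
        then show ?thesis using component_subset[OF True cl1] Y by (auto simp: C_def)
      next
        case False
        then have "C \<subseteq> C - Y" using component_subset[OF _ cl2] aC by (simp add: C_def)
        then show ?thesis using Y by blast
      qed
    qed
    show "j (i z) = z"
      by (auto simp: z i_def j_def Let_def)
    show "i z \<in> (SIGMA Y:Pow X. ?C Y \<times> ?E Y)"
      using sP sQ conn CX
      unfolding z i_def prod.case C_def[symmetric] Let_def
      by (auto simp: CC XC insert_absorb[OF aC])
  qed
  also have "\<dots> = part_sum u (insert a X) * part_sum v (insert a X)"
    by (simp add: prod_eq)
  finally show ?thesis ..
qed

text \<open>Solved for the term \<open>Y = X\<close>, the recursion determines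
  \<open>conn_sum\<close> from partition sums and from its values on smaller sets.\<close>

lemma conn_sum_insert:
  assumes "finite X" "a \<notin> X"
  shows "conn_sum u v (insert a X) = part_sum u (insert a X) * part_sum v (insert a X) -
    (\<Sum>Y\<in>Pow X - {X}. conn_sum u v (insert a Y) * (part_sum u (X - Y) * part_sum v (X - Y)))"
  unfolding part_sum_mult_insert[OF assms]
  using assms by (subst sum.remove[of "Pow X" X]) auto

text \<open>Inherited from \<open>part_sum_image\<close> by induction over
  \<open>conn_sum_insert\<close>, whose right-hand side involves connected sums over smaller sets
  alone.\<close>

lemma conn_sum_image:
  assumes "finite X" "inj_on h X" "X \<noteq> {}"
  shows "conn_sum u v (h ` X) = conn_sum (\<lambda>B. u (h ` B)) (\<lambda>B. v (h ` B)) X"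
  using assms
proof (induction "card X" arbitrary: X rule: less_induct)
  case less
  then obtain a Z where aZ: "X = insert a Z" "a \<notin> Z" by (metis Set.set_insert ex_in_conv)
  have fin: "finite Z" and inj: "inj_on h Z" and ha: "h a \<notin> h ` Z"
    using less.prems aZ by auto
  let ?u = "\<lambda>B. u (h ` B)" and ?v = "\<lambda>B. v (h ` B)"
  have Pow: "Pow (h ` Z) - {h ` Z} = (`) h ` (Pow Z - {Z})"
  proof -
    have "Pow (h ` Z) = (`) h ` Pow Z" by (auto simp: subset_image_iff)
    moreover have "(`) h ` (Pow Z - {Z}) = (`) h ` Pow Z - (`) h ` {Z}"
      by (rule inj_on_image_set_diff[OF inj_on_image_Pow[OF inj]]) auto
    ultimately show ?thesis by simp
  qed
  have inj2: "inj_on ((`) h) (Pow Z - {Z})" using inj inj_on_image_Pow by (meson Diff_subset inj_on_subset)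
  have eq: "conn_sum u v (insert (h a) (h ` Y)) * (part_sum u (h ` Z - h ` Y) * part_sum v (h ` Z - h ` Y))
      = conn_sum ?u ?v (insert a Y) * (part_sum ?u (Z - Y) * part_sum ?v (Z - Y))"
    if Y: "Y \<in> Pow Z - {Z}" for Y
  proof -
    have d: "h ` Z - h ` Y = h ` (Z - Y)" using Y inj by (simp add: inj_on_image_set_diff)
    have "Y \<subset> Z" using Y by auto
    then have "card (insert a Y) < card X"
      using fin aZ by (metis card_insert_disjoint finite_subset psubset_card_mono psubsetE
          Suc_less_eq subsetD)
    moreover have "inj_on h (insert a Y)" using less.prems Y aZ by (auto intro: inj_on_subset)
    moreover have "finite (insert a Y)" using Y fin by (auto intro: finite_subset)
    ultimately have "conn_sum u v (h ` insert a Y) = conn_sum ?u ?v (insert a Y)"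
      using less.hyps[of "insert a Y"] by simp
    moreover have "inj_on h (Z - Y)" using inj by (meson Diff_subset inj_on_subset)
    ultimately show ?thesis using fin by (simp add: d part_sum_image)
  qed
  have "conn_sum u v (h ` X) = part_sum u (h ` X) * part_sum v (h ` X) -
    (\<Sum>Y\<in>Pow Z - {Z}. conn_sum u v (insert (h a) (h ` Y)) * (part_sum u (h ` Z - h ` Y) * part_sum v (h ` Z - h ` Y)))"
    using conn_sum_insert[of "h ` Z" "h a" u v] fin ha
    by (simp add: aZ Pow sum.reindex[OF inj2])
  also have "\<dots> = part_sum ?u X * part_sum ?v X - 
    (\<Sum>Y\<in>Pow Z - {Z}. conn_sum ?u ?v (insert a Y) * (part_sum ?u (Z - Y) * part_sum ?v (Z - Y)))"
    unfolding part_sum_image[OF less.prems(1,2)]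
    by (rule arg_cong[where f = "minus _"], rule sum.cong[OF refl], rule eq)
  also have "\<dots> = conn_sum ?u ?v X"
    using conn_sum_insert[of Z a ?u ?v] fin aZ by simp
  finally show ?case .
qed

lemma conn_sum_cong:
  assumes "\<And>B. B \<subseteq> X \<Longrightarrow> u B = u' B" "\<And>B. B \<subseteq> X \<Longrightarrow> v B = v' B"
  shows "conn_sum u v X = conn_sum u' v' X"
proof -
  have "prod u P = prod u' P" "prod v P = prod v' P" if "partition_on X P" for P
    using that assms by (auto simp: partition_on_def intro!: prod.cong)
  then show ?thesis unfolding conn_sum_def by (intro sum.cong) auto
qed

section \<open>Partial derivatives of smooth functions\<close>

lemma partial_eq: "(f has_derivative f') (at y) \<Longrightarrow> partial a f y = f' (axis a 1)"
  unfolding partial_def by (metis frechet_derivative_at)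

lemma partial_cong:
  assumes "open U" "y \<in> U" "\<And>z. z \<in> U \<Longrightarrow> f z = g z"
  shows "partial a f y = partial a g y"
proof -
  have "(f has_derivative D) (at y) \<longleftrightarrow> (g has_derivative D) (at y)" for D
    using has_derivative_transform_within_open[OF _ assms(1,2), of f D UNIV g]
      has_derivative_transform_within_open[OF _ assms(1,2), of g D UNIV f] assms(3) by auto
  then show ?thesis by (simp add: partial_def frechet_derivative_def)
qed

text \<open>Each differentiation looks at a neighbourhood, so the induction runs over all points of
  the open set at once.\<close>

lemma foldr_partial_cong:
  assumes "open U" "\<And>z. z \<in> U \<Longrightarrow> f z = g z" "y \<in> U"
  shows "foldr partial J f y = foldr partial J g y"
  using assms(3)
proof (induction J arbitrary: y)
  case (Cons a J)
  show ?case using partial_cong[OF assms(1) Cons.prems Cons.IH] by simp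
qed (simp add: assms)

lemma differentiable_at_cong:
  assumes "open U" "y \<in> U" "\<And>z. z \<in> U \<Longrightarrow> f z = g z" "f differentiable (at y)"
  shows "g differentiable (at y)"
  using assms(4) has_derivative_transform_within_open[OF _ assms(1,2), of f _ UNIV g] assms(3)
  unfolding differentiable_def by auto

lemma smooth_on_iff:
  "open U \<Longrightarrow> smooth_on U f \<longleftrightarrow> (\<forall>J. \<forall>y\<in>U. foldr partial J f differentiable (at y))"
  by (simp add: smooth_on_def differentiable_on_eq_differentiable_at)

lemma smooth_on_partial: "smooth_on U f \<Longrightarrow> smooth_on U (partial a f)"
  unfolding smooth_on_def
proof
  fix J assume "\<forall>J. foldr partial J f differentiable_on U"
  \<comment> \<open>\<open>foldr\<close> applies the last index first, so a derivative of
    \<open>partial a f\<close> along \<open>J\<close> is a derivative of \<open>f\<close> along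
    \<open>J @ [a]\<close>.\<close>
  then have "foldr partial (J @ [a]) f differentiable_on U" by blast
  then show "foldr partial J (partial a f) differentiable_on U" by simp
qed

lemma partial_const: "partial a (\<lambda>_. c) = (\<lambda>_. 0)"
  by (rule ext) (subst partial_eq[OF has_derivative_const], simp)

lemma foldr_partial_const: "\<exists>d. foldr partial J (\<lambda>_. c) = (\<lambda>_. d)"
  by (induction J) (auto simp: partial_const)

lemma smooth_on_const:
  fixes U :: "(real^'b::finite) set"
  shows "smooth_on U (\<lambda>_. c)"
  unfolding smooth_on_def
proof
  fix J :: "'b list"
  obtain d where "foldr partial J (\<lambda>_. c) = (\<lambda>_. d)" using foldr_partial_const by blast
  then show "foldr partial J (\<lambda>_. c) differentiable_on U" by simp
qed

lemma partial_add:
  assumes "f differentiable (at y)" "g differentiable (at y)"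
  shows "partial a (\<lambda>z. f z + g z) y = partial a f y + partial a g y"
proof -
  obtain f' g' where "(f has_derivative f') (at y)" "(g has_derivative g') (at y)"
    using assms by (auto simp: differentiable_def)
  note fg = this
  show ?thesis
    unfolding partial_eq[OF has_derivative_add[OF fg]] partial_eq[OF fg(1)] partial_eq[OF fg(2)] ..
qed

lemma partial_mult:
  assumes "f differentiable (at y)" "g differentiable (at y)"
  shows "partial a (\<lambda>z. f z * g z) y = partial a f y * g y + f y * partial a g y"
proof -
  obtain f' g' where fg: "(f has_derivative f') (at y)" "(g has_derivative g') (at y)"
    using assms by (auto simp: differentiable_def)
  have "partial a (\<lambda>z. f z * g z) y = f y * g' (axis a 1) + f' (axis a 1) * g y"
    by (rule partial_eq[OF has_derivative_mult[OF fg]])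
  then show ?thesis using partial_eq[OF fg(1)] partial_eq[OF fg(2)] by simp
qed

lemma partial_sum_list:
  assumes "\<And>x. x \<in> set xs \<Longrightarrow> f x differentiable (at y)"
  shows "partial a (\<lambda>z. \<Sum>x\<leftarrow>xs. f x z) y = (\<Sum>x\<leftarrow>xs. partial a (f x) y)
    \<and> (\<lambda>z. \<Sum>x\<leftarrow>xs. f x z) differentiable (at y)"
  using assms
proof (induction xs)
  case Nil then show ?case by (simp add: partial_const)
next
  case (Cons x xs)
  then show ?case by (simp add: partial_add differentiable_add)
qed

lemma foldr_partial_add:
  assumes "open U" "smooth_on U f" "smooth_on U g" "y \<in> U"
  shows "foldr partial J (\<lambda>z. f z + g z) y = foldr partial J f y + foldr partial J g y"
  using assms(4)
proof (induction J arbitrary: y)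
  case (Cons a J)
  have "foldr partial (a # J) (\<lambda>z. f z + g z) y = partial a (\<lambda>z. foldr partial J f z + foldr partial J g z) y"
    using partial_cong[OF assms(1) Cons.prems Cons.IH] by simp
  also have "\<dots> = foldr partial (a # J) f y + foldr partial (a # J) g y"
    using assms(1-3) Cons.prems by (simp add: partial_add smooth_on_iff)
  finally show ?case .
qed simp

lemma smooth_on_add:
  assumes "open U" "smooth_on U f" "smooth_on U g"
  shows "smooth_on U (\<lambda>z. f z + g z)"
  unfolding smooth_on_iff[OF assms(1)]
proof (intro allI ballI)
  fix J y assume y: "y \<in> U"
  show "foldr partial J (\<lambda>z. f z + g z) differentiable (at y)"
    by (rule differentiable_at_cong[OF assms(1) y foldr_partial_add[OF assms, symmetric]])
      (use assms y in \<open>auto simp: smooth_on_iff intro!: differentiable_add\<close>)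
qed

lemma smooth_on_sum:
  assumes "open U" "\<And>i. i \<in> A \<Longrightarrow> smooth_on U (f i)"
  shows "smooth_on U (\<lambda>z. \<Sum>i\<in>A. f i z)"
  using assms(2)
  by (induction A rule: infinite_finite_induct) (auto simp: smooth_on_const smooth_on_add[OF assms(1)])

lemma foldr_partial_sum:
  assumes "open U" "\<And>i. i \<in> A \<Longrightarrow> smooth_on U (f i)" "y \<in> U" "finite A"
  shows "foldr partial J (\<lambda>z. \<Sum>i\<in>A. f i z) y = (\<Sum>i\<in>A. foldr partial J (f i) y)"
  using assms(4,2)
proof (induction A)
  case empty
  have "foldr partial J (\<lambda>_. 0) = (\<lambda>_. 0)" for J :: "'a list"
    by (induction J) (auto simp: partial_const)
  then show ?case by simp
next
  case (insert x A)
  then show ?case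
    by (simp add: foldr_partial_add[OF assms(1) _ _ assms(3)] smooth_on_sum[OF assms(1)])
qed

text \<open>The ways of distributing the derivatives over two factors in the Leibniz rule. They are
  kept as a list because repeated indices produce equal terms that have to be counted
  separately.\<close>

fun splits :: "'a list \<Rightarrow> ('a list \<times> 'a list) list" where
  "splits [] = [([], [])]"
| "splits (a # J) = map (\<lambda>(P, Q). (a # P, Q)) (splits J) @ map (\<lambda>(P, Q). (P, a # Q)) (splits J)"

text \<open>Differentiability is carried along with the formula, so that smoothness of products can
  be read off.\<close>

lemma foldr_partial_mult:
  assumes "open U" "smooth_on U f" "smooth_on U g" "y \<in> U"
  shows "foldr partial J (\<lambda>z. f z * g z) y =
      (\<Sum>(P, Q)\<leftarrow>splits J. foldr partial P f y * foldr partial Q g y)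
    \<and> foldr partial J (\<lambda>z. f z * g z) differentiable (at y)"
  using assms(4)
proof (induction J arbitrary: y)
  case Nil
  then show ?case using assms smooth_on_iff[OF assms(1)]
    by (auto intro!: differentiable_mult dest: spec[where x = "[]"])
next
  case (Cons a J)
  let ?F = "\<lambda>PQ z. foldr partial (fst PQ) f z * foldr partial (snd PQ) g z"
  have df: "foldr partial P f differentiable (at z)" and dg: "foldr partial P g differentiable (at z)"
    if "z \<in> U" for P z
    using assms that by (auto simp: smooth_on_iff)
  have dF: "?F PQ differentiable (at z)" if "z \<in> U" for PQ z
    using that by (intro differentiable_mult df dg)
  have eq: "foldr partial (a # J) (\<lambda>z. f z * g z) z =
      (\<Sum>(P, Q)\<leftarrow>splits (a # J). foldr partial P f z * foldr partial Q g z)" if z: "z \<in> U" for z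
  proof -
    have "foldr partial (a # J) (\<lambda>z. f z * g z) z = partial a (\<lambda>z. \<Sum>x\<leftarrow>splits J. ?F x z) z"
      using partial_cong[OF assms(1) z Cons.IH[THEN conjunct1]] by (simp add: case_prod_beta)
    also have "\<dots> = (\<Sum>x\<leftarrow>splits J. partial a (?F x) z)"
      by (rule partial_sum_list[THEN conjunct1]) (rule dF[OF z])
    also have "\<dots> = (\<Sum>x\<leftarrow>splits J. foldr partial (a # fst x) f z * foldr partial (snd x) g z +
        foldr partial (fst x) f z * foldr partial (a # snd x) g z)"
      using df[OF z] dg[OF z] by (simp add: partial_mult)
    also have "\<dots> = (\<Sum>(P, Q)\<leftarrow>splits (a # J). foldr partial P f z * foldr partial Q g z)"
      by (simp add: sum_list_addf case_prod_beta o_def)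
    finally show ?thesis .
  qed
  have "(\<lambda>z. \<Sum>x\<leftarrow>splits (a # J). ?F x z) differentiable (at y)"
    by (rule partial_sum_list[THEN conjunct2]) (rule dF[OF Cons.prems])
  then have "foldr partial (a # J) (\<lambda>z. f z * g z) differentiable (at y)"
    by (rule differentiable_at_cong[OF assms(1) Cons.prems, rotated]) (simp add: eq case_prod_unfold del: splits.simps foldr.simps)
  then show ?case using eq[OF Cons.prems] by blast
qed

lemma smooth_on_mult:
  assumes "open U" "smooth_on U f" "smooth_on U g"
  shows "smooth_on U (\<lambda>z. f z * g z)"
  using foldr_partial_mult[OF assms] by (simp add: smooth_on_iff[OF assms(1)])

section \<open>Symmetry of second derivatives\<close>

lemma partial_line:
  assumes "f differentiable (at (z + t *\<^sub>R axis a 1))"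
  shows "((\<lambda>t. Re (f (z + t *\<^sub>R axis a 1))) has_real_derivative Re (partial a f (z + t *\<^sub>R axis a 1))) (at t)"
proof -
  obtain D where D: "(f has_derivative D) (at (z + t *\<^sub>R axis a 1))"
    using assms by (auto simp: differentiable_def)
  have "((\<lambda>t. z + t *\<^sub>R axis a 1) has_derivative (\<lambda>s. s *\<^sub>R axis a 1)) (at t)"
    by (auto intro!: derivative_eq_intros)
  from diff_chain_at[OF this D]
  have "((\<lambda>t. f (z + t *\<^sub>R axis a 1)) has_derivative (\<lambda>s. D (s *\<^sub>R axis a 1))) (at t)"
    by (simp add: o_def)
  then have "((\<lambda>t. Re (f (z + t *\<^sub>R axis a 1))) has_derivative (\<lambda>s. Re (D (s *\<^sub>R axis a 1)))) (at t)"
    by (rule has_derivative_Re)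
  moreover have "Re (D (s *\<^sub>R axis a 1)) = Re (partial a f (z + t *\<^sub>R axis a 1)) * s" for s
    using linear_scale[OF has_derivative_linear[OF D]] partial_eq[OF D] by simp
  ultimately show ?thesis by (simp add: has_field_derivative_def)
qed

text \<open>Exchanging \<open>a\<close> and \<open>b\<close> does not change the left-hand side, hence the symmetry of second derivatives.\<close>

lemma mixed_difference:
  assumes "open U" "smooth_on U f" "0 < h"
    and U: "\<And>s t. 0 \<le> s \<Longrightarrow> s \<le> h \<Longrightarrow> 0 \<le> t \<Longrightarrow> t \<le> h \<Longrightarrow> y + s *\<^sub>R axis a 1 + t *\<^sub>R axis b 1 \<in> U"
  obtains s t where "0 \<le> s" "s \<le> h" "0 \<le> t" "t \<le> h"
    "Re (f (y + h *\<^sub>R axis a 1 + h *\<^sub>R axis b 1) - f (y + h *\<^sub>R axis b 1) - f (y + h *\<^sub>R axis a 1) + f y) =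
     h * h * Re (partial b (partial a f) (y + s *\<^sub>R axis a 1 + t *\<^sub>R axis b 1))"
proof -
  have d: "g differentiable (at z)" if "smooth_on U g" "z \<in> U" for g z
    using that smooth_on_iff[OF assms(1)] by (metis foldr_Nil id_apply)
  let ?p = "\<lambda>s. Re (f ((y + h *\<^sub>R axis b 1) + s *\<^sub>R axis a 1)) - Re (f (y + s *\<^sub>R axis a 1))"
  let ?p' = "\<lambda>s. Re (partial a f ((y + h *\<^sub>R axis b 1) + s *\<^sub>R axis a 1)) - Re (partial a f (y + s *\<^sub>R axis a 1))"
  have 1: "(?p has_real_derivative ?p' s) (at s)" if "0 \<le> s" "s \<le> h" for s
  proof (intro DERIV_diff partial_line d assms(2))
    show "y + s *\<^sub>R axis a 1 \<in> U" using U[of s 0] that assms(3) by simp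
    show "y + h *\<^sub>R axis b 1 + s *\<^sub>R axis a 1 \<in> U" using U[of s h] that assms(3) by (simp add: algebra_simps)
  qed
  obtain s where s: "0 < s" "s < h" "?p h - ?p 0 = (h - 0) * ?p' s"
    using MVT2[OF assms(3), of ?p ?p'] 1 by blast
  let ?q = "\<lambda>t. Re (partial a f ((y + s *\<^sub>R axis a 1) + t *\<^sub>R axis b 1))"
  let ?q' = "\<lambda>t. Re (partial b (partial a f) ((y + s *\<^sub>R axis a 1) + t *\<^sub>R axis b 1))"
  have 2: "(?q has_real_derivative ?q' t) (at t)" if "0 \<le> t" "t \<le> h" for t
    by (intro partial_line d smooth_on_partial assms(2) U) (use that s in auto)
  obtain t where t: "0 < t" "t < h" "?q h - ?q 0 = (h - 0) * ?q' t"
    using MVT2[OF assms(3), of ?q ?q'] 2 by blast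
  have "?p' s = ?q h - ?q 0" by (simp add: algebra_simps)
  then have "?p h - ?p 0 = h * h * ?q' t" using s(3) t(3) by simp
  then show ?thesis
    by (intro that[of s t]) (use s t in \<open>simp_all add: algebra_simps\<close>)
qed

text \<open>Schwarz's argument: the second difference over a square of side \<open>h\<close> equals
  \<open>h * h\<close> times either mixed derivative at some point of the square, and both
  derivatives are continuous. Real parts appear because the mean value theorem behind
  \<open>mixed_difference\<close> fails for complex values.\<close>

lemma Re_partial_commute:
  assumes "open U" "smooth_on U f" "y \<in> U"
  shows "Re (partial a (partial b f) y) = Re (partial b (partial a f) y)"
proof (rule ccontr)
  let ?A = "\<lambda>z. Re (partial a (partial b f) z)" and ?B = "\<lambda>z. Re (partial b (partial a f) z)"
  assume "?A y \<noteq> ?B y"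
  \<comment> \<open>Half of the supposed gap: no number lies within less than \<open>e\<close> of
    both values at \<open>y\<close>.\<close>
  define e where "e = \<bar>?A y - ?B y\<bar> / 2"
  have e: "e > 0" using \<open>?A y \<noteq> ?B y\<close> by (simp add: e_def)
  have cont: "continuous (at y) (partial c (partial d f))" for c d
  proof -
    have "smooth_on U (partial c (partial d f))" by (intro smooth_on_partial assms(2))
    then have "partial c (partial d f) differentiable (at y)"
      using assms smooth_on_iff[OF assms(1)] by (metis foldr_Nil id_apply)
    then show ?thesis by (rule differentiable_imp_continuous_within)
  qed
  have "\<exists>d>0. \<forall>z. dist z y < d \<longrightarrow> \<bar>Re (partial c (partial c' f) z) - Re (partial c (partial c' f) y)\<bar> < e" for c c'
  proof -
    obtain d where "d > 0" "\<forall>z. dist z y < d \<longrightarrow> dist (partial c (partial c' f) z) (partial c (partial c' f) y) < e"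
      using cont[of c c'] e unfolding continuous_at_eps_delta by blast
    then show ?thesis
      by (metis abs_Re_le_cmod dist_norm minus_complex.sel(1) order_le_less_trans)
  qed
  then obtain d1 d2 where d1: "d1 > 0" "\<And>z. dist z y < d1 \<Longrightarrow> \<bar>?A z - ?A y\<bar> < e"
    and d2: "d2 > 0" "\<And>z. dist z y < d2 \<Longrightarrow> \<bar>?B z - ?B y\<bar> < e"
    by metis
  obtain r where r: "r > 0" "\<And>z. dist z y < r \<Longrightarrow> z \<in> U"
    using assms(1,3) unfolding open_dist by blast
  \<comment> \<open>A third of the radii, since points of the square have distance at most
    \<open>2 * h\<close> from \<open>y\<close>.\<close>
  define h where "h = min r (min d1 d2) / 3"
  have h: "h > 0" "2 * h < r" "2 * h < d1" "2 * h < d2"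
    using r d1 d2 unfolding h_def by auto
  have dist: "dist (y + s *\<^sub>R axis a' 1 + t *\<^sub>R axis b' 1) y \<le> 2 * h"
    if "0 \<le> s" "s \<le> h" "0 \<le> t" "t \<le> h" for s t and a' b' :: 'a
  proof -
    have "dist (y + s *\<^sub>R axis a' 1 + t *\<^sub>R axis b' 1) y = norm (s *\<^sub>R axis a' 1 + t *\<^sub>R (axis b' 1 :: real^'a))"
      by (simp add: dist_norm algebra_simps)
    also have "\<dots> \<le> s + t"
      by (rule order.trans[OF norm_triangle_ineq]) (use that in \<open>simp add: norm_axis_1\<close>)
    finally show ?thesis using that by simp
  qed
  have inU: "y + s *\<^sub>R axis a' 1 + t *\<^sub>R axis b' 1 \<in> U"
    if "0 \<le> s" "s \<le> h" "0 \<le> t" "t \<le> h" for s t and a' b' :: 'a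
    by (rule r(2), rule order_le_less_trans[OF dist[OF that] h(2)])
  obtain s t where st: "0 \<le> s" "s \<le> h" "0 \<le> t" "t \<le> h" and
    1: "Re (f (y + h *\<^sub>R axis a 1 + h *\<^sub>R axis b 1) - f (y + h *\<^sub>R axis b 1) - f (y + h *\<^sub>R axis a 1) + f y) =
     h * h * ?B (y + s *\<^sub>R axis a 1 + t *\<^sub>R axis b 1)"
    by (rule mixed_difference[OF assms(1,2) h(1), of y a b])
      (use inU in blast)+
  obtain s' t' where st': "0 \<le> s'" "s' \<le> h" "0 \<le> t'" "t' \<le> h" and
    2: "Re (f (y + h *\<^sub>R axis b 1 + h *\<^sub>R axis a 1) - f (y + h *\<^sub>R axis a 1) - f (y + h *\<^sub>R axis b 1) + f y) =
     h * h * ?A (y + s' *\<^sub>R axis b 1 + t' *\<^sub>R axis a 1)"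
    by (rule mixed_difference[OF assms(1,2) h(1), of y b a])
      (use inU in blast)+
  have "h * h * ?A (y + s' *\<^sub>R axis b 1 + t' *\<^sub>R axis a 1) = h * h * ?B (y + s *\<^sub>R axis a 1 + t *\<^sub>R axis b 1)"
    unfolding 1[symmetric] 2[symmetric] by (simp add: algebra_simps)
  then have "?A (y + s' *\<^sub>R axis b 1 + t' *\<^sub>R axis a 1) = ?B (y + s *\<^sub>R axis a 1 + t *\<^sub>R axis b 1)"
    using h(1) by simp
  moreover have "\<bar>?A (y + s' *\<^sub>R axis b 1 + t' *\<^sub>R axis a 1) - ?A y\<bar> < e"
    by (rule d1(2)[OF order_le_less_trans[OF dist[OF st'] h(3)]])
  moreover have "\<bar>?B (y + s *\<^sub>R axis a 1 + t *\<^sub>R axis b 1) - ?B y\<bar> < e"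
    by (rule d2(2)[OF order_le_less_trans[OF dist[OF st] h(4)]])
  moreover have "\<bar>a - b\<bar> \<le> \<bar>u - a\<bar> + \<bar>u - b\<bar>" for a b u :: real
    by arith
  ultimately show False unfolding e_def
    by (smt (verit) field_sum_of_halves)
qed

lemma partial_commute:
  assumes "open U" "smooth_on U f" "y \<in> U"
  shows "partial a (partial b f) y = partial b (partial a f) y"
proof (rule complex_eqI)
  show "Re (partial a (partial b f) y) = Re (partial b (partial a f) y)"
    by (rule Re_partial_commute[OF assms])
  \<comment> \<open>The real part of \<open>- \<i> * z\<close> is the imaginary part of
    \<open>z\<close>, so the real case applied to \<open>?g\<close> settles the imaginary
    part.\<close>
  let ?g = "\<lambda>z. - \<i> * f z"
  have g: "smooth_on U ?g" by (intro smooth_on_mult smooth_on_const assms)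
  have eq: "partial c (partial d ?g) y = - \<i> * partial c (partial d f) y" for c d
  proof -
    have 1: "partial c (\<lambda>z. - \<i> * k z) z = - \<i> * partial c k z" if "smooth_on U k" "z \<in> U" for c k z
      using foldr_partial_mult[OF assms(1) smooth_on_const[of _ "- \<i>"] that, of "[c]"] by (simp add: partial_const)
    have "partial c (partial d ?g) y = partial c (\<lambda>z. - \<i> * partial d f z) y"
      by (rule partial_cong[OF assms(1,3)]) (rule 1[OF assms(2)])
    then show ?thesis using 1[OF smooth_on_partial[OF assms(2)] assms(3)] by simp
  qed
  show "Im (partial a (partial b f) y) = Im (partial b (partial a f) y)"
    using Re_partial_commute[OF assms(1) g assms(3), of a b] unfolding eq by simp
qed

text \<open>Adjacent exchanges move the head of \<open>J\<close> to the front of \<open>J'\<close>,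
  and the tails are compared by induction. This is what makes the arbitrary choice in
  \<open>list_of_mset\<close> harmless.\<close>

lemma foldr_partial_perm:
  assumes "open U" "smooth_on U f" "y \<in> U" "mset J = mset J'"
  shows "foldr partial J f y = foldr partial J' f y"
  using assms(3,4)
proof (induction J arbitrary: J' y)
  case (Cons a J)
  then have "a \<in> set J'" by (metis list.set_intros(1) set_mset_mset)
  then obtain P Q where J': "J' = P @ a # Q" by (meson split_list)
  have sm: "smooth_on U (foldr partial K f)" for K
    by (induction K) (auto simp: assms(2) smooth_on_partial)
  have "foldr partial (P @ a # Q) f z = foldr partial (a # P @ Q) f z" if "z \<in> U" for z
    using that
  proof (induction P arbitrary: z)
    case (Cons b P)
    have "foldr partial ((b # P) @ a # Q) f z = partial b (partial a (foldr partial (P @ Q) f)) z"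
      using partial_cong[OF assms(1) Cons.prems Cons.IH] by simp
    then show ?case using partial_commute[OF assms(1) sm[of "P @ Q"] Cons.prems, of a b] by simp
  qed simp
  moreover have "mset J = mset (P @ Q)" using Cons.prems(2) J' by simp
  then have "foldr partial J f z = foldr partial (P @ Q) f z" if "z \<in> U" for z
    by (rule Cons.IH[OF that])
  then have "foldr partial (a # J) f y = foldr partial (a # P @ Q) f y"
    using partial_cong[OF assms(1) Cons.prems(1), of "foldr partial J f" "foldr partial (P @ Q) f" a]
    by (simp only: foldr_Cons o_apply)
  ultimately show ?case using Cons.prems(1) unfolding J' by metis
qed simp

section \<open>Exponential formula\<close>

lemma mfps_monom_nth: "mfps_nth (mfps_monom M a) N = (if N = M then a else 0)"
  by (simp add: mfps_monom_def)

lemma mfps_monom_0 [simp]: "mfps_monom M 0 = 0"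
  by (rule mfps_eqI) (simp add: mfps_monom_nth)

lemma mfps_monom_add: "mfps_monom M (a + b) = mfps_monom M a + mfps_monom M (b :: 'a::comm_ring_1)"
  by (rule mfps_eqI) (simp add: mfps_monom_nth)

lemma mfps_monom_sum: "mfps_monom M (sum f A) = (\<Sum>x\<in>A. mfps_monom M (f x :: 'a::comm_ring_1))"
  by (induction A rule: infinite_finite_induct) (auto simp: mfps_monom_add)

lemma mfps_monom_mult:
  "mfps_monom M a * mfps_monom N b = mfps_monom (M + N) (a * b :: 'a::comm_ring_1)"
proof (rule mfps_eqI)
  fix L
  have "mfps_nth (mfps_monom M a * mfps_monom N b) L =
      (\<Sum>A | A \<subseteq># L. if A = M then (if L - M = N then a * b else 0) else 0)"
    unfolding mfps_nth_times by (rule sum.cong) (auto simp: mfps_monom_nth)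
  also have "\<dots> = (if M \<subseteq># L \<and> L - M = N then a * b else 0)"
    by (auto simp: finite_submultisets)
  also have "\<dots> = mfps_nth (mfps_monom (M + N) (a * b)) L"
    by (auto simp: mfps_monom_nth)
  finally show "mfps_nth (mfps_monom M a * mfps_monom N b) L =
    mfps_nth (mfps_monom (M + N) (a * b)) L" .
qed

lemma mfps_const_1 [simp]: "mfps_const 1 = 1"
  by (rule mfps_eqI) (simp add: mfps_monom_nth mfps_nth_one)

lemma mfps_const_mult: "mfps_const (a * b :: 'a::comm_ring_1) = mfps_const a * mfps_const b"
  by (simp add: mfps_monom_mult)

lemma mfps_const_power: "mfps_const (a ^ n :: 'a::comm_ring_1) = mfps_const a ^ n"
  by (induction n) (simp_all add: mfps_const_mult)

lemma mfps_const_prod: "mfps_const (prod f A) = (\<Prod>x\<in>A. mfps_const (f x :: 'a::comm_ring_1))"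
  by (induction A rule: infinite_finite_induct) (auto simp: mfps_const_mult)

lemma mfps_const_of_nat: "mfps_const (of_nat n :: 'a::comm_ring_1) = of_nat n"
  by (induction n) (simp_all add: mfps_monom_add)

lemma mfps_nth_const_mult:
  "mfps_nth (mfps_const a * f) M = a * mfps_nth f (M :: 'v multiset) " for a :: "'a::comm_ring_1"
proof -
  have "mfps_nth (mfps_const a * f) M = (\<Sum>A | A \<subseteq># M. if A = {#} then a * mfps_nth f M else 0)"
    unfolding mfps_nth_times by (rule sum.cong) (auto simp: mfps_monom_nth)
  then show ?thesis by (simp add: finite_submultisets)
qed

lemma mfps_const_mult_monom: "mfps_const a * mfps_monom M b = mfps_monom M (a * b :: 'a::comm_ring_1)"
  by (simp add: mfps_monom_mult)

lemma mfps_nth_of_nat_mult: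
  "mfps_nth (of_nat n * f) M = of_nat n * mfps_nth f M" for f :: "('v, 'a::comm_ring_1) mfps"
  by (simp add: mfps_const_of_nat[symmetric] mfps_nth_const_mult)

text \<open>The series are available as a commutative ring and no more, so a nonzero integer is
  cancelled in the coefficients, which lie in a domain of characteristic 0.\<close>

lemma mfps_of_nat_cancel:
  fixes f g :: "('v, 'a::{idom, ring_char_0}) mfps"
  assumes "of_nat (Suc n) * f = of_nat (Suc n) * g"
  shows "f = g"
proof (rule mfps_eqI)
  fix M
  have "mfps_nth (of_nat (Suc n) * f) M = mfps_nth (of_nat (Suc n) * g) M"
    by (simp only: assms)
  then show "mfps_nth f M = mfps_nth g M"
    unfolding mfps_nth_of_nat_mult by (metis mult_cancel_left of_nat_neq_0)
qed

lemma mfps_nth_sum: "mfps_nth (sum f A) M = (\<Sum>x\<in>A. mfps_nth (f x :: ('v, 'a::comm_ring_1) mfps) M)"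
  by (induction A rule: infinite_finite_induct) auto

section \<open>Exponential and logarithm through formal differential equations\<close>

lemma series_power_eq_0: "fps_nth (Z :: 'v series) 0 = 0 \<Longrightarrow> n < k \<Longrightarrow> fps_nth (Z ^ k) n = 0"
  by (rule startsby_zero_power_prefix[rule_format])

lemma series_exp_0: "fps_nth (series_exp Z) 0 = 1"
  by (simp add: series_exp_def)

lemma series_ln_0: "fps_nth (series_ln Z) 0 = 0"
  by (simp add: series_ln_def)

text \<open>The chain rule \<open>(Z^(k+1))' = (k+1) Z^k Z'\<close>, read off in degree
  \<open>n\<close>. Keeping the integer factors undivided avoids inverses in a ring that is not a
  field.\<close>

lemma fps_nth_power_Suc_deriv:
  "of_nat (Suc n) * fps_nth (Z ^ Suc k) (Suc n) =
   of_nat (Suc k) * (\<Sum>i\<le>n. fps_nth (Z ^ k) i * fps_nth (fps_deriv Z) (n - i))"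
  for Z :: "'v series"
proof -
  have "of_nat (Suc n) * fps_nth (Z ^ Suc k) (Suc n) = fps_nth (fps_deriv (Z ^ Suc k)) n"
    by (simp only: fps_deriv_nth Suc_eq_plus1)
  also have "fps_deriv (Z ^ Suc k) = fps_const (of_nat (Suc k)) * (Z ^ k * fps_deriv Z)"
    by (simp only: fps_deriv_power diff_Suc_1 mult_ac)
  also have "fps_nth \<dots> n = of_nat (Suc k) * (\<Sum>i=0..n. fps_nth (Z ^ k) i * fps_nth (fps_deriv Z) (n - i))"
    unfolding fps_mult_left_const_nth by (simp only: fps_mult_nth)
  finally show ?thesis by (simp only: atMost_atLeast0)
qed

text \<open>This is the differential equation \<open>A' = A Z'\<close> of the exponential, in
  coefficients.\<close>

lemma fps_nth_series_exp_Suc: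
  fixes Z :: "'v series"
  assumes "fps_nth Z 0 = 0"
  shows "of_nat (Suc n) * fps_nth (series_exp Z) (Suc n) =
    (\<Sum>i\<le>n. fps_nth (series_exp Z) i * fps_nth (fps_deriv Z) (n - i))"
proof -
  have c: "mfps_const (1 / fact (Suc k)) * of_nat (Suc k) = (mfps_const (1 / fact k) :: ('v, complex fls) mfps)" for k
  proof -
    have "1 / fact (Suc k) * of_nat (Suc k) = (1 / fact k :: complex fls)"
      using of_nat_neq_0[of k, where 'a = "complex fls"] by (simp add: fact_Suc del: of_nat_Suc)
    then show ?thesis by (metis mfps_const_mult mfps_const_of_nat)
  qed
  have "of_nat (Suc n) * fps_nth (series_exp Z) (Suc n) =
    (\<Sum>k\<le>Suc n. mfps_const (1 / fact k) * (of_nat (Suc n) * fps_nth (Z ^ k) (Suc n)))"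
    by (simp only: series_exp_def fps_nth_Abs_fps sum_distrib_left mult_ac)
  also have "\<dots> = (\<Sum>k\<le>n. mfps_const (1 / fact (Suc k)) * (of_nat (Suc n) * fps_nth (Z ^ Suc k) (Suc n)))"
    by (simp only: sum.atMost_Suc_shift) simp
  also have "\<dots> = (\<Sum>k\<le>n. mfps_const (1 / fact k) * (\<Sum>i\<le>n. fps_nth (Z ^ k) i * fps_nth (fps_deriv Z) (n - i)))"
    by (simp only: fps_nth_power_Suc_deriv mult.assoc[symmetric] c)
  also have "\<dots> = (\<Sum>i\<le>n. (\<Sum>k\<le>n. mfps_const (1 / fact k) * fps_nth (Z ^ k) i) * fps_nth (fps_deriv Z) (n - i))"
    unfolding sum_distrib_left sum_distrib_right by (subst sum.swap) (simp only: mult.assoc)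
  also have "\<dots> = (\<Sum>i\<le>n. fps_nth (series_exp Z) i * fps_nth (fps_deriv Z) (n - i))"
  proof (intro sum.cong refl arg_cong2[where f = times])
    \<comment> \<open>\<open>Z ^ k\<close> starts in degree \<open>k\<close>, so the cut-off
      \<open>n\<close> may replace the cut-off \<open>i\<close> of the definition.\<close>
    fix i assume "i \<in> {..n}"
    then show "(\<Sum>k\<le>n. mfps_const (1 / fact k) * fps_nth (Z ^ k) i) = fps_nth (series_exp Z) i"
      unfolding series_exp_def fps_nth_Abs_fps
      by (intro sum.mono_neutral_right) (auto simp: series_power_eq_0[OF assms])
  qed
  finally show ?thesis .
qed

text \<open>With initial value 1 the differential equation is a recursion for the coefficients,
  because \<open>Suc n\<close> can be cancelled.\<close>

lemma series_exp_unique: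
  fixes A Z :: "'v series"
  assumes "fps_nth Z 0 = 0" "fps_nth A 0 = 1"
    and "\<And>n. of_nat (Suc n) * fps_nth A (Suc n) = (\<Sum>i\<le>n. fps_nth A i * fps_nth (fps_deriv Z) (n - i))"
  shows "A = series_exp Z"
proof (rule fps_ext)
  fix n show "fps_nth A n = fps_nth (series_exp Z) n"
  proof (induction n rule: less_induct)
    case (less n)
    show ?case
    proof (cases n)
      case 0 then show ?thesis using assms(2) by (simp add: series_exp_0)
    next
      case (Suc m)
      have "of_nat (Suc m) * fps_nth A (Suc m) = of_nat (Suc m) * fps_nth (series_exp Z) (Suc m)"
        unfolding assms(3) fps_nth_series_exp_Suc[OF assms(1)] using less Suc
        by (intro sum.cong) auto
      then show ?thesis unfolding Suc by (rule mfps_of_nat_cancel)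
    qed
  qed
qed

text \<open>Differentiating the logarithm term by term leaves the geometric series for the inverse
  of \<open>A\<close>, times \<open>A'\<close>.\<close>

lemma fps_deriv_series_ln:
  fixes A :: "'v series"
  assumes "fps_nth A 0 = 1"
  shows "fps_deriv A = A * fps_deriv (series_ln A)"
proof -
  define B where "B = A - 1"
  have B0: "fps_nth B 0 = 0" using assms by (simp add: B_def)
  define c where "c k = (mfps_const ((- 1) ^ (k + 1) / of_nat k) :: ('v, complex fls) mfps)" for k
  have c: "c (Suc k) * of_nat (Suc k) = (- 1) ^ k" for k
  proof -
    have "(- 1) ^ (Suc k + 1) / of_nat (Suc k) * of_nat (Suc k) = ((- 1) ^ k :: complex fls)"
      using of_nat_neq_0[of k, where 'a = "complex fls"] by (simp del: of_nat_Suc)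
    then have "c (Suc k) * of_nat (Suc k) = mfps_const ((- 1) ^ k)"
      unfolding c_def by (metis mfps_const_mult mfps_const_of_nat)
    moreover have "mfps_const (- 1) = (- 1 :: ('v, complex fls) mfps)"
      by (rule mfps_eqI) (simp add: mfps_monom_nth mfps_nth_one)
    ultimately show ?thesis by (simp add: mfps_const_power)
  qed
  \<comment> \<open>With \<open>A = 1 + B\<close> this is the geometric series of
    \<open>- B\<close>, shown below to be inverse to \<open>A\<close>. Cutting it off is harmless as
    \<open>B\<close> has no term of degree 0.\<close>
  define E where "E = Abs_fps (\<lambda>n. \<Sum>k\<le>n. (- 1) ^ k * fps_nth (B ^ k) n)"
  have E_n: "fps_nth E i = (\<Sum>k\<le>n. (- 1) ^ k * fps_nth (B ^ k) i)" if "i \<le> n" for i n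
    unfolding E_def fps_nth_Abs_fps using that
    by (intro sum.mono_neutral_left) (auto simp: series_power_eq_0[OF B0])
  have dL: "fps_deriv (series_ln A) = E * fps_deriv B"
  proof (rule fps_ext)
    fix n
    have "fps_nth (fps_deriv (series_ln A)) n =
      (\<Sum>k=1..Suc n. c k * (of_nat (Suc n) * fps_nth (B ^ k) (Suc n)))"
      unfolding series_ln_def B_def c_def fps_deriv_nth fps_nth_Abs_fps sum_distrib_left Suc_eq_plus1
      by (intro sum.cong) (simp_all only: mult_ac)
    also have "\<dots> = (\<Sum>k\<le>n. c (Suc k) * (of_nat (Suc n) * fps_nth (B ^ Suc k) (Suc n)))"
      by (rule sum.reindex_bij_witness[where j = "\<lambda>k. k - 1" and i = Suc]) auto
    also have "\<dots> = (\<Sum>k\<le>n. (- 1) ^ k * (\<Sum>i\<le>n. fps_nth (B ^ k) i * fps_nth (fps_deriv B) (n - i)))"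
      by (simp only: fps_nth_power_Suc_deriv mult.assoc[symmetric] c)
    also have "\<dots> = (\<Sum>i\<le>n. (\<Sum>k\<le>n. (- 1) ^ k * fps_nth (B ^ k) i) * fps_nth (fps_deriv B) (n - i))"
      unfolding sum_distrib_left sum_distrib_right by (subst sum.swap) (simp only: mult.assoc)
    also have "\<dots> = (\<Sum>i\<le>n. fps_nth E i * fps_nth (fps_deriv B) (n - i))"
      using E_n by (intro sum.cong refl arg_cong2[where f = times]) auto
    also have "\<dots> = fps_nth (E * fps_deriv B) n"
      by (simp only: fps_mult_nth atMost_atLeast0)
    finally show "fps_nth (fps_deriv (series_ln A)) n = fps_nth (E * fps_deriv B) n" .
  qed
  have AE: "A * E = 1"
  proof (rule fps_ext)
    fix n
    have "fps_nth (B * E) n = (\<Sum>i=0..n. fps_nth B i * (\<Sum>k\<le>n. (- 1) ^ k * fps_nth (B ^ k) (n - i)))"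
      unfolding fps_mult_nth by (intro sum.cong refl arg_cong2[where f = times] E_n) auto
    also have "\<dots> = (\<Sum>k\<le>n. (- 1) ^ k * fps_nth (B ^ Suc k) n)"
      unfolding sum_distrib_left power_Suc fps_mult_nth
      by (subst sum.swap) (simp only: mult_ac)
    also have "\<dots> = - (\<Sum>k\<le>n. (- 1) ^ Suc k * fps_nth (B ^ Suc k) n)"
      by (simp add: sum_negf)
    also have "(\<Sum>k\<le>n. (- 1) ^ Suc k * fps_nth (B ^ Suc k) n) =
      (\<Sum>k\<le>Suc n. (- 1) ^ k * fps_nth (B ^ k) n) - fps_nth 1 n"
      unfolding sum.atMost_Suc_shift by simp
    also have "(\<Sum>k\<le>Suc n. (- 1) ^ k * fps_nth (B ^ k) n) = fps_nth E n"
      by (rule E_n[symmetric]) simp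
    finally have "fps_nth (B * E) n = fps_nth 1 n - fps_nth E n" by simp
    moreover have "A * E = E + B * E" by (simp add: B_def algebra_simps)
    ultimately show "fps_nth (A * E) n = fps_nth 1 n" by simp
  qed
  have "fps_deriv A = fps_deriv B" by (simp add: B_def)
  then show ?thesis using AE by (simp add: dL mult.assoc[symmetric])
qed

text \<open>The logarithm of the exponential and \<open>Z\<close> have derivatives with the same
  product with \<open>series_exp Z\<close>, and both vanish in degree 0.\<close>

lemma series_ln_exp:
  fixes Z :: "'v series"
  assumes "fps_nth Z 0 = 0"
  shows "series_ln (series_exp Z) = Z"
proof -
  let ?A = "series_exp Z" and ?L = "series_ln (series_exp Z)"
  have "fps_deriv ?A = ?A * fps_deriv Z"
  proof (rule fps_ext)
    fix n show "fps_nth (fps_deriv ?A) n = fps_nth (?A * fps_deriv Z) n"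
      using fps_nth_series_exp_Suc[OF assms, of n] unfolding fps_mult_nth atMost_atLeast0
      by (simp only: fps_deriv_nth Suc_eq_plus1)
  qed
  then have eq: "?A * fps_deriv ?L = ?A * fps_deriv Z"
    using fps_deriv_series_ln[OF series_exp_0, of Z] by simp
  have d: "fps_nth (fps_deriv ?L) n = fps_nth (fps_deriv Z) n" for n
  proof (induction n rule: less_induct)
    case (less n)
    \<comment> \<open>The leading coefficient 1 of \<open>?A\<close> isolates the coefficient of
      degree \<open>n\<close> of the other factor, so \<open>?A\<close> is cancelled by induction on
      the degree instead of by an inverse.\<close>
    have split: "fps_nth (?A * X) n = fps_nth X n + (\<Sum>i=Suc 0..n. fps_nth ?A i * fps_nth X (n - i))" for X
      unfolding fps_mult_nth by (subst sum.atLeast_Suc_atMost) (simp_all add: series_exp_0)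
    have "(\<Sum>i=Suc 0..n. fps_nth ?A i * fps_nth (fps_deriv ?L) (n - i)) =
       (\<Sum>i=Suc 0..n. fps_nth ?A i * fps_nth (fps_deriv Z) (n - i))"
      by (intro sum.cong refl arg_cong2[where f = times] less.IH) auto
    then show ?case using split[of "fps_deriv ?L"] split[of "fps_deriv Z"] eq by simp
  qed
  show ?thesis
  proof (rule fps_ext)
    fix n show "fps_nth ?L n = fps_nth Z n"
    proof (cases n)
      case (Suc m)
      show ?thesis unfolding Suc
        by (rule mfps_of_nat_cancel) (use d[of m] in \<open>simp only: fps_deriv_nth Suc_eq_plus1\<close>)
    qed (simp add: series_ln_0 assms)
  qed
qed

section \<open>From recursions over labelled structures to exponentials of generating
  functions\<close>

lemma sum_Pow_card:
  assumes "finite X"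
  shows "(\<Sum>Y\<in>Pow X. g (card Y)) = (\<Sum>k\<le>card X. of_nat (card X choose k) * (g k :: 'r::comm_ring_1))"
proof -
  have "(\<Sum>k\<le>card X. of_nat (card X choose k) * g k) = (\<Sum>k\<le>card X. \<Sum>Y | Y \<in> Pow X \<and> card Y = k. g (card Y))"
    by (rule sum.cong) (auto simp: n_subsets[OF assms])
  also have "\<dots> = (\<Sum>Y\<in>Pow X. g (card Y))"
    by (rule sum.group) (use assms in \<open>auto simp: card_mono\<close>)
  finally show ?thesis ..
qed

text \<open>A structure on \<open>n + 1\<close> points consists of the component of one marked
  point, with \<open>k\<close> further points, and a structure on the rest. For exponential
  generating functions this recursion is the equation \<open>A' = A Z'\<close>.\<close>

lemma exponential_formula:
  fixes t u :: "nat \<Rightarrow> ('v, complex fls) mfps"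
  assumes "t 0 = 1" "\<And>n. t (Suc n) = (\<Sum>k\<le>n. of_nat (n choose k) * (u (Suc k) * t (n - k)))"
  shows "Abs_fps (\<lambda>n. mfps_const (1 / fact n) * t n) =
    series_exp (Abs_fps (\<lambda>n. if n = 0 then 0 else mfps_const (1 / fact n) * u n))"
    (is "?A = series_exp ?Z")
proof (rule series_exp_unique)
  fix n
  have "of_nat (Suc n) * fps_nth ?A (Suc n) = mfps_const (1 / fact n) * t (Suc n)"
  proof -
    have "of_nat (Suc n) * (1 / fact (Suc n)) = (1 / fact n :: complex fls)"
      using of_nat_neq_0[of n, where 'a = "complex fls"] by (simp add: fact_Suc del: of_nat_Suc)
    then have "of_nat (Suc n) * mfps_const (1 / fact (Suc n)) = (mfps_const (1 / fact n) :: ('v, complex fls) mfps)"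
      by (metis mfps_const_mult mfps_const_of_nat)
    then show ?thesis by (simp only: fps_nth_Abs_fps mult.assoc[symmetric])
  qed
  also have "\<dots> = (\<Sum>k\<le>n. mfps_const (1 / fact n) * of_nat (n choose k) * (u (Suc k) * t (n - k)))"
    by (simp only: assms(2) sum_distrib_left mult_ac)
  also have "\<dots> = (\<Sum>k\<le>n. (mfps_const (1 / fact (n - k)) * t (n - k)) * (mfps_const (1 / fact k) * u (Suc k)))"
  proof (rule sum.cong)
    fix k assume "k \<in> {..n}"
    then have "1 / fact n * of_nat (n choose k) = (1 / fact (n - k) * (1 / fact k) :: complex fls)"
      by (simp add: binomial_fact)
    then have "mfps_const (1 / fact n) * of_nat (n choose k) =
        (mfps_const (1 / fact (n - k)) * mfps_const (1 / fact k) :: ('v, complex fls) mfps)"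
      by (metis mfps_const_mult mfps_const_of_nat)
    then show "mfps_const (1 / fact n) * of_nat (n choose k) * (u (Suc k) * t (n - k)) =
        (mfps_const (1 / fact (n - k)) * t (n - k)) * (mfps_const (1 / fact k) * u (Suc k))"
      by (simp only: mult_ac)
  qed simp
  also have "\<dots> = (\<Sum>i\<le>n. fps_nth ?A i * (mfps_const (1 / fact (n - i)) * u (Suc (n - i))))"
    by (rule sum.reindex_bij_witness[where i = "\<lambda>k. n - k" and j = "\<lambda>k. n - k"]) auto
  also have "\<dots> = (\<Sum>i\<le>n. fps_nth ?A i * fps_nth (fps_deriv ?Z) (n - i))"
  proof (intro sum.cong refl arg_cong2[where f = times])
    fix i
    define m where "m = n - i"
    have "of_nat (Suc m) * (1 / fact (Suc m)) = (1 / fact m :: complex fls)"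
      using of_nat_neq_0[of m, where 'a = "complex fls"] by (simp add: fact_Suc del: of_nat_Suc)
    then have "of_nat (Suc m) * mfps_const (1 / fact (Suc m)) = (mfps_const (1 / fact m) :: ('v, complex fls) mfps)"
      by (metis mfps_const_mult mfps_const_of_nat)
    then show "mfps_const (1 / fact (n - i)) * u (Suc (n - i)) = fps_nth (fps_deriv ?Z) (n - i)"
      unfolding m_def[symmetric] fps_deriv_nth fps_nth_Abs_fps Suc_eq_plus1[symmetric]
      by (simp add: mult.assoc[symmetric] del: of_nat_Suc fact_Suc)
  qed
  finally show "of_nat (Suc n) * fps_nth ?A (Suc n) = (\<Sum>i\<le>n. fps_nth ?A i * fps_nth (fps_deriv ?Z) (n - i))" .
qed (simp_all add: assms)

section \<open>Taylor expansion is multiplicative\<close>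

definition smooth_fps :: "(real^'b::finite) set \<Rightarrow> (real^'b \<Rightarrow> complex fps) \<Rightarrow> bool" where
  "smooth_fps U f \<longleftrightarrow> (\<forall>n. smooth_on U (\<lambda>y. fps_nth (f y) n))"

definition smooth_mfps :: "(real^'b::finite) set \<Rightarrow> (real^'b \<Rightarrow> ('c, complex fps) mfps) \<Rightarrow> bool" where
  "smooth_mfps U u \<longleftrightarrow> (\<forall>M. smooth_fps U (\<lambda>y. mfps_nth (u y) M))"

lemma fps_nth_partial: "fps_nth (partial_fps a f y) n = partial a (\<lambda>z. fps_nth (f z) n) y"
  by (simp add: partial_fps_def)

lemma mfps_nth_partial: "mfps_nth (partial_mfps a u y) M = partial_fps a (\<lambda>z. mfps_nth (u z) M) y"
  by (simp add: partial_mfps_def)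

lemma fps_nth_foldr_partial:
  "fps_nth (foldr partial_fps J f y) n = foldr partial J (\<lambda>z. fps_nth (f z) n) y"
proof (induction J arbitrary: y)
  case (Cons a J)
  then have "(\<lambda>z. fps_nth (foldr partial_fps J f z) n) = foldr partial J (\<lambda>z. fps_nth (f z) n)" by auto
  then show ?case by (simp add: fps_nth_partial)
qed simp

lemma mfps_nth_foldr_partial:
  "mfps_nth (foldr partial_mfps J u y) M = foldr partial_fps J (\<lambda>z. mfps_nth (u z) M) y"
proof (induction J arbitrary: y)
  case (Cons a J)
  then have "(\<lambda>z. mfps_nth (foldr partial_mfps J u z) M) = foldr partial_fps J (\<lambda>z. mfps_nth (u z) M)" by auto
  then show ?case by (simp add: mfps_nth_partial)
qed simp

lemma smooth_fps_partial: "smooth_fps U f \<Longrightarrow> smooth_fps U (partial_fps a f)"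
  by (simp add: smooth_fps_def fps_nth_partial smooth_on_partial)

lemma smooth_mfps_partial: "smooth_mfps U u \<Longrightarrow> smooth_mfps U (partial_mfps a u)"
  by (simp add: smooth_mfps_def mfps_nth_partial smooth_fps_partial)

lemma smooth_fps_const: "smooth_fps U (\<lambda>_. c)"
  by (simp add: smooth_fps_def smooth_on_const)

lemma smooth_mfps_const: "smooth_mfps U (\<lambda>_. c)"
  by (simp add: smooth_mfps_def smooth_fps_const)

lemma smooth_mfps_foldr_partial: "smooth_mfps U u \<Longrightarrow> smooth_mfps U (foldr partial_mfps J u)"
  by (induction J) (auto simp: smooth_mfps_partial)

context
  fixes U :: "(real^'b::finite) set"
  assumes U: "open U"
begin

lemma smooth_fps_sum: "(\<And>i. i \<in> A \<Longrightarrow> smooth_fps U (f i)) \<Longrightarrow> smooth_fps U (\<lambda>z. \<Sum>i\<in>A. f i z)"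
  by (simp add: smooth_fps_def fps_sum_nth smooth_on_sum[OF U])

lemma smooth_fps_add: "smooth_fps U f \<Longrightarrow> smooth_fps U g \<Longrightarrow> smooth_fps U (\<lambda>z. f z + g z)"
  by (simp add: smooth_fps_def smooth_on_add[OF U])

lemma smooth_fps_mult: "smooth_fps U f \<Longrightarrow> smooth_fps U g \<Longrightarrow> smooth_fps U (\<lambda>z. f z * g z)"
  by (simp add: smooth_fps_def fps_mult_nth smooth_on_sum[OF U] smooth_on_mult[OF U])

lemma smooth_mfps_add: "smooth_mfps U f \<Longrightarrow> smooth_mfps U g \<Longrightarrow> smooth_mfps U (\<lambda>z. f z + g z)"
  by (simp add: smooth_mfps_def smooth_fps_add)

lemma smooth_mfps_mult: "smooth_mfps U f \<Longrightarrow> smooth_mfps U g \<Longrightarrow> smooth_mfps U (\<lambda>z. f z * g z)"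
  by (simp add: smooth_mfps_def mfps_nth_times smooth_fps_sum smooth_fps_mult)

lemma partial_fps_sum:
  assumes "finite A" "\<And>i. i \<in> A \<Longrightarrow> smooth_fps U (f i)" "y \<in> U"
  shows "foldr partial_fps J (\<lambda>z. \<Sum>i\<in>A. f i z) y = (\<Sum>i\<in>A. foldr partial_fps J (f i) y)"
  by (rule fps_ext)
    (use assms in \<open>simp add: fps_nth_foldr_partial fps_sum_nth foldr_partial_sum[OF U] smooth_fps_def\<close>)

lemma partial_fps_add:
  assumes "smooth_fps U f" "smooth_fps U g" "y \<in> U"
  shows "foldr partial_fps J (\<lambda>z. f z + g z) y = foldr partial_fps J f y + foldr partial_fps J g y"
  by (rule fps_ext)
    (use assms in \<open>simp add: fps_nth_foldr_partial foldr_partial_add[OF U] smooth_fps_def\<close>)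

lemma partial_fps_cong:
  assumes "\<And>z. z \<in> U \<Longrightarrow> f z = g z" "y \<in> U"
  shows "foldr partial_fps J f y = foldr partial_fps J g y"
  by (rule fps_ext, unfold fps_nth_foldr_partial, rule foldr_partial_cong[OF U _ assms(2)])
    (simp add: assms(1))

lemma partial_fps_mult:
  assumes "smooth_fps U f" "smooth_fps U g" "y \<in> U"
  shows "partial_fps a (\<lambda>z. f z * g z) y = partial_fps a f y * g y + f y * partial_fps a g y"
proof (rule fps_ext)
  fix n
  have sm: "smooth_on U (\<lambda>z. fps_nth (f z) i)" "smooth_on U (\<lambda>z. fps_nth (g z) i)" for i
    using assms by (auto simp: smooth_fps_def)
  have "fps_nth (partial_fps a (\<lambda>z. f z * g z) y) n =
    partial a (\<lambda>z. \<Sum>i=0..n. fps_nth (f z) i * fps_nth (g z) (n - i)) y"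
    by (simp add: fps_nth_partial fps_mult_nth)
  also have "\<dots> = (\<Sum>i=0..n. partial a (\<lambda>z. fps_nth (f z) i * fps_nth (g z) (n - i)) y)"
    using foldr_partial_sum[OF U _ assms(3), of "{0..n}" "\<lambda>i z. fps_nth (f z) i * fps_nth (g z) (n - i)" "[a]"]
    by (simp add: smooth_on_mult[OF U] sm)
  also have "\<dots> = (\<Sum>i=0..n. partial a (\<lambda>z. fps_nth (f z) i) y * fps_nth (g y) (n - i) +
     fps_nth (f y) i * partial a (\<lambda>z. fps_nth (g z) (n - i)) y)"
    using foldr_partial_mult[OF U sm(1) sm(2) assms(3), of "[a]"] by simp
  also have "\<dots> = fps_nth (partial_fps a f y * g y + f y * partial_fps a g y) n"
    by (simp add: fps_mult_nth fps_nth_partial sum.distrib)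
  finally show "fps_nth (partial_fps a (\<lambda>z. f z * g z) y) n =
    fps_nth (partial_fps a f y * g y + f y * partial_fps a g y) n" .
qed

lemma partial_mfps_mult:
  assumes "smooth_mfps U f" "smooth_mfps U g" "y \<in> U"
  shows "partial_mfps a (\<lambda>z. f z * g z) y = partial_mfps a f y * g y + f y * partial_mfps a g y"
proof (rule mfps_eqI)
  fix M
  have sm: "smooth_fps U (\<lambda>z. mfps_nth (f z) i)" "smooth_fps U (\<lambda>z. mfps_nth (g z) i)" for i
    using assms by (auto simp: smooth_mfps_def)
  have "mfps_nth (partial_mfps a (\<lambda>z. f z * g z) y) M =
    partial_fps a (\<lambda>z. \<Sum>A | A \<subseteq># M. mfps_nth (f z) A * mfps_nth (g z) (M - A)) y"
    by (simp add: mfps_nth_partial mfps_nth_times)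
  also have "\<dots> = (\<Sum>A | A \<subseteq># M. partial_fps a (\<lambda>z. mfps_nth (f z) A * mfps_nth (g z) (M - A)) y)"
    using partial_fps_sum[OF finite_submultisets _ assms(3), of M "\<lambda>A z. mfps_nth (f z) A * mfps_nth (g z) (M - A)" "[a]"]
    by (simp add: smooth_fps_mult sm)
  also have "\<dots> = mfps_nth (partial_mfps a f y * g y + f y * partial_mfps a g y) M"
    by (simp add: mfps_nth_times mfps_nth_partial sum.distrib partial_fps_mult[OF sm assms(3)])
  finally show "mfps_nth (partial_mfps a (\<lambda>z. f z * g z) y) M =
    mfps_nth (partial_mfps a f y * g y + f y * partial_mfps a g y) M" .
qed

lemma partial_mfps_add:
  assumes "smooth_mfps U f" "smooth_mfps U g" "y \<in> U"
  shows "partial_mfps a (\<lambda>z. f z + g z) y = partial_mfps a f y + partial_mfps a g y"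
proof (rule mfps_eqI)
  fix M
  show "mfps_nth (partial_mfps a (\<lambda>z. f z + g z) y) M = mfps_nth (partial_mfps a f y + partial_mfps a g y) M"
    using partial_fps_add[of "\<lambda>z. mfps_nth (f z) M" "\<lambda>z. mfps_nth (g z) M" y "[a]"] assms
    by (simp add: mfps_nth_partial smooth_mfps_def)
qed

lemma partial_mfps_cong:
  assumes "\<And>z. z \<in> U \<Longrightarrow> f z = g z" "y \<in> U"
  shows "partial_mfps a f y = partial_mfps a g y"
proof (rule mfps_eqI)
  fix M
  show "mfps_nth (partial_mfps a f y) M = mfps_nth (partial_mfps a g y) M"
    using partial_fps_cong[of "\<lambda>z. mfps_nth (f z) M" "\<lambda>z. mfps_nth (g z) M" y "[a]"] assms
    by (simp add: mfps_nth_partial)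
qed

end

lemma foldr_partial_mfps_perm:
  assumes "open U" "smooth_mfps U u" "y \<in> U" "mset J = mset J'"
  shows "foldr partial_mfps J u y = foldr partial_mfps J' u y"
  by (intro mfps_eqI fps_ext, unfold mfps_nth_foldr_partial fps_nth_foldr_partial, rule foldr_partial_perm)
    (use assms in \<open>auto simp: smooth_mfps_def smooth_fps_def\<close>)

section \<open>Taylor terms along a formal displacement\<close>

definition displacement :: "('b \<Rightarrow> complex fps) \<Rightarrow> 'b \<Rightarrow> complex fps" where
  "displacement c a = c a - fps_const (fps_nth (c a) 0)"

lemma displacement_0 [simp]: "fps_nth (displacement c a) 0 = 0"
  by (simp add: displacement_def)

text \<open>The \<open>k\<close>-th directional derivative of \<open>f\<close> along the
  displacement. Without the factor \<open>1 / fact k\<close> it obeys the binomial Leibniz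
  rule.\<close>

definition taylor_term :: "('b::finite \<Rightarrow> complex fps) \<Rightarrow> real^'b \<Rightarrow> nat \<Rightarrow> (real^'b \<Rightarrow> complex fps) \<Rightarrow> complex fps" where
  "taylor_term c y k f = (\<Sum>J | length J = k. foldr partial_fps J f y * (\<Prod>a\<leftarrow>J. displacement c a))"

lemma finite_lists_length: "finite {J :: 'b::finite list. length J = k}"
  using finite_lists_length_eq[of "UNIV :: 'b set" k] by simp

text \<open>Pascal's rule for an arbitrary array; it is the induction step of the Leibniz rule in
  \<open>taylor_term_mult\<close>.\<close>

lemma leibniz_pascal:
  fixes w :: "nat \<Rightarrow> nat \<Rightarrow> 'r::comm_ring_1"
  shows "(\<Sum>i\<le>Suc k. of_nat (Suc k choose i) * w i (Suc k - i)) =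
    (\<Sum>i\<le>k. of_nat (k choose i) * (w (Suc i) (k - i) + w i (Suc (k - i))))"
proof -
  have "(\<Sum>i\<le>Suc k. of_nat (Suc k choose i) * w i (Suc k - i)) =
    w 0 (Suc k) + (\<Sum>i\<le>k. of_nat (k choose Suc i) * w (Suc i) (k - i)) +
    (\<Sum>i\<le>k. of_nat (k choose i) * w (Suc i) (k - i))"
    by (subst sum.atMost_Suc_shift) (simp add: sum.distrib distrib_right)
  also have "w 0 (Suc k) + (\<Sum>i\<le>k. of_nat (k choose Suc i) * w (Suc i) (k - i)) =
    (\<Sum>i\<le>Suc k. of_nat (k choose i) * w i (Suc k - i))"
    by (subst sum.atMost_Suc_shift) simp
  also have "\<dots> = (\<Sum>i\<le>k. of_nat (k choose i) * w i (Suc (k - i)))"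
    by (simp add: Suc_diff_le binomial_eq_0)
  finally show ?thesis by (simp add: distrib_left sum.distrib add.commute)
qed

text \<open>The last index is split off because it is the innermost derivative; the induction
  hypothesis then applies to \<open>partial_fps a f\<close>.\<close>

lemma taylor_term_Suc:
  "taylor_term c y (Suc k) f = (\<Sum>a\<in>UNIV. displacement c a * taylor_term c y k (partial_fps a f))"
proof -
  have "(\<Sum>a\<in>UNIV. displacement c a * taylor_term c y k (partial_fps a f)) =
    (\<Sum>(a, J)\<in>UNIV \<times> {J. length J = k}. displacement c a *
       (foldr partial_fps J (partial_fps a f) y * (\<Prod>a\<leftarrow>J. displacement c a)))"
    by (simp add: taylor_term_def sum_distrib_left sum.cartesian_product)
  also have "\<dots> = taylor_term c y (Suc k) f"
    unfolding taylor_term_def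
    by (rule sum.reindex_bij_witness[where j = "\<lambda>(a, J). J @ [a]" and i = "\<lambda>J. (last J, butlast J)"])
      (auto simp: mult_ac intro!: append_butlast_last_id)
  finally show ?thesis ..
qed

lemma fps_to_fls_sum: "fps_to_fls (sum f A) = (\<Sum>i\<in>A. fps_to_fls (f i :: complex fps))"
  by (induction A rule: infinite_finite_induct) auto

lemma fps_mult_nth_eq_0:
  fixes p q :: "complex fps"
  assumes "\<And>n. n < k \<Longrightarrow> fps_nth p n = 0" "\<And>n. n < l \<Longrightarrow> fps_nth q n = 0" "n < k + l"
  shows "fps_nth (p * q) n = 0"
  unfolding fps_mult_nth
proof (rule sum.neutral, rule ballI)
  fix i assume "i \<in> {0..n}"
  then have "i < k \<or> n - i < l" using assms(3) by auto
  then show "fps_nth p i * fps_nth q (n - i) = 0" using assms(1,2) by auto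
qed

lemma prod_displacement_nth: "n < length J \<Longrightarrow> fps_nth (\<Prod>a\<leftarrow>J. displacement c a) n = 0"
proof (induction J arbitrary: n)
  case (Cons a J)
  show ?case unfolding list.map prod_list.Cons
    by (rule fps_mult_nth_eq_0[where k = 1 and l = "length J"])
      (use Cons in auto)
qed simp

lemma taylor_term_nth: "n < k \<Longrightarrow> fps_nth (taylor_term c y k f) n = 0"
  unfolding taylor_term_def fps_sum_nth
  by (rule sum.neutral, rule ballI, rule fps_mult_nth_eq_0[where k = 0 and l = k])
    (auto simp: prod_displacement_nth)

text \<open>The \<open>k\<close>-th Taylor term has order at least \<open>k\<close> in \<hbar>, so
  any cut-off from \<open>n\<close> on gives the same coefficient. A common cut-off for all degrees
  is what products need.\<close>

lemma taylor_at_nth: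
  assumes "n \<le> N"
  shows "fps_nth (taylor_at c f) n =
    (\<Sum>k\<le>N. fps_nth (fps_const (1 / fact k) * taylor_term c (base_point c) k f) n)"
proof -
  have fin: "finite {J :: 'a list. length J \<le> n}"
    using finite_lists_length_le[of "UNIV :: 'a set" n] by simp
  have "fps_nth (taylor_at c f) n = (\<Sum>J | length J \<le> n. fps_nth
     (fps_const (1 / fact (length J)) * (foldr partial_fps J f (base_point c) *
      (\<Prod>a\<leftarrow>J. displacement c a))) n)"
    unfolding taylor_at_def fps_nth_Abs_fps displacement_def by (simp only: mult.assoc)
  also have "\<dots> = (\<Sum>k\<le>n. \<Sum>J | J \<in> {J. length J \<le> n} \<and> length J = k. fps_nth
     (fps_const (1 / fact (length J)) * (foldr partial_fps J f (base_point c) *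
      (\<Prod>a\<leftarrow>J. displacement c a))) n)"
    by (rule sum.group[symmetric]) (use fin in auto)
  also have "\<dots> = (\<Sum>k\<le>n. fps_nth (fps_const (1 / fact k) * taylor_term c (base_point c) k f) n)"
  proof (rule sum.cong[OF refl])
    fix k assume "k \<in> {..n}"
    then have "{J. J \<in> {J :: 'a list. length J \<le> n} \<and> length J = k} = {J. length J = k}" by auto
    then show "(\<Sum>J | J \<in> {J. length J \<le> n} \<and> length J = k. fps_nth
       (fps_const (1 / fact (length J)) * (foldr partial_fps J f (base_point c) *
        (\<Prod>a\<leftarrow>J. displacement c a))) n) = fps_nth (fps_const (1 / fact k) * taylor_term c (base_point c) k f) n"
      by (simp add: taylor_term_def sum_distrib_left fps_sum_nth)
  qed
  also have "\<dots> = (\<Sum>k\<le>N. fps_nth (fps_const (1 / fact k) * taylor_term c (base_point c) k f) n)"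
    using assms by (intro sum.mono_neutral_left) (auto simp: taylor_term_nth)
  finally show ?thesis .
qed

context
  fixes U :: "(real^'b::finite) set" and c :: "'b \<Rightarrow> complex fps" and y :: "real^'b"
  assumes U: "open U" "y \<in> U"
begin

lemma taylor_term_sum:
  assumes "finite A" "\<And>i. i \<in> A \<Longrightarrow> smooth_fps U (f i)"
  shows "taylor_term c y k (\<lambda>z. \<Sum>i\<in>A. f i z) = (\<Sum>i\<in>A. taylor_term c y k (f i))"
  unfolding taylor_term_def
  by (subst sum.swap) (simp add: partial_fps_sum[OF U(1) assms U(2)] sum_distrib_right)

lemma taylor_term_add:
  assumes "smooth_fps U f" "smooth_fps U g"
  shows "taylor_term c y k (\<lambda>z. f z + g z) = taylor_term c y k f + taylor_term c y k g"
  by (simp add: taylor_term_def partial_fps_add[OF U(1) assms U(2)] distrib_right sum.distrib)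

lemma taylor_term_cong:
  assumes "\<And>z. z \<in> U \<Longrightarrow> f z = g z"
  shows "taylor_term c y k f = taylor_term c y k g"
  unfolding taylor_term_def using partial_fps_cong[OF U(1) assms U(2)] by simp

text \<open>The displacements do not depend on the point, so differentiation along them behaves like
  powers of a single derivation.\<close>

lemma taylor_term_mult:
  assumes "smooth_fps U f" "smooth_fps U g"
  shows "taylor_term c y k (\<lambda>z. f z * g z) =
    (\<Sum>i\<le>k. of_nat (k choose i) * (taylor_term c y i f * taylor_term c y (k - i) g))"
  using assms
proof (induction k arbitrary: f g)
  case 0 then show ?case by (simp add: taylor_term_def)
next
  case (Suc k)
  let ?d = "displacement c" and ?t = "taylor_term c y"
  have "?t (Suc k) (\<lambda>z. f z * g z) = (\<Sum>a\<in>UNIV. ?d a * ?t k (partial_fps a (\<lambda>z. f z * g z)))"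
    by (rule taylor_term_Suc)
  also have "\<dots> = (\<Sum>a\<in>UNIV. ?d a * ?t k (\<lambda>z. partial_fps a f z * g z + f z * partial_fps a g z))"
    by (intro sum.cong refl arg_cong2[where f = times] taylor_term_cong partial_fps_mult[OF U(1)] Suc.prems)
  also have "\<dots> = (\<Sum>a\<in>UNIV. \<Sum>i\<le>k. of_nat (k choose i) *
      (?d a * (?t i (partial_fps a f) * ?t (k - i) g + ?t i f * ?t (k - i) (partial_fps a g))))"
  proof (rule sum.cong[OF refl])
    fix a
    have sm: "smooth_fps U (partial_fps a f)" "smooth_fps U (partial_fps a g)"
      using Suc.prems by (auto intro: smooth_fps_partial)
    have "?t k (\<lambda>z. partial_fps a f z * g z + f z * partial_fps a g z) =
        ?t k (\<lambda>z. partial_fps a f z * g z) + ?t k (\<lambda>z. f z * partial_fps a g z)"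
      by (intro taylor_term_add smooth_fps_mult U sm Suc.prems)
    also have "\<dots> = (\<Sum>i\<le>k. of_nat (k choose i) *
      (?t i (partial_fps a f) * ?t (k - i) g + ?t i f * ?t (k - i) (partial_fps a g)))"
      unfolding Suc.IH[OF sm(1) Suc.prems(2)] Suc.IH[OF Suc.prems(1) sm(2)]
      by (simp only: sum.distrib distrib_left)
    finally show "?d a * ?t k (\<lambda>z. partial_fps a f z * g z + f z * partial_fps a g z) =
      (\<Sum>i\<le>k. of_nat (k choose i) *
      (?d a * (?t i (partial_fps a f) * ?t (k - i) g + ?t i f * ?t (k - i) (partial_fps a g))))"
      by (simp only: sum_distrib_left mult.left_commute)
  qed
  also have "\<dots> = (\<Sum>i\<le>k. of_nat (k choose i) * (?t (Suc i) f * ?t (k - i) g + ?t i f * ?t (Suc (k - i)) g))"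
    by (subst sum.swap) (simp add: taylor_term_Suc sum_distrib_left sum_distrib_right sum.distrib
        distrib_left mult_ac)
  also have "\<dots> = (\<Sum>i\<le>Suc k. of_nat (Suc k choose i) * (?t i f * ?t (Suc k - i) g))"
    by (rule leibniz_pascal[symmetric, of k "\<lambda>i j. ?t i f * ?t j g"])
  finally show ?case .
qed

end

context
  fixes U :: "(real^'b::finite) set" and c :: "'b \<Rightarrow> complex fps"
  assumes U: "open U" "base_point c \<in> U"
begin

lemma taylor_at_sum:
  assumes "finite A" "\<And>i. i \<in> A \<Longrightarrow> smooth_fps U (f i)"
  shows "taylor_at c (\<lambda>z. \<Sum>i\<in>A. f i z) = (\<Sum>i\<in>A. taylor_at c (f i))"
proof (rule fps_ext)
  fix n show "fps_nth (taylor_at c (\<lambda>z. \<Sum>i\<in>A. f i z)) n = fps_nth (\<Sum>i\<in>A. taylor_at c (f i)) n"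
    by (subst taylor_at_nth[OF order.refl], subst fps_sum_nth, subst taylor_at_nth[OF order.refl], subst sum.swap)
      (simp add: taylor_term_sum[OF U assms] fps_sum_nth sum_distrib_left)
qed

lemma taylor_at_add:
  assumes "smooth_fps U f" "smooth_fps U g"
  shows "taylor_at c (\<lambda>z. f z + g z) = taylor_at c f + taylor_at c g"
proof (rule fps_ext)
  fix n show "fps_nth (taylor_at c (\<lambda>z. f z + g z)) n = fps_nth (taylor_at c f + taylor_at c g) n"
    unfolding fps_add_nth taylor_at_nth[OF order.refl]
    by (simp add: taylor_term_add[OF U assms] sum.distrib distrib_left)
qed

lemma taylor_at_cong:
  assumes "\<And>z. z \<in> U \<Longrightarrow> f z = g z"
  shows "taylor_at c f = taylor_at c g"
  by (rule fps_ext, subst (1 2) taylor_at_nth[OF order.refl]) (simp add: taylor_term_cong[OF U assms])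

lemma taylor_at_mult:
  assumes "smooth_fps U f" "smooth_fps U g"
  shows "taylor_at c (\<lambda>z. f z * g z) = taylor_at c f * taylor_at c g"
proof (rule fps_ext)
  fix n
  define T where "T k f = fps_const (1 / fact k) * taylor_term c (base_point c) k f" for k f
  have T: "fps_nth (taylor_at c f) i = fps_nth (\<Sum>k\<le>n. T k f) i" if "i \<le> n" for i f
    using that by (simp add: T_def fps_sum_nth taylor_at_nth)
  have T0: "i < k \<Longrightarrow> fps_nth (T k f) i = 0" for i k f
    by (simp add: T_def taylor_term_nth)
  have Tm: "T k (\<lambda>z. f z * g z) = (\<Sum>i\<le>k. T i f * T (k - i) g)" for k
  proof -
    have "T k (\<lambda>z. f z * g z) = (\<Sum>i\<le>k. (fps_const (1 / fact k) * of_nat (k choose i)) * 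
        (taylor_term c (base_point c) i f * taylor_term c (base_point c) (k - i) g))"
      by (simp add: T_def taylor_term_mult[OF U assms] sum_distrib_left mult_ac)
    also have "\<dots> = (\<Sum>i\<le>k. T i f * T (k - i) g)"
    proof (rule sum.cong[OF refl])
      fix i assume "i \<in> {..k}"
      then have "(1 / fact k) * of_nat (k choose i) = (1 / fact i * (1 / fact (k - i)) :: complex)"
        by (simp add: binomial_fact)
      then have "fps_const (1 / fact k) * of_nat (k choose i) =
          (fps_const (1 / fact i) * fps_const (1 / fact (k - i)) :: complex fps)"
        by (metis fps_const_mult fps_of_nat)
      then show "(fps_const (1 / fact k) * of_nat (k choose i)) * 
        (taylor_term c (base_point c) i f * taylor_term c (base_point c) (k - i) g) = T i f * T (k - i) g"
        by (simp only: T_def mult_ac)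
    qed
    finally show ?thesis .
  qed
  have "fps_nth (taylor_at c (\<lambda>z. f z * g z)) n = (\<Sum>k\<le>n. \<Sum>i\<le>k. fps_nth (T i f * T (k - i) g) n)"
    by (subst T[OF order.refl]) (simp add: Tm fps_sum_nth)
  also have "\<dots> = (\<Sum>(i, j)\<in>{(i, j). i + j \<le> n}. fps_nth (T i f * T j g) n)"
    by (rule sum.triangle_reindex_eq[symmetric])
  \<comment> \<open>Outside the triangle the product of the two terms has order above
    \<open>n\<close> in \<hbar>, so the triangle may be enlarged to a square and the double sum
    factors.\<close>
  also have "\<dots> = (\<Sum>(i, j)\<in>{..n} \<times> {..n}. fps_nth (T i f * T j g) n)"
  proof (rule sum.mono_neutral_left)
    show "\<forall>ij\<in>{..n} \<times> {..n} - {(i, j). i + j \<le> n}. (case ij of (i, j) \<Rightarrow> fps_nth (T i f * T j g) n) = 0"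
      by (auto intro!: fps_mult_nth_eq_0 T0)
  qed auto
  also have "\<dots> = fps_nth ((\<Sum>i\<le>n. T i f) * (\<Sum>j\<le>n. T j g)) n"
    by (simp add: sum_product fps_sum_nth sum.cartesian_product case_prod_unfold)
  also have "\<dots> = fps_nth (taylor_at c f * taylor_at c g) n"
    unfolding fps_mult_nth by (intro sum.cong refl) (simp add: T)
  finally show "fps_nth (taylor_at c (\<lambda>z. f z * g z)) n = fps_nth (taylor_at c f * taylor_at c g) n" .
qed

lemma taylor_at_mfps_mult:
  assumes "smooth_mfps U u" "smooth_mfps U v"
  shows "taylor_at_mfps c (\<lambda>z. u z * v z) = taylor_at_mfps c u * taylor_at_mfps c v"
proof (rule mfps_eqI)
  fix M
  have sm: "smooth_fps U (\<lambda>z. mfps_nth (u z) i)" "smooth_fps U (\<lambda>z. mfps_nth (v z) i)" for i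
    using assms by (auto simp: smooth_mfps_def)
  show "mfps_nth (taylor_at_mfps c (\<lambda>z. u z * v z)) M = mfps_nth (taylor_at_mfps c u * taylor_at_mfps c v) M"
    by (simp add: taylor_at_mfps_def mfps_nth_times taylor_at_sum finite_submultisets
        smooth_fps_mult[OF U(1)] sm taylor_at_mult fps_to_fls_sum fls_times_fps_to_fls)
qed

lemma taylor_at_mfps_cong:
  assumes "\<And>z. z \<in> U \<Longrightarrow> u z = v z"
  shows "taylor_at_mfps c u = taylor_at_mfps c v"
  unfolding taylor_at_mfps_def using taylor_at_cong[of "\<lambda>z. mfps_nth (u z) _" "\<lambda>z. mfps_nth (v z) _"] assms
  by simp

lemma taylor_at_mfps_add:
  assumes "smooth_mfps U u" "smooth_mfps U v"
  shows "taylor_at_mfps c (\<lambda>z. u z + v z) = taylor_at_mfps c u + taylor_at_mfps c v"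
proof (rule mfps_eqI)
  fix M
  show "mfps_nth (taylor_at_mfps c (\<lambda>z. u z + v z)) M = mfps_nth (taylor_at_mfps c u + taylor_at_mfps c v) M"
    using assms by (simp add: taylor_at_mfps_def taylor_at_add smooth_mfps_def)
qed

end

lemma taylor_at_const: "taylor_at c (\<lambda>_. k) = k"
proof (rule fps_ext)
  fix n
  have 0: "foldr partial_fps J (\<lambda>_. k) y = 0" if ne: "J \<noteq> []" for J :: "'a list" and y
  proof -
    obtain J' a where J: "J = J' @ [a]" using ne by (cases J rule: rev_exhaust) auto
    have "foldr partial J' (\<lambda>_. 0) = (\<lambda>_. 0)"
      by (induction J') (auto simp: partial_const)
    then show ?thesis
      by (intro fps_ext) (simp add: fps_nth_foldr_partial fps_nth_partial J partial_const)
  qed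
  have "fps_nth (taylor_at c (\<lambda>_. k)) n = (\<Sum>J | length (J :: 'a list) \<le> n. if J = [] then fps_nth k n else 0)"
    unfolding taylor_at_def fps_nth_Abs_fps by (rule sum.cong) (auto simp: 0)
  also have "\<dots> = fps_nth k n"
    using finite_lists_length_le[of "UNIV :: 'a set" n] by simp
  finally show "fps_nth (taylor_at c (\<lambda>_. k)) n = fps_nth k n" .
qed

lemma taylor_at_mfps_monom: "taylor_at_mfps c (\<lambda>_. mfps_monom M k) = mfps_monom M (fps_to_fls k)"
  by (rule mfps_eqI) (simp add: taylor_at_mfps_def taylor_at_const mfps_monom_nth)

section \<open>Fourier inversion as a sum over set partitions\<close>

lemma splits_map: "splits (map f J) = map (\<lambda>(P, Q). (map f P, map f Q)) (splits J)"
  by (induction J) (auto simp: case_prod_unfold)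

lemma splits_mset: "(P, Q) \<in> set (splits J) \<Longrightarrow> mset P + mset Q = mset J"
  by (induction J arbitrary: P Q) auto

text \<open>For distinct entries a split is determined by the set of its first part. This turns the
  Leibniz sum into the sum over subsets that occurs in \<open>part_sum_insert\<close>.\<close>

lemma sum_splits:
  fixes G :: "'a set \<Rightarrow> 'a set \<Rightarrow> 'r::comm_ring_1"
  assumes "distinct J"
  shows "(\<Sum>(P, Q)\<leftarrow>splits J. G (set P) (set Q)) = (\<Sum>Y\<in>Pow (set J). G Y (set J - Y))"
  using assms
proof (induction J arbitrary: G)
  case (Cons a J)
  then have a: "a \<notin> set J" and J: "distinct J" by auto
  have "(\<Sum>(P, Q)\<leftarrow>splits (a # J). G (set P) (set Q)) =
    (\<Sum>(P, Q)\<leftarrow>splits J. G (insert a (set P)) (set Q)) + (\<Sum>(P, Q)\<leftarrow>splits J. G (set P) (insert a (set Q)))"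
    by (simp add: case_prod_unfold o_def)
  also have "\<dots> = (\<Sum>Y\<in>Pow (set J). G (insert a Y) (set J - Y)) + (\<Sum>Y\<in>Pow (set J). G Y (insert a (set J - Y)))"
    using Cons.IH[OF J, of "\<lambda>A B. G (insert a A) B"] Cons.IH[OF J, of "\<lambda>A B. G A (insert a B)"] by simp
  also have "(\<Sum>Y\<in>Pow (set J). G (insert a Y) (set J - Y)) =
    (\<Sum>Y\<in>insert a ` Pow (set J). G Y (set (a # J) - Y))"
  proof -
    have "inj_on (insert a) (Pow (set J))" using a by (auto simp: inj_on_def)
    then show ?thesis using a by (simp add: sum.reindex)
  qed
  also have "(\<Sum>Y\<in>Pow (set J). G Y (insert a (set J - Y))) = (\<Sum>Y\<in>Pow (set J). G Y (set (a # J) - Y))"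
    using a by (intro sum.cong refl arg_cong2[where f = G]) auto
  also have "(\<Sum>Y\<in>insert a ` Pow (set J). G Y (set (a # J) - Y)) + (\<Sum>Y\<in>Pow (set J). G Y (set (a # J) - Y)) =
    (\<Sum>Y\<in>insert a ` Pow (set J) \<union> Pow (set J). G Y (set (a # J) - Y))"
    by (rule sum.union_disjoint[symmetric]) (use a in auto)
  also have "insert a ` Pow (set J) \<union> Pow (set J) = Pow (set (a # J))"
    by (simp add: Pow_insert Un_commute)
  finally show ?case .
qed simp

lemma mset_list_of_mset [simp]: "mset (list_of_mset M) = M"
  unfolding list_of_mset_def by (rule someI_ex) (rule ex_mset)

abbreviation hbar_mfps :: "('c, complex fps) mfps" where
  "hbar_mfps \<equiv> mfps_const (fps_const (1 / \<i>) * fps_X)"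

text \<open>Two spellings of \<open>\<hbar>/i\<close>: in power series the division is one of
  complex numbers, in Laurent series it is a quotient of series.\<close>

lemma fps_to_fls_hbar: "fps_to_fls (fps_const (1 / \<i>) * fps_X) = hbar_over_i"
proof -
  have "fls_const \<i> * fls_const \<i> = (- 1 :: complex fls)"
    by (simp add: fls_const_mult_const)
  moreover have "fls_const \<i> \<noteq> (0 :: complex fls)" by simp
  ultimately have "- fls_const \<i> = (1 / fls_const \<i> :: complex fls)"
    by (simp only: eq_divide_eq) simp
  then show ?thesis
    by (simp add: fls_times_fps_to_fls)
qed

lemma partial_mfps_const: "partial_mfps a (\<lambda>_. k) y = 0"
  by (intro mfps_eqI fps_ext) (simp add: mfps_nth_partial fps_nth_partial partial_const)

lemma smooth_mfps_sum_list:
  "open U \<Longrightarrow> (\<And>x. x \<in> set xs \<Longrightarrow> smooth_mfps U (u x)) \<Longrightarrow> smooth_mfps U (\<lambda>z. \<Sum>x\<leftarrow>xs. u x z)"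
  by (induction xs) (auto intro: smooth_mfps_add smooth_mfps_const)

context
  fixes U :: "(real^'b::finite) set" and S :: "real^'b \<Rightarrow> ('c, complex fps) mfps"
  assumes U: "open U" and S: "smooth_mfps U S"
begin

lemma smooth_twisted_partial: "smooth_mfps U u \<Longrightarrow> smooth_mfps U (twisted_partial S a u)"
  unfolding twisted_partial_def
  by (intro smooth_mfps_add smooth_mfps_mult smooth_mfps_partial smooth_mfps_const U S)

lemma smooth_foldr_twisted: "smooth_mfps U u \<Longrightarrow> smooth_mfps U (foldr (twisted_partial S) J u)"
  by (induction J) (auto intro: smooth_twisted_partial)

text \<open>The operator has order one, so a single factor takes up the phase term. The second
  factor is chosen for this; the first is hit by the plain derivative times
  \<open>\<hbar>/i\<close>.\<close>

lemma twisted_partial_mult: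
  assumes "smooth_mfps U u" "smooth_mfps U v" "y \<in> U"
  shows "twisted_partial S a (\<lambda>z. u z * v z) y =
    hbar_mfps * partial_mfps a u y * v y + u y * twisted_partial S a v y"
  by (simp add: twisted_partial_def partial_mfps_mult[OF U assms] algebra_simps)

lemma twisted_partial_cong:
  assumes "\<And>z. z \<in> U \<Longrightarrow> u z = v z" "y \<in> U"
  shows "twisted_partial S a u y = twisted_partial S a v y"
  using assms by (simp add: twisted_partial_def partial_mfps_cong[OF U assms])

lemma twisted_partial_sum_list:
  assumes "\<And>x. x \<in> set xs \<Longrightarrow> smooth_mfps U (u x)" "y \<in> U"
  shows "twisted_partial S a (\<lambda>z. \<Sum>x\<leftarrow>xs. u x z) y = (\<Sum>x\<leftarrow>xs. twisted_partial S a (u x) y)"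
  using assms(1)
proof (induction xs)
  case Nil
  then show ?case by (simp add: twisted_partial_def partial_mfps_const)
next
  case (Cons x xs)
  have "twisted_partial S a (\<lambda>z. u x z + (\<Sum>x\<leftarrow>xs. u x z)) y =
      twisted_partial S a (u x) y + twisted_partial S a (\<lambda>z. \<Sum>x\<leftarrow>xs. u x z) y"
    using partial_mfps_add[OF U _ smooth_mfps_sum_list[OF U] assms(2), of "u x" xs u a] Cons.prems
    by (simp add: twisted_partial_def algebra_simps)
  then show ?case using Cons by simp
qed

lemma foldr_twisted_mult:
  assumes "smooth_mfps U u" "smooth_mfps U v" "y \<in> U"
  shows "foldr (twisted_partial S) J (\<lambda>z. u z * v z) y =
    (\<Sum>(P, Q)\<leftarrow>splits J. hbar_mfps ^ length P * foldr partial_mfps P u y * foldr (twisted_partial S) Q v y)"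
  using assms(3)
proof (induction J arbitrary: y)
  case (Cons a J)
  let ?G = "\<lambda>P Q z. hbar_mfps ^ length P * foldr partial_mfps P u z * foldr (twisted_partial S) Q v z"
  have sm1: "smooth_mfps U (\<lambda>z. hbar_mfps ^ length P * foldr partial_mfps P u z)" for P
    by (intro smooth_mfps_mult smooth_mfps_const smooth_mfps_foldr_partial U assms)
  have sm2: "smooth_mfps U (foldr (twisted_partial S) Q v)" for Q
    by (intro smooth_foldr_twisted assms)
  have tw: "twisted_partial S a (?G P Q) y = ?G (a # P) Q y + ?G P (a # Q) y" for P Q
    unfolding twisted_partial_mult[OF sm1 sm2 Cons.prems]
      partial_mfps_mult[OF U smooth_mfps_const smooth_mfps_foldr_partial[OF assms(1)] Cons.prems]
    by (simp add: partial_mfps_const algebra_simps)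
  have "foldr (twisted_partial S) (a # J) (\<lambda>z. u z * v z) y =
     twisted_partial S a (\<lambda>z. \<Sum>PQ\<leftarrow>splits J. ?G (fst PQ) (snd PQ) z) y"
    using twisted_partial_cong[OF Cons.IH Cons.prems] by (simp add: case_prod_unfold)
  also have "\<dots> = (\<Sum>PQ\<leftarrow>splits J. twisted_partial S a (?G (fst PQ) (snd PQ)) y)"
    by (rule twisted_partial_sum_list) (intro smooth_mfps_mult[OF U] sm1 sm2 Cons.prems)+
  also have "\<dots> = (\<Sum>PQ\<leftarrow>splits (a # J). ?G (fst PQ) (snd PQ) y)"
    unfolding tw by (simp add: case_prod_unfold o_def sum_list_addf)
  finally show ?case by (simp only: case_prod_unfold)
qed simp

text \<open>Applied to 1, the innermost operator leaves the factor
  \<open>\<partial>\<^sub>a S\<close>, which is then differentiated plainly. The derivatives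
  \<open>P\<close> that hit this factor will form the block of \<open>a\<close>.\<close>

lemma foldr_twisted_snoc:
  assumes "y \<in> U"
  shows "foldr (twisted_partial S) (J @ [a]) (\<lambda>_. 1) y =
    (\<Sum>(P, Q)\<leftarrow>splits J. hbar_mfps ^ length P * foldr partial_mfps (P @ [a]) S y * foldr (twisted_partial S) Q (\<lambda>_. 1) y)"
proof -
  have "twisted_partial S a (\<lambda>_. 1) = (\<lambda>z. partial_mfps a S z * 1)"
    by (rule ext) (simp add: twisted_partial_def partial_mfps_const)
  then have "foldr (twisted_partial S) (J @ [a]) (\<lambda>_. 1) = foldr (twisted_partial S) J (\<lambda>z. partial_mfps a S z * 1)"
    by simp
  then show ?thesis
    using foldr_twisted_mult[OF smooth_mfps_partial[OF S, of a] smooth_mfps_const[of _ 1] assms, of J] by simp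
qed

end

section \<open>Derivatives of the phase as weights of white blocks\<close>

definition phase_derivative :: "('b::finite \<Rightarrow> complex fps) \<Rightarrow> (real^'b \<Rightarrow> ('c, complex fps) mfps) \<Rightarrow>
     'b multiset \<Rightarrow> ('c, complex fls) mfps" where
  "phase_derivative c S M = taylor_at_mfps c (foldr partial_mfps (list_of_mset M) S)"

text \<open>The \<open>\<hbar>/i\<close> per derivative, less the one cancelled by the factor \<open>i/\<hbar>\<close> in front of \<open>S\<close>.\<close>

definition phase_cumulant :: "('b::finite \<Rightarrow> complex fps) \<Rightarrow> (real^'b \<Rightarrow> ('c, complex fps) mfps) \<Rightarrow>
     'b multiset \<Rightarrow> ('c, complex fls) mfps" where
  "phase_cumulant c S M = mfps_const (hbar_over_i ^ (size M - 1)) * phase_derivative c S M"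

abbreviation restr :: "('i \<Rightarrow> 'b) \<Rightarrow> 'i set \<Rightarrow> 'b multiset" where
  "restr \<sigma> Y \<equiv> image_mset \<sigma> (mset_set Y)"

text \<open>Equal colours are told apart by the elements that carry them: an ordering of the colours
  lifts to an ordering of the elements.\<close>

lemma mset_eq_image_msetD:
  assumes "mset L = image_mset \<sigma> N"
  shows "\<exists>xs. mset xs = N \<and> map \<sigma> xs = L"
  using assms
proof (induction L arbitrary: N)
  case (Cons b L)
  then have "b \<in># image_mset \<sigma> N" by (metis list.set_intros(1) set_mset_mset)
  then obtain k where k: "k \<in># N" "b = \<sigma> k" by auto
  then obtain N' where N': "N = add_mset k N'" by (metis multi_member_split)
  then obtain xs where "mset xs = N'" "map \<sigma> xs = L" using Cons k by auto
  then show ?case using k N' by (intro exI[of _ "k # xs"]) auto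
qed auto

context
  fixes U :: "(real^'b::finite) set" and S :: "real^'b \<Rightarrow> ('c, complex fps) mfps" and c :: "'b \<Rightarrow> complex fps"
  assumes U: "open U" "base_point c \<in> U" and S: "smooth_mfps U S"
begin

lemma taylor_at_foldr_partial:
  "taylor_at_mfps c (foldr partial_mfps J S) = phase_derivative c S (mset J)"
  unfolding phase_derivative_def
  by (rule taylor_at_mfps_cong[OF U], rule foldr_partial_mfps_perm[OF U(1) S]) auto

lemma taylor_at_mfps_sum_list:
  "(\<And>x. x \<in> set xs \<Longrightarrow> smooth_mfps U (u x)) \<Longrightarrow>
   taylor_at_mfps c (\<lambda>z. \<Sum>x\<leftarrow>xs. u x z) = (\<Sum>x\<leftarrow>xs. taylor_at_mfps c (u x))"
proof (induction xs)
  case Nil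
  have "taylor_at_mfps c (\<lambda>_. mfps_const 0) = mfps_const 0"
    by (simp only: taylor_at_mfps_monom fps_zero_to_fls)
  then show ?case by simp
next
  case (Cons x xs)
  then show ?case
    using taylor_at_mfps_add[OF U, of "u x" "\<lambda>z. \<Sum>x\<leftarrow>xs. u x z"]
      smooth_mfps_sum_list[OF U(1), of xs u] by simp
qed

text \<open>Faa di Bruno's formula, by induction from the innermost derivative: the derivatives that
  hit its factor form one block, and the rest act on 1 again. Derivatives are labelled by the
  distinct entries of \<open>xs\<close>, since their indices may coincide.\<close>

lemma taylor_at_foldr_twisted:
  "distinct xs \<Longrightarrow> taylor_at_mfps c (foldr (twisted_partial S) (map \<sigma> xs) (\<lambda>_. 1)) =
    part_sum (\<lambda>Y. phase_cumulant c S (restr \<sigma> Y)) (set xs)"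
proof (induction "length xs" arbitrary: xs rule: less_induct)
  case less
  show ?case
  proof (cases xs rule: rev_exhaust)
    case Nil
    have "taylor_at_mfps c (\<lambda>_. mfps_const 1) = mfps_const 1"
      by (simp only: taylor_at_mfps_monom fps_one_to_fls)
    then show ?thesis by (simp add: Nil)
  next
    case (snoc ys a)
    then have ys: "distinct ys" "a \<notin> set ys" using less.prems by auto
    let ?m = "\<lambda>Q. taylor_at_mfps c (foldr (twisted_partial S) Q (\<lambda>_. 1))"
    let ?q = "\<lambda>Y. phase_cumulant c S (restr \<sigma> Y)"
    let ?G = "\<lambda>P Q z. hbar_mfps ^ length P * foldr partial_mfps (P @ [\<sigma> a]) S z *
        foldr (twisted_partial S) Q (\<lambda>_. 1) z"
    have sm: "smooth_mfps U (\<lambda>z. hbar_mfps ^ length P * foldr partial_mfps P' S z)"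
      "smooth_mfps U (foldr (twisted_partial S) Q (\<lambda>_. 1))" for P P' Q
      by (intro smooth_mfps_mult smooth_mfps_const smooth_mfps_foldr_partial smooth_foldr_twisted U S)+
    have tG: "taylor_at_mfps c (?G P Q) = 
        mfps_const (hbar_over_i ^ length P) * phase_derivative c S (mset (P @ [\<sigma> a])) * ?m Q" for P Q
    proof -
      have "taylor_at_mfps c (\<lambda>_. hbar_mfps ^ length P :: ('c, complex fps) mfps) = mfps_const (hbar_over_i ^ length P)"
      proof -
        have "fps_to_fls (p ^ k) = fps_to_fls p ^ k" for p :: "complex fps" and k
          by (induction k) (simp_all add: fls_times_fps_to_fls)
        then show ?thesis
          by (simp only: mfps_const_power[symmetric] taylor_at_mfps_monom fps_to_fls_hbar)
      qed
      then show ?thesis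
        by (simp only: taylor_at_mfps_mult[OF U sm] taylor_at_foldr_partial
            taylor_at_mfps_mult[OF U smooth_mfps_const smooth_mfps_foldr_partial[OF S]])
    qed
    have "?m (map \<sigma> xs) = taylor_at_mfps c (\<lambda>z. \<Sum>PQ\<leftarrow>splits (map \<sigma> ys). ?G (fst PQ) (snd PQ) z)"
      by (rule taylor_at_mfps_cong[OF U])
        (simp only: snoc map_append list.map foldr_twisted_snoc[OF U(1) S] case_prod_unfold)
    also have "\<dots> = (\<Sum>PQ\<leftarrow>splits (map \<sigma> ys). taylor_at_mfps c (?G (fst PQ) (snd PQ)))"
      by (rule taylor_at_mfps_sum_list) (intro smooth_mfps_mult[OF U(1)] sm)
    also have "\<dots> = (\<Sum>(P, Q)\<leftarrow>splits ys. mfps_const (hbar_over_i ^ length P) *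
        phase_derivative c S (mset (map \<sigma> P @ [\<sigma> a])) * ?m (map \<sigma> Q))"
      unfolding tG by (simp add: splits_map case_prod_unfold o_def)
    also have "\<dots> = (\<Sum>(P, Q)\<leftarrow>splits ys. ?q (insert a (set P)) * part_sum ?q (set Q))"
    proof (intro arg_cong[where f = sum_list] map_cong refl, clarify)
      fix P Q assume PQ: "(P, Q) \<in> set (splits ys)"
      then have m: "mset P + mset Q = mset ys" by (rule splits_mset)
      then have dPQ: "distinct P" "distinct Q"
        using ys(1) by (metis distinct_append mset_append mset_eq_imp_distinct_iff)+
      have aP: "a \<notin> set P" using m ys(2) by (metis set_mset_mset union_iff)
      have "length Q \<le> length ys" using m by (metis le_add2 size_mset size_union)
      then have "?m (map \<sigma> Q) = part_sum ?q (set Q)"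
        using less.hyps[OF _ dPQ(2)] snoc by simp
      \<comment> \<open>The block of \<open>a\<close> has one element more than \<open>P\<close>,
        whence the exponent \<open>size M - 1\<close> in \<open>phase_cumulant\<close>.\<close>
      moreover have "restr \<sigma> (insert a (set P)) = mset (map \<sigma> P @ [\<sigma> a])"
        using aP dPQ(1) by (simp add: mset_set_set)
      ultimately show "mfps_const (hbar_over_i ^ length P) *
        phase_derivative c S (mset (map \<sigma> P @ [\<sigma> a])) * ?m (map \<sigma> Q) =
        ?q (insert a (set P)) * part_sum ?q (set Q)"
        by (simp add: phase_cumulant_def)
    qed
    also have "\<dots> = (\<Sum>Y\<in>Pow (set ys). ?q (insert a Y) * part_sum ?q (set ys - Y))"
      by (rule sum_splits[OF ys(1), of "\<lambda>P Q. ?q (insert a P) * part_sum ?q Q"])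
    also have "\<dots> = part_sum ?q (set xs)"
      using part_sum_insert[of "set ys" a ?q] ys by (simp add: snoc)
    finally show ?thesis .
  qed
qed

lemma fourier_inversion_eq:
  assumes "finite X"
  shows "fourier_inversion c S (restr \<sigma> X) = part_sum (\<lambda>Y. phase_cumulant c S (restr \<sigma> Y)) X"
proof -
  \<comment> \<open>\<open>fourier_inversion\<close> orders the colours arbitrarily; that order is
    lifted to an enumeration of \<open>X\<close> to which the formula for lists applies.\<close>
  obtain xs where xs: "mset xs = mset_set X" "map \<sigma> xs = list_of_mset (restr \<sigma> X)"
    using mset_eq_image_msetD[of "list_of_mset (restr \<sigma> X)" \<sigma> "mset_set X"] by auto
  have "set xs = X" using arg_cong[OF xs(1), of set_mset] assms by simp
  moreover have "distinct xs"
    unfolding distinct_count_atmost_1 using xs(1) assms \<open>set xs = X\<close> by (auto simp: count_mset_set)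
  ultimately have "taylor_at_mfps c (foldr (twisted_partial S) (map \<sigma> xs) (\<lambda>_. 1)) =
    part_sum (\<lambda>Y. phase_cumulant c S (restr \<sigma> Y)) X"
    using taylor_at_foldr_twisted[of xs \<sigma>] by simp
  then show ?thesis
    unfolding fourier_inversion_def xs(2)[symmetric] .
qed

end

section \<open>Sums over edge colourings\<close>

text \<open>A colour is the coordinate index summed along an edge. Extensional functions make the
  colourings of a finite set finite in number.\<close>

definition colour_sum :: "(('i \<Rightarrow> 'b::finite) \<Rightarrow> 'i set \<Rightarrow> 'r::comm_ring_1) \<Rightarrow> 'i set \<Rightarrow> 'r" where
  "colour_sum t X = (\<Sum>\<sigma>\<in>X \<rightarrow>\<^sub>E UNIV. t \<sigma> X)"

definition local_weight :: "(('i \<Rightarrow> 'b) \<Rightarrow> 'i set \<Rightarrow> 'r) \<Rightarrow> bool" where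
  "local_weight t \<longleftrightarrow> (\<forall>\<sigma> \<tau> X. (\<forall>i\<in>X. \<sigma> i = \<tau> i) \<longrightarrow> t \<sigma> X = t \<tau> X)"

text \<open>Invariance under renaming the edges together with their colours. With locality it makes
  the colour sum a function of the cardinality.\<close>

definition natural_weight :: "(('i \<Rightarrow> 'b) \<Rightarrow> 'i set \<Rightarrow> 'r) \<Rightarrow> bool" where
  "natural_weight t \<longleftrightarrow> (\<forall>\<sigma> h X. finite X \<longrightarrow> X \<noteq> {} \<longrightarrow> inj_on h X \<longrightarrow> t \<sigma> (h ` X) = t (\<sigma> \<circ> h) X)"

text \<open>A colouring of a disjoint union is a pair of colourings, and by locality each weight
  sees its own half.\<close>

lemma colour_sum_product:
  fixes s t :: "('i \<Rightarrow> 'b::finite) \<Rightarrow> 'i set \<Rightarrow> 'r::comm_ring_1"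
  assumes "local_weight s" "local_weight t" "A \<inter> B = {}"
  shows "(\<Sum>\<sigma>\<in>(A \<union> B) \<rightarrow>\<^sub>E UNIV. s \<sigma> A * t \<sigma> B) = colour_sum s A * colour_sum t B"
proof -
  have "(\<Sum>\<sigma>\<in>(A \<union> B) \<rightarrow>\<^sub>E UNIV. s \<sigma> A * t \<sigma> B) =
    (\<Sum>(\<sigma>, \<tau>)\<in>(A \<rightarrow>\<^sub>E UNIV) \<times> (B \<rightarrow>\<^sub>E UNIV). s \<sigma> A * t \<tau> B)"
  proof (rule sum.reindex_bij_witness[where j = "\<lambda>\<sigma>. (restrict \<sigma> A, restrict \<sigma> B)"
        and i = "\<lambda>(\<sigma>, \<tau>) i. if i \<in> A then \<sigma> i else \<tau> i"])
    fix \<sigma> :: "'i \<Rightarrow> 'b" assume "\<sigma> \<in> (A \<union> B) \<rightarrow>\<^sub>E UNIV"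
    then show "(case (restrict \<sigma> A, restrict \<sigma> B) of (\<sigma>, \<tau>) \<Rightarrow> (\<lambda>i. if i \<in> A then \<sigma> i else \<tau> i)) = \<sigma>"
      by (auto simp: fun_eq_iff restrict_def PiE_def extensional_def)
    have "s (restrict \<sigma> A) A = s \<sigma> A" "t (restrict \<sigma> B) B = t \<sigma> B"
      using assms(1,2) unfolding local_weight_def by simp_all
    then show "(case (restrict \<sigma> A, restrict \<sigma> B) of (\<sigma>, \<tau>) \<Rightarrow> s \<sigma> A * t \<tau> B) = s \<sigma> A * t \<sigma> B"
      by simp
  qed (use assms(3) in \<open>auto simp: fun_eq_iff PiE_def extensional_def\<close>)
  then show ?thesis
    by (simp add: colour_sum_def sum_product sum.cartesian_product)
qed

lemma colour_sum_insert:
  fixes c t :: "('i \<Rightarrow> 'b::finite) \<Rightarrow> 'i set \<Rightarrow> 'r::comm_ring_1"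
  assumes "local_weight c" "local_weight t" "finite X" "a \<notin> X"
    and "\<And>\<sigma>. t \<sigma> (insert a X) = (\<Sum>Y\<in>Pow X. c \<sigma> (insert a Y) * t \<sigma> (X - Y))"
  shows "colour_sum t (insert a X) = (\<Sum>Y\<in>Pow X. colour_sum c (insert a Y) * colour_sum t (X - Y))"
proof -
  have "colour_sum t (insert a X) =
    (\<Sum>Y\<in>Pow X. \<Sum>\<sigma>\<in>insert a X \<rightarrow>\<^sub>E UNIV. c \<sigma> (insert a Y) * t \<sigma> (X - Y))"
    unfolding colour_sum_def assms(5) by (rule sum.swap)
  also have "\<dots> = (\<Sum>Y\<in>Pow X. colour_sum c (insert a Y) * colour_sum t (X - Y))"
  proof (rule sum.cong[OF refl])
    fix Y assume "Y \<in> Pow X"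
    then have "insert a X = insert a Y \<union> (X - Y)" "insert a Y \<inter> (X - Y) = {}" using assms(4) by auto
    then show "(\<Sum>\<sigma>\<in>insert a X \<rightarrow>\<^sub>E UNIV. c \<sigma> (insert a Y) * t \<sigma> (X - Y)) =
      colour_sum c (insert a Y) * colour_sum t (X - Y)"
      using colour_sum_product[OF assms(1,2)] by metis
  qed
  finally show ?thesis .
qed

lemma colour_sum_image:
  fixes t :: "('i \<Rightarrow> 'b::finite) \<Rightarrow> 'i set \<Rightarrow> 'r::comm_ring_1"
  assumes "local_weight t" "natural_weight t" "finite X" "X \<noteq> {}" "inj_on h X"
  shows "colour_sum t (h ` X) = colour_sum t X"
  unfolding colour_sum_def
proof (rule sum.reindex_bij_witness[where j = "\<lambda>\<sigma>. restrict (\<sigma> \<circ> h) X"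
      and i = "\<lambda>\<tau>. restrict (\<tau> \<circ> inv_into X h) (h ` X)"])
  fix \<sigma> :: "'i \<Rightarrow> 'b" assume s: "\<sigma> \<in> h ` X \<rightarrow>\<^sub>E UNIV"
  show "restrict (restrict (\<sigma> \<circ> h) X \<circ> inv_into X h) (h ` X) = \<sigma>"
    using s assms(5) by (auto simp: fun_eq_iff restrict_def PiE_def extensional_def)
  have "t (restrict (\<sigma> \<circ> h) X) X = t (\<sigma> \<circ> h) X"
    using assms(1) unfolding local_weight_def by simp
  also have "\<dots> = t \<sigma> (h ` X)"
    using assms(2-5) unfolding natural_weight_def by simp
  finally show "t (restrict (\<sigma> \<circ> h) X) X = t \<sigma> (h ` X)" .
next
  fix \<tau> :: "'i \<Rightarrow> 'b" assume "\<tau> \<in> X \<rightarrow>\<^sub>E UNIV"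
  then show "restrict (restrict (\<tau> \<circ> inv_into X h) (h ` X) \<circ> h) X = \<tau>"
    using assms(5) by (auto simp: fun_eq_iff restrict_def PiE_def extensional_def)
qed auto

lemma colour_sum_card:
  fixes t :: "(nat \<Rightarrow> 'b::finite) \<Rightarrow> nat set \<Rightarrow> 'r::comm_ring_1"
  assumes "local_weight t" "natural_weight t" "finite X"
  shows "colour_sum t X = colour_sum t {..<card X}"
proof (cases "X = {}")
  case False
  obtain h where h: "bij_betw h {..<card X} X"
    using ex_bij_betw_nat_finite[OF assms(3)] by (auto simp: lessThan_atLeast0)
  moreover have "0 \<in> {..<card X}" using False assms(3) by (simp add: card_gt_0_iff)
  then have "{..<card X} \<noteq> {}" by blast
  ultimately show ?thesis
    using colour_sum_image[OF assms(1,2), of "{..<card X}" h] by (simp add: bij_betw_def)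
qed simp

text \<open>It serves twice: with single blocks as components for
  \<open>exp (i/\<hbar> F^+)\<close>, and with connected pairs of partitions as components for the
  amplitude.\<close>

lemma colour_exponential:
  fixes t c :: "(nat \<Rightarrow> 'b::finite) \<Rightarrow> nat set \<Rightarrow> ('v, complex fls) mfps"
  assumes "local_weight c" "local_weight t" "natural_weight c" "natural_weight t"
    and empty: "\<And>\<sigma>. t \<sigma> {} = 1"
    and rec: "\<And>\<sigma> X a. finite X \<Longrightarrow> a \<notin> X \<Longrightarrow> t \<sigma> (insert a X) = (\<Sum>Y\<in>Pow X. c \<sigma> (insert a Y) * t \<sigma> (X - Y))"
  shows "Abs_fps (\<lambda>n. mfps_const (1 / fact n) * colour_sum t {..<n}) =
    series_exp (Abs_fps (\<lambda>n. if n = 0 then 0 else mfps_const (1 / fact n) * colour_sum c {..<n}))"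
proof (rule exponential_formula)
  show "colour_sum t {..<0} = 1"
    by (simp add: colour_sum_def empty)
  fix n
  have "colour_sum t {..<Suc n} = (\<Sum>Y\<in>Pow {..<n}. colour_sum c (insert n Y) * colour_sum t ({..<n} - Y))"
    unfolding lessThan_Suc by (rule colour_sum_insert) (use assms in auto)
  also have "\<dots> = (\<Sum>Y\<in>Pow {..<n}. colour_sum c {..<Suc (card Y)} * colour_sum t {..<n - card Y})"
  proof (rule sum.cong[OF refl])
    fix Y assume Y: "Y \<in> Pow {..<n}"
    then have "finite Y" "n \<notin> Y" using finite_subset by auto
    then have "card (insert n Y) = Suc (card Y)" "card ({..<n} - Y) = n - card Y"
      using Y by (auto simp: card_Diff_subset)
    then show "colour_sum c (insert n Y) * colour_sum t ({..<n} - Y) =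
        colour_sum c {..<Suc (card Y)} * colour_sum t {..<n - card Y}"
      using colour_sum_card[OF assms(1,3), of "insert n Y"] colour_sum_card[OF assms(2,4), of "{..<n} - Y"]
        \<open>finite Y\<close> by simp
  qed
  also have "\<dots> = (\<Sum>k\<le>n. of_nat (n choose k) * (colour_sum c {..<Suc k} * colour_sum t {..<n - k}))"
    using sum_Pow_card[of "{..<n}" "\<lambda>k. colour_sum c {..<Suc k} * colour_sum t {..<n - k}"] by simp
  finally show "colour_sum t {..<Suc n} = \<dots>" .
qed

lemma restr_cong: "(\<forall>i\<in>X. \<sigma> i = \<tau> i) \<Longrightarrow> Y \<subseteq> X \<Longrightarrow> restr \<sigma> Y = restr \<tau> Y"
  by (rule image_mset_cong) (metis elem_mset_set empty_iff infinite_set_mset_mset_set subsetD)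

lemma restr_image: "inj_on h X \<Longrightarrow> restr \<sigma> (h ` X) = restr (\<sigma> \<circ> h) X"
  by (simp add: image_mset_mset_set[symmetric] multiset.map_comp o_def)

lemma map_upt_eq_restr: "mset (map \<sigma> [0..<n]) = restr \<sigma> {..<n}"
  by (simp add: lessThan_atLeast0)

lemma sum_lists_PiE:
  fixes g :: "'b::finite list \<Rightarrow> 'r::comm_monoid_add"
  shows "(\<Sum>I | length I = n. g I) = (\<Sum>\<sigma>\<in>{..<n} \<rightarrow>\<^sub>E UNIV. g (map \<sigma> [0..<n]))"
  by (rule sum.reindex_bij_witness[where i = "\<lambda>\<sigma>. map \<sigma> [0..<n]" and j = "\<lambda>I. restrict ((!) I) {..<n}"])
    (auto simp: fun_eq_iff PiE_def extensional_def intro!: nth_equalityI arg_cong[where f = g])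

section \<open>The logarithm of the amplitude\<close>

text \<open>The factor \<open>(size M)!\<close> passes from monomials, which are ordered tuples, to blocks of a partition.\<close>

definition vertex_weight :: "('b::finite list \<Rightarrow> complex fps) \<Rightarrow> 'b multiset \<Rightarrow> complex fls" where
  "vertex_weight f M = (if size M \<ge> 2
     then fact (size M) * (i_over_hbar * fps_to_fls (f (list_of_mset M))) else 0)"

definition connected_weight :: "('b::finite list \<Rightarrow> complex fps) \<Rightarrow> ('b multiset \<Rightarrow> ('c, complex fls) mfps) \<Rightarrow>
    (nat \<Rightarrow> 'b) \<Rightarrow> nat set \<Rightarrow> ('c, complex fls) mfps" where
  "connected_weight f q \<sigma> X =
     conn_sum (\<lambda>Y. mfps_const (vertex_weight f (restr \<sigma> Y))) (\<lambda>Y. q (restr \<sigma> Y)) X"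

definition connected_series :: "('b::finite list \<Rightarrow> complex fps) \<Rightarrow> ('b multiset \<Rightarrow> ('c, complex fls) mfps) \<Rightarrow> 'c series" where
  "connected_series f q = Abs_fps (\<lambda>n. if n = 0 then 0
     else mfps_const (1 / fact n) * colour_sum (connected_weight f q) {..<n})"

lemma mfps_const_part_sum: "mfps_const (part_sum u X) = part_sum (\<lambda>Y. mfps_const (u Y)) X"
  by (simp add: part_sum_def mfps_monom_sum mfps_const_prod)

lemma finite_multisets_size: "finite {M :: 'b::finite multiset. size M = n}"
proof (rule finite_subset)
  show "{M :: 'b multiset. size M = n} \<subseteq> mset ` {J. length J = n}"
    by (metis (mono_tags, lifting) ex_mset image_eqI mem_Collect_eq size_mset subsetI)
qed (simp add: finite_lists_length)

text \<open>The factors in a term of the exponential become the blocks of a partition. For a single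
  block the factorial in \<open>vertex_weight\<close> cancels the \<open>1 / fact n\<close> of the
  generating function; the monomial records the momenta.\<close>

lemma higher_part_exponential:
  fixes f :: "'b::finite list \<Rightarrow> complex fps"
  assumes sym: "\<And>I J. mset I = mset J \<Longrightarrow> f I = f J"
  shows "series_exp (scalar i_over_hbar * higher_part f) =
    Abs_fps (\<lambda>n. mfps_const (1 / fact n) * colour_sum (\<lambda>\<sigma> X. mfps_monom (restr \<sigma> X)
      (part_sum (\<lambda>Y. vertex_weight f (restr \<sigma> Y)) X)) {..<n})"
    (is "_ = Abs_fps (\<lambda>n. _ * colour_sum ?t _)")
proof -
  let ?c = "\<lambda>\<sigma> X. mfps_monom (restr \<sigma> X) (vertex_weight f (restr \<sigma> X))"
  have "scalar i_over_hbar * higher_part f =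
    Abs_fps (\<lambda>n. if n = 0 then 0 else mfps_const (1 / fact n) * colour_sum ?c {..<n})"
  proof (rule fps_ext)
    fix n
    have c: "colour_sum ?c {..<n} = (\<Sum>I | length I = n. mfps_monom (mset I) (vertex_weight f (mset I)))"
      unfolding sum_lists_PiE colour_sum_def map_upt_eq_restr ..
    have f: "f (list_of_mset (mset I)) = f I" for I by (rule sym) simp
    show "fps_nth (scalar i_over_hbar * higher_part f) n =
      fps_nth (Abs_fps (\<lambda>n. if n = 0 then 0 else mfps_const (1 / fact n) * colour_sum ?c {..<n})) n"
      unfolding fps_mult_left_const_nth fps_nth_Abs_fps c higher_part_def
      by (auto simp: vertex_weight_def f sum_distrib_left mfps_const_mult_monom intro!: sum.cong)
  qed
  moreover have "Abs_fps (\<lambda>n. mfps_const (1 / fact n) * colour_sum ?t {..<n}) =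
    series_exp (Abs_fps (\<lambda>n. if n = 0 then 0 else mfps_const (1 / fact n) * colour_sum ?c {..<n}))"
  proof (rule colour_exponential)
    show "local_weight ?c" by (simp add: local_weight_def restr_cong[OF _ order.refl] cong: restr_cong)
    show "local_weight ?t"
      unfolding local_weight_def
    proof (intro allI impI)
      fix \<sigma> \<tau> :: "nat \<Rightarrow> 'b" and X assume st: "\<forall>i\<in>X. \<sigma> i = \<tau> i"
      then have "restr \<sigma> Y = restr \<tau> Y" if "Y \<subseteq> X" for Y using restr_cong that by blast
      then show "?t \<sigma> X = ?t \<tau> X"
        using part_sum_cong[of X "\<lambda>Y. vertex_weight f (restr \<sigma> Y)" "\<lambda>Y. vertex_weight f (restr \<tau> Y)"] by simp
    qed
    show "natural_weight ?c" by (simp add: natural_weight_def restr_image o_def)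
    show "natural_weight ?t"
      unfolding natural_weight_def
    proof (intro allI impI)
      fix \<sigma> :: "nat \<Rightarrow> 'b" and h :: "nat \<Rightarrow> nat" and X assume fX: "finite X" and h: "inj_on h X"
      have "part_sum (\<lambda>Y. vertex_weight f (restr \<sigma> (h ` Y))) X = part_sum (\<lambda>Y. vertex_weight f (restr (\<sigma> \<circ> h) Y)) X"
        using h by (intro part_sum_cong) (simp only: restr_image[OF inj_on_subset])
      then show "?t \<sigma> (h ` X) = ?t (\<sigma> \<circ> h) X"
        by (simp only: part_sum_image[OF fX h] restr_image[OF h])
    qed
    show "?t \<sigma> {} = 1" for \<sigma> by simp
    fix \<sigma> :: "nat \<Rightarrow> 'b" and X :: "nat set" and a assume X: "finite X" "a \<notin> X"
    \<comment> \<open>Cutting off a block splits the multiset of momenta, so the monomials multiply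
      along the recursion.\<close>
    have "restr \<sigma> (insert a X) = restr \<sigma> (insert a Y) + restr \<sigma> (X - Y)" if "Y \<in> Pow X" for Y
    proof -
      have "finite Y" "insert a X = insert a Y \<union> (X - Y)" "insert a Y \<inter> (X - Y) = {}"
        using that X finite_subset by auto
      then show ?thesis using X by (metis finite_Diff finite_insert image_mset_union mset_set_Union)
    qed
    then show "?t \<sigma> (insert a X) = (\<Sum>Y\<in>Pow X. ?c \<sigma> (insert a Y) * ?t \<sigma> (X - Y))"
      by (simp only: part_sum_insert[OF X] mfps_monom_sum mfps_monom_mult cong: sum.cong)
  qed
  ultimately show ?thesis by simp
qed

lemma local_connected_weight: "local_weight (connected_weight f q)"
  unfolding local_weight_def connected_weight_def
proof (intro allI impI conn_sum_cong)
  fix \<sigma> \<tau> :: "nat \<Rightarrow> 'a" and X Y assume "\<forall>i\<in>X. \<sigma> i = \<tau> i" "Y \<subseteq> X"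
  then have "restr \<sigma> Y = restr \<tau> Y" by (rule restr_cong)
  then show "mfps_const (vertex_weight f (restr \<sigma> Y)) = mfps_const (vertex_weight f (restr \<tau> Y))"
    and "q (restr \<sigma> Y) = q (restr \<tau> Y)" by simp_all
qed

lemma natural_connected_weight: "natural_weight (connected_weight f q)"
  unfolding natural_weight_def
proof (intro allI impI)
  fix \<sigma> :: "nat \<Rightarrow> 'a" and h :: "nat \<Rightarrow> nat" and X assume X: "finite X" "X \<noteq> {}" and h: "inj_on h X"
  have "restr \<sigma> (h ` Y) = restr (\<sigma> \<circ> h) Y" if "Y \<subseteq> X" for Y
    by (rule restr_image[OF inj_on_subset[OF h that]])
  then show "connected_weight f q \<sigma> (h ` X) = connected_weight f q (\<sigma> \<circ> h) X"
    unfolding connected_weight_def conn_sum_image[OF X(1) h X(2)] by (intro conn_sum_cong) simp_all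
qed

text \<open>\<open>part_sum_mult_insert\<close> is the required recursion, with
  \<open>connected_weight\<close> as the weight of a component.\<close>

lemma pair_exponential:
  fixes f :: "'b::finite list \<Rightarrow> complex fps" and q :: "'b multiset \<Rightarrow> ('c, complex fls) mfps"
  shows "Abs_fps (\<lambda>n. mfps_const (1 / fact n) * colour_sum (\<lambda>\<sigma> X.
      part_sum (\<lambda>Y. mfps_const (vertex_weight f (restr \<sigma> Y))) X * part_sum (\<lambda>Y. q (restr \<sigma> Y)) X) {..<n}) =
    series_exp (connected_series f q)"
    (is "Abs_fps (\<lambda>n. _ * colour_sum ?t _) = _")
  unfolding connected_series_def
proof (rule colour_exponential)
  show "local_weight (connected_weight f q)" by (rule local_connected_weight)
  show "natural_weight (connected_weight f q)" by (rule natural_connected_weight)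
  show "local_weight ?t"
    unfolding local_weight_def
  proof (intro allI impI arg_cong2[where f = times] part_sum_cong)
    fix \<sigma> \<tau> :: "nat \<Rightarrow> 'b" and X Y assume "\<forall>i\<in>X. \<sigma> i = \<tau> i" "Y \<subseteq> X"
    then have "restr \<sigma> Y = restr \<tau> Y" by (rule restr_cong)
    then show "mfps_const (vertex_weight f (restr \<sigma> Y)) = mfps_const (vertex_weight f (restr \<tau> Y))"
      and "q (restr \<sigma> Y) = q (restr \<tau> Y)" by simp_all
  qed
  show "natural_weight ?t"
    unfolding natural_weight_def
  proof (intro allI impI)
    fix \<sigma> :: "nat \<Rightarrow> 'b" and h :: "nat \<Rightarrow> nat" and X assume fX: "finite X" and h: "inj_on h X"
    have "restr \<sigma> (h ` Y) = restr (\<sigma> \<circ> h) Y" if "Y \<subseteq> X" for Y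
      by (rule restr_image[OF inj_on_subset[OF h that]])
    then show "?t \<sigma> (h ` X) = ?t (\<sigma> \<circ> h) X"
      unfolding part_sum_image[OF fX h] by (intro arg_cong2[where f = times] part_sum_cong) simp_all
  qed
  show "?t \<sigma> {} = 1" for \<sigma> by simp
  fix \<sigma> :: "nat \<Rightarrow> 'b" and X :: "nat set" and a assume X: "finite X" "a \<notin> X"
  show "?t \<sigma> (insert a X) = (\<Sum>Y\<in>Pow X. connected_weight f q \<sigma> (insert a Y) * ?t \<sigma> (X - Y))"
    unfolding connected_weight_def by (rule part_sum_mult_insert[OF X])
qed

text \<open>The coefficient of a momentum monomial and the Fourier inversion of that monomial are
  expanded with the same colouring. This couples the partition into black blocks with the one into
  white blocks.\<close>

lemma amplitude_eq:
  fixes F :: "real^'a::finite \<Rightarrow> 'b::finite list \<Rightarrow> complex fps"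
    and G :: "real^'b \<Rightarrow> 'c::finite list \<Rightarrow> complex fps"
  assumes U: "open U" "base_point (formal_map F x) \<in> U"
    and S: "smooth_mfps U (\<lambda>y. momentum_series (G y))"
    and sym: "\<And>I J. mset I = mset J \<Longrightarrow> F x I = F x J"
  shows "osc_amplitude (composition_integral F G x) =
    series_exp (connected_series (F x) (phase_cumulant (formal_map F x) (\<lambda>y. momentum_series (G y))))"
proof -
  let ?c = "formal_map F x" and ?S = "\<lambda>y. momentum_series (G y)"
  let ?E = "series_exp (scalar i_over_hbar * higher_part (F x))"
  let ?P = "\<lambda>\<sigma> X. part_sum (\<lambda>Y. vertex_weight (F x) (restr \<sigma> Y)) X"
  let ?Q = "\<lambda>\<sigma> X. part_sum (\<lambda>Y. phase_cumulant ?c ?S (restr \<sigma> Y)) X"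
  have "fps_nth (osc_amplitude (composition_integral F G x)) n =
     mfps_const (1 / fact n) * colour_sum (\<lambda>\<sigma> X. mfps_const (?P \<sigma> X) * ?Q \<sigma> X) {..<n}" for n
  proof -
    have E: "mfps_nth (fps_nth ?E n) M =
      1 / fact n * (\<Sum>\<sigma>\<in>{..<n} \<rightarrow>\<^sub>E UNIV. if M = restr \<sigma> {..<n} then ?P \<sigma> {..<n} else 0)" for M
      by (simp only: higher_part_exponential[OF sym] fps_nth_Abs_fps mfps_nth_const_mult colour_sum_def
          mfps_nth_sum mfps_monom_nth)
    have "fps_nth (osc_amplitude (composition_integral F G x)) n =
      (\<Sum>M | size M = n. mfps_const (mfps_nth (fps_nth ?E n) M) * fourier_inversion ?c ?S M)"
      by (simp add: composition_integral_def Let_def)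
    also have "\<dots> = (\<Sum>M | size M = n. \<Sum>\<sigma>\<in>{..<n} \<rightarrow>\<^sub>E UNIV. if M = restr \<sigma> {..<n} then
        mfps_const (1 / fact n) * (mfps_const (?P \<sigma> {..<n}) * fourier_inversion ?c ?S (restr \<sigma> {..<n})) else 0)"
      unfolding E mfps_const_mult mfps_monom_sum sum_distrib_left sum_distrib_right
      by (intro sum.cong refl) (simp add: mult.assoc)
    also have "\<dots> = (\<Sum>\<sigma>\<in>{..<n} \<rightarrow>\<^sub>E UNIV. \<Sum>M | size M = n. if M = restr \<sigma> {..<n} then
        mfps_const (1 / fact n) * (mfps_const (?P \<sigma> {..<n}) * fourier_inversion ?c ?S (restr \<sigma> {..<n})) else 0)"
      by (rule sum.swap)
    \<comment> \<open>A colouring contributes to the single multiset of its own colours, which has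
      size \<open>n\<close>, so the sum over \<open>M\<close> collapses.\<close>
    also have "\<dots> = (\<Sum>\<sigma>\<in>{..<n} \<rightarrow>\<^sub>E UNIV. 
        mfps_const (1 / fact n) * (mfps_const (?P \<sigma> {..<n}) * fourier_inversion ?c ?S (restr \<sigma> {..<n})))"
      by (intro sum.cong refl) (simp add: finite_multisets_size)
    also have "\<dots> = mfps_const (1 / fact n) * colour_sum (\<lambda>\<sigma> X. mfps_const (?P \<sigma> X) * ?Q \<sigma> X) {..<n}"
      by (simp add: colour_sum_def sum_distrib_left fourier_inversion_eq[OF U S])
    finally show ?thesis .
  qed
  then have "osc_amplitude (composition_integral F G x) =
    Abs_fps (\<lambda>n. mfps_const (1 / fact n) * colour_sum (\<lambda>\<sigma> X. mfps_const (?P \<sigma> X) * ?Q \<sigma> X) {..<n})"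
    by (intro fps_ext) simp
  then show ?thesis
    unfolding pair_exponential[symmetric] mfps_const_part_sum .
qed

section \<open>Partitions as kernels of surjections\<close>

text \<open>Such a map sends a numbered edge to its end; surjectivity says that no vertex is
  isolated.\<close>

definition surj_maps :: "'a set \<Rightarrow> 'v set \<Rightarrow> ('a \<Rightarrow> 'v) set" where
  "surj_maps X V = {\<phi> \<in> X \<rightarrow>\<^sub>E V. \<phi> ` X = V}"

definition fibre :: "'a set \<Rightarrow> ('a \<Rightarrow> 'v) \<Rightarrow> 'v \<Rightarrow> 'a set" where
  "fibre X \<phi> v = {i \<in> X. \<phi> i = v}"

definition kernel :: "'a set \<Rightarrow> ('a \<Rightarrow> 'v) \<Rightarrow> 'a set set" where
  "kernel X \<phi> = fibre X \<phi> ` \<phi> ` X"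

lemma finite_surj_maps: "finite X \<Longrightarrow> finite V \<Longrightarrow> finite (surj_maps X V)"
  unfolding surj_maps_def by (simp add: finite_PiE)

lemma inj_on_fibre: "inj_on (fibre X \<phi>) (\<phi> ` X)"
  by (auto simp: inj_on_def fibre_def)

lemma partition_on_kernel: "partition_on X (kernel X \<phi>)"
  by (rule partition_onI) (auto simp: kernel_def fibre_def disjnt_def)

lemma card_kernel: "\<phi> \<in> surj_maps X V \<Longrightarrow> card (kernel X \<phi>) = card V"
  unfolding kernel_def surj_maps_def by (simp add: card_image inj_on_fibre[of X \<phi>, THEN inj_on_subset])

lemma prod_kernel:
  fixes u :: "'a set \<Rightarrow> 'r::comm_monoid_mult"
  shows "\<phi> \<in> surj_maps X V \<Longrightarrow> (\<Prod>v\<in>V. u (fibre X \<phi> v)) = (\<Prod>B\<in>kernel X \<phi>. u B)"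
  unfolding kernel_def surj_maps_def using inj_on_fibre[of X \<phi>] by (auto simp: prod.reindex)

lemma kernel_eq_iff:
  fixes \<phi> \<psi> :: "'a \<Rightarrow> 'v"
  assumes "kernel X \<phi> = kernel X \<psi>" "i \<in> X" "j \<in> X"
  shows "\<phi> i = \<phi> j \<longleftrightarrow> \<psi> i = \<psi> j"
proof -
  have *: "\<psi> i = \<psi> j" if k: "kernel X \<phi> = kernel X \<psi>" and eq: "\<phi> i = \<phi> j" for \<phi> \<psi> :: "'a \<Rightarrow> 'v"
  proof -
    have "fibre X \<phi> (\<phi> i) \<in> kernel X \<psi>" using k assms(2) by (auto simp: kernel_def)
    then obtain v where "fibre X \<phi> (\<phi> i) = fibre X \<psi> v" by (auto simp: kernel_def)
    moreover have "i \<in> fibre X \<phi> (\<phi> i)" "j \<in> fibre X \<phi> (\<phi> i)" using assms eq by (auto simp: fibre_def)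
    ultimately show ?thesis by (auto simp: fibre_def)
  qed
  show ?thesis using *[of \<phi> \<psi>] *[of \<psi> \<phi>] assms(1) by auto
qed

text \<open>The maps with a given kernel form a torsor under the permutations of \<open>V\<close>:
  with one of them, \<open>\<phi>0\<close>, fixed, each is a unique permutation after
  \<open>\<phi>0\<close>.\<close>

lemma card_surj_maps_kernel:
  fixes V :: "'v set"
  assumes "finite X" "finite V" "partition_on X P" "card P = card V"
  shows "card {\<phi> \<in> surj_maps X V. kernel X \<phi> = P} = fact (card V)"
proof -
  obtain \<beta> where \<beta>: "bij_betw \<beta> P V"
    using finite_same_card_bij[OF finite_elements[OF assms(1,3)] assms(2,4)] by blast
  \<comment> \<open>The block of \<open>i\<close>; followed by a bijection from blocks to vertices
    it gives one map with kernel \<open>P\<close>.\<close>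
  define blk where "blk i = (THE B. B \<in> P \<and> i \<in> B)" for i
  have blk: "blk i = B" if "B \<in> P" "i \<in> B" for i B
    unfolding blk_def using assms(3) that unfolding partition_on_def disjoint_def
    by (intro the_equality) auto
  have X: "X = \<Union>P" using assms(3) by (simp add: partition_on_def)
  have ne: "B \<noteq> {}" if "B \<in> P" for B using that assms(3) by (auto simp: partition_on_def)
  define \<phi>0 where "\<phi>0 = restrict (\<lambda>i. \<beta> (blk i)) X"
  have \<phi>0: "\<phi>0 i = \<beta> B" if "B \<in> P" "i \<in> B" for i B
    using that X blk by (auto simp: \<phi>0_def)
  have fib: "fibre X \<phi>0 (\<beta> B) = B" if B: "B \<in> P" for B
  proof -
    have "i \<in> B" if i: "i \<in> X" "\<phi>0 i = \<beta> B" for i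
    proof -
      obtain B' where B': "B' \<in> P" "i \<in> B'" using i X by auto
      then have "\<beta> B' = \<beta> B" using \<phi>0 i by auto
      then have "B' = B" using \<beta> B B' by (auto simp: bij_betw_def inj_on_def)
      then show ?thesis using B' by simp
    qed
    then show ?thesis using \<phi>0 B X by (auto simp: fibre_def)
  qed
  have img: "\<phi>0 ` X = V"
  proof
    show "\<phi>0 ` X \<subseteq> V" using \<phi>0 X \<beta> by (auto simp: bij_betw_def)
    show "V \<subseteq> \<phi>0 ` X"
    proof
      fix v assume "v \<in> V"
      then obtain B where "B \<in> P" "v = \<beta> B" using \<beta> by (auto simp: bij_betw_def)
      moreover then obtain i where "i \<in> B" using ne by blast
      ultimately show "v \<in> \<phi>0 ` X" using \<phi>0 X by force
    qed
  qed
  have surj0: "\<phi>0 \<in> surj_maps X V"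
    using img by (auto simp: surj_maps_def \<phi>0_def)
  have ker0: "kernel X \<phi>0 = P"
  proof -
    have "V = \<beta> ` P" using \<beta> by (auto simp: bij_betw_def)
    then show ?thesis using fib unfolding kernel_def img by (simp add: image_image)
  qed
  let ?A = "\<lambda>\<pi>. restrict (\<pi> \<circ> \<phi>0) X"
  have "{\<phi> \<in> surj_maps X V. kernel X \<phi> = P} = ?A ` {\<pi>. \<pi> permutes V}"
  proof (intro equalityI subsetI)
    fix \<phi> assume "\<phi> \<in> {\<phi> \<in> surj_maps X V. kernel X \<phi> = P}"
    then have \<phi>: "\<phi> \<in> X \<rightarrow>\<^sub>E V" "\<phi> ` X = V" and eq: "\<And>i j. i \<in> X \<Longrightarrow> j \<in> X \<Longrightarrow> \<phi> i = \<phi> j \<longleftrightarrow> \<phi>0 i = \<phi>0 j"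
      using kernel_eq_iff[of X \<phi> \<phi>0] ker0 by (auto simp: surj_maps_def)
    \<comment> \<open>Any preimage of \<open>v\<close> will do, because equal kernels make
      \<open>\<phi>\<close> constant on the fibres of \<open>\<phi>0\<close>.\<close>
    define \<pi> where "\<pi> v = (if v \<in> V then \<phi> (inv_into X \<phi>0 v) else v)" for v
    have \<pi>: "\<pi> (\<phi>0 i) = \<phi> i" if "i \<in> X" for i
      using that eq img by (auto simp: \<pi>_def f_inv_into_f inv_into_into)
    have "\<pi> ` V = V"
    proof -
      have "\<pi> ` \<phi>0 ` X = \<phi> ` X" using \<pi> by (auto simp: image_image)
      then show ?thesis using img \<phi> by simp
    qed
    then have "bij_betw \<pi> V V" using assms(2) by (simp add: bij_betw_def eq_card_imp_inj_on)
    then have "\<pi> permutes V" by (rule bij_imp_permutes) (simp add: \<pi>_def)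
    moreover have "\<phi> = ?A \<pi>" using \<phi>(1) \<pi> by (auto simp: fun_eq_iff restrict_def PiE_def extensional_def)
    ultimately show "\<phi> \<in> ?A ` {\<pi>. \<pi> permutes V}" by blast
  next
    fix \<phi> assume "\<phi> \<in> ?A ` {\<pi>. \<pi> permutes V}"
    then obtain \<pi> where \<pi>: "\<pi> permutes V" "\<phi> = ?A \<pi>" by auto
    have im: "\<phi> ` X = V" using img permutes_image[OF \<pi>(1)] \<pi>(2) by (auto simp: image_comp[symmetric])
    have "fibre X \<phi> (\<pi> v) = fibre X \<phi>0 v" for v
      using inj_eq[OF permutes_inj[OF \<pi>(1)]] by (auto simp: fibre_def \<pi>(2))
    then have "fibre X \<phi> ` \<pi> ` V = fibre X \<phi>0 ` V" by (simp add: image_image)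
    then have "kernel X \<phi> = P"
      using ker0 permutes_image[OF \<pi>(1)] unfolding kernel_def im img by simp
    moreover have "\<phi> \<in> surj_maps X V" using im \<pi>(2) by (auto simp: surj_maps_def)
    ultimately show "\<phi> \<in> {\<phi> \<in> surj_maps X V. kernel X \<phi> = P}" by simp
  qed
  moreover have "inj_on ?A {\<pi>. \<pi> permutes V}"
  proof (rule inj_onI, clarify)
    fix \<pi> \<rho> assume p: "\<pi> permutes V" "\<rho> permutes V" and eq: "?A \<pi> = ?A \<rho>"
    show "\<pi> = \<rho>"
    proof
      fix v show "\<pi> v = \<rho> v"
      proof (cases "v \<in> V")
        case True
        then obtain i where "i \<in> X" "v = \<phi>0 i" using img by auto
        then show ?thesis using fun_cong[OF eq, of i] by simp
      qed (use p in \<open>auto simp: permutes_def\<close>)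
    qed
  qed
  ultimately show ?thesis
    using card_permutations[OF refl assms(2)] by (simp add: card_image)
qed

text \<open>Passing from numbered vertices to blocks produces the factorials that cancel those of
  the orbit count.\<close>

lemma sum_surj_maps_kernel:
  fixes H :: "'a set set \<Rightarrow> 'r::comm_ring_1" and V :: "'v set"
  assumes "finite X" "finite V"
  shows "(\<Sum>\<phi>\<in>surj_maps X V. H (kernel X \<phi>)) =
    of_nat (fact (card V)) * (\<Sum>P | partition_on X P \<and> card P = card V. H P)"
proof -
  have fin: "finite {P. partition_on X P \<and> card P = card V}"
    by (rule finite_subset[OF _ finitely_many_partition_on[OF assms(1)]]) auto
  have "(\<Sum>\<phi>\<in>surj_maps X V. H (kernel X \<phi>)) = (\<Sum>P | partition_on X P \<and> card P = card V.
      \<Sum>\<phi> | \<phi> \<in> surj_maps X V \<and> kernel X \<phi> = P. H (kernel X \<phi>))"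
    by (rule sum.group[symmetric])
      (use assms fin in \<open>auto simp: finite_surj_maps partition_on_kernel card_kernel\<close>)
  also have "\<dots> = (\<Sum>P | partition_on X P \<and> card P = card V. of_nat (fact (card V)) * H P)"
    by (rule sum.cong[OF refl]) (simp add: card_surj_maps_kernel[OF assms])
  finally show ?thesis by (simp add: sum_distrib_left)
qed

section \<open>Labels of white vertices\<close>

lemma sum_mset_subset:
  fixes M :: "'a multiset"
  shows "finite W \<Longrightarrow> w \<in> W \<Longrightarrow> f w \<subseteq># (\<Sum>w\<in>W. f w)"
  by (simp add: sum.remove)

lemma finite_lists_mset: "finite {I. mset I = M}"
  using finite_permutations_of_multiset[of M] by (simp add: permutations_of_multiset_def)

lemma finite_label_functions:
  assumes "finite W"
  shows "finite {\<alpha> \<in> W \<rightarrow>\<^sub>E UNIV. (\<Sum>w\<in>W. mset (\<alpha> w)) = (M :: 'c multiset)}"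
proof (rule finite_subset)
  show "{\<alpha> \<in> W \<rightarrow>\<^sub>E UNIV. (\<Sum>w\<in>W. mset (\<alpha> w)) = M} \<subseteq> W \<rightarrow>\<^sub>E (\<Union>N\<in>{N. N \<subseteq># M}. {I. mset I = N})"
  proof
    fix \<alpha> assume a: "\<alpha> \<in> {\<alpha> \<in> W \<rightarrow>\<^sub>E UNIV. (\<Sum>w\<in>W. mset (\<alpha> w)) = M}"
    have "mset (\<alpha> w) \<subseteq># M" if "w \<in> W" for w
      using sum_mset_subset[OF assms that, of "\<lambda>w. mset (\<alpha> w)"] a by simp
    then show "\<alpha> \<in> W \<rightarrow>\<^sub>E (\<Union>N\<in>{N. N \<subseteq># M}. {I. mset I = N})"
      using a by (simp add: PiE_iff)
  qed
  show "finite (W \<rightarrow>\<^sub>E (\<Union>N\<in>{N. N \<subseteq># M}. {I. mset I = N}))"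
    using assms by (intro finite_PiE finite_UN_I finite_submultisets finite_lists_mset)
qed

text \<open>Multiplying out: the label lists of different vertices are chosen independently, and the
  coefficient at \<open>M\<close> selects the choices whose labels together make up
  \<open>M\<close>.\<close>

lemma mfps_nth_prod_labels:
  fixes d :: "'w \<Rightarrow> 'c list \<Rightarrow> 'r::comm_ring_1"
  assumes "finite W"
  shows "mfps_nth (\<Prod>w\<in>W. Abs_mfps (\<lambda>N. \<Sum>I | mset I = N. d w I)) M =
    (\<Sum>\<alpha> | \<alpha> \<in> W \<rightarrow>\<^sub>E UNIV \<and> (\<Sum>w\<in>W. mset (\<alpha> w)) = M. \<Prod>w\<in>W. d w (\<alpha> w))"
  using assms
proof (induction W arbitrary: M)
  case empty
  have "{\<alpha>. \<alpha> \<in> {} \<rightarrow>\<^sub>E UNIV \<and> (\<Sum>w\<in>{}. mset (\<alpha> w)) = M} = (if M = {#} then {\<lambda>_. undefined} else {})"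
    by (auto simp: PiE_def)
  then show ?case by (simp add: mfps_nth_one)
next
  case (insert w W)
  let ?A = "\<lambda>M. {\<alpha>. \<alpha> \<in> W \<rightarrow>\<^sub>E UNIV \<and> (\<Sum>w\<in>W. mset (\<alpha> w)) = M}"
  define j where "j = (\<lambda>(N :: 'c multiset, I :: 'c list, \<alpha>). \<alpha>(w := I))"
  \<comment> \<open>Resetting the value at \<open>w\<close> to \<open>undefined\<close> keeps the
    remaining function extensional on \<open>W\<close>, as needed for a bijection.\<close>
  define i where "i = (\<lambda>\<alpha>. (mset (\<alpha> w), \<alpha> w, \<alpha>(w := undefined :: 'c list)))"
  have fin: "finite (?A M)" for M using finite_label_functions[OF insert.hyps(1), of M] by simp
  have "mfps_nth (\<Prod>w\<in>insert w W. Abs_mfps (\<lambda>N. \<Sum>I | mset I = N. d w I)) M =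
    (\<Sum>N | N \<subseteq># M. (\<Sum>I | mset I = N. d w I) * (\<Sum>\<alpha>\<in>?A (M - N). \<Prod>w\<in>W. d w (\<alpha> w)))"
    using insert by (simp add: mfps_nth_times)
  also have "\<dots> = (\<Sum>N | N \<subseteq># M. \<Sum>(I, \<alpha>)\<in>{I. mset I = N} \<times> ?A (M - N). d w I * (\<Prod>w\<in>W. d w (\<alpha> w)))"
    by (simp add: sum_product sum.cartesian_product)
  also have "\<dots> = (\<Sum>(N, I, \<alpha>)\<in>(SIGMA N:{N. N \<subseteq># M}. {I. mset I = N} \<times> ?A (M - N)).
      d w I * (\<Prod>w\<in>W. d w (\<alpha> w)))"
    by (rule sum.Sigma) (auto simp: finite_submultisets finite_lists_mset fin intro!: finite_cartesian_product)
  also have "\<dots> = (\<Sum>\<alpha> | \<alpha> \<in> insert w W \<rightarrow>\<^sub>E UNIV \<and> (\<Sum>w\<in>insert w W. mset (\<alpha> w)) = M. \<Prod>w\<in>insert w W. d w (\<alpha> w))"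
  proof (rule sum.reindex_bij_witness[where j = j and i = i])
    fix z assume "z \<in> (SIGMA N:{N. N \<subseteq># M}. {I. mset I = N} \<times> ?A (M - N))"
    then obtain N I \<alpha> where z: "z = (N, I, \<alpha>)" "N \<subseteq># M" "mset I = N" "\<alpha> \<in> W \<rightarrow>\<^sub>E UNIV"
      "(\<Sum>w\<in>W. mset (\<alpha> w)) = M - N" by auto
    have s: "(\<Sum>v\<in>W. mset ((\<alpha>(w := I)) v)) = M - N"
      using z(5) insert.hyps by (metis (mono_tags, lifting) fun_upd_other sum.cong)
    have p: "(\<Prod>v\<in>W. d v ((\<alpha>(w := I)) v)) = (\<Prod>v\<in>W. d v (\<alpha> v))"
      using insert.hyps by (intro prod.cong) auto
    have "\<alpha> w = undefined" using z(4) insert.hyps by (auto simp: PiE_def extensional_def)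
    then show "i (j z) = z"
      unfolding z(1) i_def j_def using z(3) by auto
    show "j z \<in> {\<alpha>. \<alpha> \<in> insert w W \<rightarrow>\<^sub>E UNIV \<and> (\<Sum>w\<in>insert w W. mset (\<alpha> w)) = M}"
      using z insert.hyps s unfolding j_def by (auto simp: PiE_def extensional_def)
    show "(\<Prod>v\<in>insert w W. d v (j z v)) =
       (case z of (N, I, \<alpha>) \<Rightarrow> d w I * (\<Prod>w\<in>W. d w (\<alpha> w)))"
      using insert.hyps p by (simp add: z(1) j_def)
  next
    fix \<alpha> assume "\<alpha> \<in> {\<alpha>. \<alpha> \<in> insert w W \<rightarrow>\<^sub>E UNIV \<and> (\<Sum>w\<in>insert w W. mset (\<alpha> w)) = M}"
    then have a: "\<alpha> \<in> insert w W \<rightarrow>\<^sub>E UNIV" "mset (\<alpha> w) + (\<Sum>w\<in>W. mset (\<alpha> w)) = M"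
      using insert.hyps by auto
    have s: "(\<Sum>v\<in>W. mset ((\<alpha>(w := undefined)) v)) = (\<Sum>w\<in>W. mset (\<alpha> w))"
      using insert.hyps by (intro sum.cong) auto
    show "j (i \<alpha>) = \<alpha>" by (simp add: i_def j_def)
    show "i \<alpha> \<in> (SIGMA N:{N. N \<subseteq># M}. {I. mset I = N} \<times> ?A (M - N))"
      using a s insert.hyps unfolding i_def by (auto simp: PiE_def extensional_def)
  qed
  finally show ?case .
qed

section \<open>Relabelling of graphs and sums over isomorphism classes\<close>

definition relabel :: "(int \<Rightarrow> int) \<Rightarrow> (int \<Rightarrow> int) \<Rightarrow> wgraph \<Rightarrow> wgraph" where
  "relabel \<pi> \<rho> g = \<lparr>num_black = num_black g, num_white = num_white g,
     edges = image_mset (map_prod \<pi> \<rho>) (edges g), weight = (\<lambda>w. weight g (inv \<rho> w))\<rparr>"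

definition relabellings :: "wgraph \<Rightarrow> ((int \<Rightarrow> int) \<times> (int \<Rightarrow> int)) set" where
  "relabellings g = {\<pi>. \<pi> permutes blacks g} \<times> {\<rho>. \<rho> permutes whites g}"

lemma finite_blacks [simp]: "finite (blacks g)" and finite_whites [simp]: "finite (whites g)"
  and card_blacks [simp]: "card (blacks g) = num_black g"
  and card_whites [simp]: "card (whites g) = num_white g"
  by (simp_all add: blacks_def whites_def)

lemma whites_disjoint_blacks: "w \<in> whites g \<Longrightarrow> w \<notin> blacks h"
  by (auto simp: blacks_def whites_def)

lemma relabel_simps [simp]:
  "num_black (relabel \<pi> \<rho> g) = num_black g" "num_white (relabel \<pi> \<rho> g) = num_white g"
  "edges (relabel \<pi> \<rho> g) = image_mset (map_prod \<pi> \<rho>) (edges g)"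
  "weight (relabel \<pi> \<rho> g) w = weight g (inv \<rho> w)"
  "blacks (relabel \<pi> \<rho> g) = blacks g" "whites (relabel \<pi> \<rho> g) = whites g"
  "verts (relabel \<pi> \<rho> g) = verts g"
  by (simp_all add: relabel_def blacks_def whites_def verts_def)

text \<open>Isomorphisms are rewritten as a group action, for which orbits and stabilizers can be
  counted.\<close>

lemma isos_iff:
  assumes "is_wgraph g" "is_wgraph h"
  shows "(\<pi>, \<rho>) \<in> isos g h \<longleftrightarrow> (\<pi>, \<rho>) \<in> relabellings g \<and> h = relabel \<pi> \<rho> g"
proof
  assume i: "(\<pi>, \<rho>) \<in> isos g h"
  then have p: "\<pi> permutes blacks g" "\<rho> permutes whites g" and
    n: "num_black h = num_black g" "num_white h = num_white g" and
    e: "edges h = image_mset (map_prod \<pi> \<rho>) (edges g)" and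
    w: "\<And>w. w \<in> whites g \<Longrightarrow> weight h (\<rho> w) = weight g w"
    by (auto simp: isos_def)
  have wh: "whites h = whites g" using n by (simp add: whites_def)
  have "weight h w = weight g (inv \<rho> w)" for w
  proof (cases "w \<in> whites g")
    case True
    then have "inv \<rho> w \<in> whites g" using permutes_in_image[OF permutes_inv[OF p(2)]] by simp
    from w[OF this] show ?thesis by (simp add: permutes_inverses[OF p(2)])
  next
    \<comment> \<open>Off the white vertices both weights are normalised to 0, and the permutation
      is the identity there.\<close>
    case False
    then have "inv \<rho> w = w" using permutes_inv[OF p(2)] by (auto simp: permutes_def)
    then show ?thesis using False assms wh by (simp add: is_wgraph_def)
  qed
  then have "h = relabel \<pi> \<rho> g"
    by (intro wgraph.equality) (simp_all add: n e fun_eq_iff)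
  then show "(\<pi>, \<rho>) \<in> relabellings g \<and> h = relabel \<pi> \<rho> g" using p by (simp add: relabellings_def)
next
  assume "(\<pi>, \<rho>) \<in> relabellings g \<and> h = relabel \<pi> \<rho> g"
  then show "(\<pi>, \<rho>) \<in> isos g h"
    by (auto simp: isos_def relabellings_def permutes_inverses)
qed

lemma relabel_comp:
  assumes "(\<pi>, \<rho>) \<in> relabellings g" "(\<pi>', \<rho>') \<in> relabellings g"
  shows "relabel \<pi>' \<rho>' (relabel \<pi> \<rho> g) = relabel (\<pi>' \<circ> \<pi>) (\<rho>' \<circ> \<rho>) g"
proof -
  have "bij \<rho>" "bij \<rho>'" using assms by (auto simp: relabellings_def permutes_bij)
  then have "inv (\<rho>' \<circ> \<rho>) = inv \<rho> \<circ> inv \<rho>'" by (simp add: o_inv_distrib)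
  then show ?thesis
    by (simp add: relabel_def multiset.map_comp map_prod_compose)
qed

lemma relabel_id: "relabel id id g = g"
  by (simp add: relabel_def prod.map_id0)

lemma relabellings_relabel [simp]: "relabellings (relabel \<pi> \<rho> g) = relabellings g"
  by (simp add: relabellings_def)

lemma relabellings_comp:
  "(\<pi>, \<rho>) \<in> relabellings g \<Longrightarrow> (\<pi>', \<rho>') \<in> relabellings g \<Longrightarrow> (\<pi>' \<circ> \<pi>, \<rho>' \<circ> \<rho>) \<in> relabellings g"
  by (simp add: relabellings_def permutes_compose)

lemma relabellings_inv: "(\<pi>, \<rho>) \<in> relabellings g \<Longrightarrow> (inv \<pi>, inv \<rho>) \<in> relabellings g"
  by (simp add: relabellings_def permutes_inv)

lemma relabel_inv:
  assumes "(\<pi>, \<rho>) \<in> relabellings g"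
  shows "relabel (inv \<pi>) (inv \<rho>) (relabel \<pi> \<rho> g) = g"
proof -
  have "inv \<pi> \<circ> \<pi> = id" "inv \<rho> \<circ> \<rho> = id"
    using assms by (auto simp: relabellings_def permutes_inv_o)
  then show ?thesis
    using relabel_comp[OF assms relabellings_inv[OF assms]] relabel_id by simp
qed

lemma is_wgraph_relabel:
  assumes "is_wgraph g" "(\<pi>, \<rho>) \<in> relabellings g"
  shows "is_wgraph (relabel \<pi> \<rho> g)"
proof -
  have p: "\<pi> permutes blacks g" "\<rho> permutes whites g" using assms(2) by (auto simp: relabellings_def)
  have "map_prod \<pi> \<rho> e \<in> blacks g \<times> whites g" if "e \<in># edges g" for e
    using that assms(1) permutes_in_image[OF p(1)] permutes_in_image[OF p(2)]
    by (cases e) (auto simp: is_wgraph_def)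
  moreover have "inv \<rho> w = w" if "w \<notin> whites g" for w
    using that permutes_inv[OF p(2)] by (auto simp: permutes_def)
  ultimately show ?thesis using assms(1) by (auto simp: is_wgraph_def)
qed

text \<open>Black vertices are positive and white ones negative, so an edge can be attached to a
  black vertex through its first component alone.\<close>

lemma valency_black:
  assumes "is_wgraph g" "v \<in> blacks g"
  shows "valency g v = size {#e \<in># edges g. fst e = v#}"
proof -
  have "attached v e \<longleftrightarrow> fst e = v" if "e \<in># edges g" for e
    using that assms whites_disjoint_blacks[of "snd e" g g]
    by (cases e) (auto simp: is_wgraph_def attached_def)
  then show ?thesis unfolding valency_def by (intro arg_cong[where f = size] filter_mset_cong refl)
qed

lemma valency_relabel:
  assumes "is_wgraph g" "(\<pi>, \<rho>) \<in> relabellings g" "v \<in> blacks g"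
  shows "valency (relabel \<pi> \<rho> g) (\<pi> v) = valency g v"
proof -
  have p: "\<pi> permutes blacks g" using assms(2) by (auto simp: relabellings_def)
  have "\<pi> v \<in> blacks (relabel \<pi> \<rho> g)" using assms(3) permutes_in_image[OF p] by simp
  then have "valency (relabel \<pi> \<rho> g) (\<pi> v) =
      size {#e \<in># image_mset (map_prod \<pi> \<rho>) (edges g). fst e = \<pi> v#}"
    using valency_black[OF is_wgraph_relabel[OF assms(1,2)]] by simp
  also have "\<dots> = size {#e \<in># edges g. fst (map_prod \<pi> \<rho> e) = \<pi> v#}"
    by (simp add: filter_mset_image_mset)
  also have "\<dots> = valency g v"
    using inj_eq[OF permutes_inj[OF p]] by (simp add: valency_black[OF assms(1,3)])
  finally show ?thesis .
qed

lemma Gamma_circ_iff: "g \<in> Gamma_circ \<longleftrightarrow> is_wgraph g \<and> verts g \<noteq> {} \<and> connected_wgraph g \<and>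
    (\<forall>v\<in>blacks g. valency g v \<noteq> 1)"
  unfolding Gamma_circ_def verts_def using whites_disjoint_blacks by auto

lemma relabel_Gamma_circ:
  assumes "g \<in> Gamma_circ" "(\<pi>, \<rho>) \<in> relabellings g"
  shows "relabel \<pi> \<rho> g \<in> Gamma_circ"
proof -
  have g: "is_wgraph g" "verts g \<noteq> {}" "connected_wgraph g" "\<And>v. v \<in> blacks g \<Longrightarrow> valency g v \<noteq> 1"
    using assms(1) by (auto simp: Gamma_circ_iff)
  have p: "\<pi> permutes blacks g" "\<rho> permutes whites g" using assms(2) by (auto simp: relabellings_def)
  \<comment> \<open>Each permutation fixes the vertices of the other colour, so the composition acts
    on all vertices at once and maps paths to paths.\<close>
  define \<tau> where "\<tau> v = \<pi> (\<rho> v)" for v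
  have \<tau>b: "\<tau> v = \<pi> v" if "v \<in> blacks g" for v
  proof -
    have "\<rho> v = v" using that p(2) whites_disjoint_blacks by (auto simp: permutes_def)
    then show ?thesis by (simp add: \<tau>_def)
  qed
  have \<tau>w: "\<tau> v = \<rho> v" if "v \<in> whites g" for v
  proof -
    have "\<rho> v \<notin> blacks g" using that permutes_in_image[OF p(2)] whites_disjoint_blacks by blast
    then show ?thesis using p(1) by (auto simp: \<tau>_def permutes_def)
  qed
  let ?R = "\<lambda>g. set_mset (edges g) \<union> (set_mset (edges g))\<inverse>"
  have step: "(\<tau> u, \<tau> v) \<in> ?R (relabel \<pi> \<rho> g)" if "(u, v) \<in> ?R g" for u v
    using that g(1) \<tau>b \<tau>w by (force simp: is_wgraph_def image_iff)
  have path: "(\<tau> u, \<tau> v) \<in> (?R (relabel \<pi> \<rho> g))\<^sup>*" if "(u, v) \<in> (?R g)\<^sup>*" for u v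
    using that
  proof (induction rule: rtrancl_induct)
    case (step y z)
    then show ?case using \<open>\<And>u v. (u, v) \<in> ?R g \<Longrightarrow> _\<close> by (meson rtrancl.rtrancl_into_rtrancl)
  qed simp
  have surj: "\<exists>u\<in>verts g. v = \<tau> u" if "v \<in> verts g" for v
  proof (cases "v \<in> blacks g")
    case True
    then have "inv \<pi> v \<in> blacks g" using permutes_in_image[OF permutes_inv[OF p(1)]] by simp
    then show ?thesis using \<tau>b permutes_inverses(1)[OF p(1)] by (metis UnI1 verts_def)
  next
    case False
    then have "inv \<rho> v \<in> whites g"
      using that permutes_in_image[OF permutes_inv[OF p(2)]] by (simp add: verts_def)
    then show ?thesis using \<tau>w permutes_inverses(1)[OF p(2)] by (metis UnI2 verts_def)
  qed
  have "connected_wgraph (relabel \<pi> \<rho> g)"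
    unfolding connected_wgraph_def
  proof (intro ballI)
    fix u v assume "u \<in> verts (relabel \<pi> \<rho> g)" "v \<in> verts (relabel \<pi> \<rho> g)"
    then obtain u' v' where "u' \<in> verts g" "u = \<tau> u'" "v' \<in> verts g" "v = \<tau> v'"
      using surj by (metis relabel_simps(7))
    then show "(u, v) \<in> (?R (relabel \<pi> \<rho> g))\<^sup>*"
      using path g(3) by (simp add: connected_wgraph_def)
  qed
  moreover have "valency (relabel \<pi> \<rho> g) v \<noteq> 1" if "v \<in> blacks g" for v
  proof -
    have "inv \<pi> v \<in> blacks g" using that permutes_in_image[OF permutes_inv[OF p(1)]] by simp
    then show ?thesis
      using valency_relabel[OF g(1) assms(2), of "inv \<pi> v"] g(4) permutes_inverses(1)[OF p(1)] by metis
  qed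
  ultimately show ?thesis
    using is_wgraph_relabel[OF g(1) assms(2)] g(2) by (auto simp: Gamma_circ_iff)
qed

section \<open>Isomorphism classes as orbits\<close>

definition iso_class :: "wgraph \<Rightarrow> wgraph set" where
  "iso_class g = (\<lambda>(\<pi>, \<rho>). relabel \<pi> \<rho> g) ` relabellings g"

lemma finite_relabellings: "finite (relabellings g)"
  by (simp add: relabellings_def finite_permutations)

lemma card_relabellings: "card (relabellings g) = fact (num_black g) * fact (num_white g)"
  by (simp add: relabellings_def card_cartesian_product card_permutations)

lemma iso_class_refl: "g \<in> iso_class g"
proof -
  have "(id, id) \<in> relabellings g" by (simp add: relabellings_def permutes_id)
  then show ?thesis unfolding iso_class_def
    by (intro image_eqI[of _ _ "(id, id)"]) (simp_all add: relabel_id)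
qed

lemma iso_class_eq: "h \<in> iso_class g \<Longrightarrow> iso_class h = iso_class g"
proof -
  have sub: "iso_class h \<subseteq> iso_class g" if "h \<in> iso_class g" for g h
  proof
    fix k assume "k \<in> iso_class h"
    then obtain \<pi> \<rho> \<pi>' \<rho>' where "(\<pi>, \<rho>) \<in> relabellings g" "h = relabel \<pi> \<rho> g"
      "(\<pi>', \<rho>') \<in> relabellings h" "k = relabel \<pi>' \<rho>' h"
      using \<open>h \<in> iso_class g\<close> by (auto simp: iso_class_def)
    then show "k \<in> iso_class g"
      using relabel_comp[of \<pi> \<rho> g \<pi>' \<rho>'] relabellings_comp[of \<pi> \<rho> g \<pi>' \<rho>']
      unfolding iso_class_def by (intro image_eqI[of _ _ "(\<pi>' \<circ> \<pi>, \<rho>' \<circ> \<rho>)"]) simp_all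
  qed
  assume h: "h \<in> iso_class g"
  then obtain \<pi> \<rho> where "(\<pi>, \<rho>) \<in> relabellings g" "h = relabel \<pi> \<rho> g" by (auto simp: iso_class_def)
  then have "g \<in> iso_class h"
    unfolding iso_class_def using relabel_inv[of \<pi> \<rho> g] relabellings_inv[of \<pi> \<rho> g]
    by (intro image_eqI[of _ _ "(inv \<pi>, inv \<rho>)"]) simp_all
  then show ?thesis using sub h by blast
qed

lemma iso_class_Gamma_circ: "g \<in> Gamma_circ \<Longrightarrow> h \<in> iso_class g \<Longrightarrow> h \<in> Gamma_circ"
  by (auto simp: iso_class_def relabel_Gamma_circ)

lemma isos_nonempty_iff:
  "is_wgraph g \<Longrightarrow> is_wgraph h \<Longrightarrow> isos g h \<noteq> {} \<longleftrightarrow> h \<in> iso_class g"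
proof
  assume wf: "is_wgraph g" "is_wgraph h"
  show "h \<in> iso_class g" if ne: "isos g h \<noteq> {}"
  proof -
    obtain \<pi> \<rho> where "(\<pi>, \<rho>) \<in> isos g h" using ne by auto
    then have "(\<pi>, \<rho>) \<in> relabellings g" "h = relabel \<pi> \<rho> g" using isos_iff[OF wf] by auto
    then show ?thesis unfolding iso_class_def by (intro image_eqI[of _ _ "(\<pi>, \<rho>)"]) simp_all
  qed
  assume "h \<in> iso_class g"
  then obtain \<pi> \<rho> where "(\<pi>, \<rho>) \<in> relabellings g" "h = relabel \<pi> \<rho> g" by (auto simp: iso_class_def)
  then have "(\<pi>, \<rho>) \<in> isos g h" using isos_iff[OF wf] by auto
  then show "isos g h \<noteq> {}" by blast
qed

lemma Gamma_circ_classes_eq: "Gamma_circ_classes = iso_class ` Gamma_circ"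
proof -
  let ?R = "{(g, h). g \<in> Gamma_circ \<and> h \<in> Gamma_circ \<and> isos g h \<noteq> {}}"
  have "?R `` {g} = iso_class g" if "g \<in> Gamma_circ" for g
  proof -
    have "h \<in> ?R `` {g} \<longleftrightarrow> h \<in> iso_class g" for h
      using isos_nonempty_iff[of g h] iso_class_Gamma_circ[OF that, of h] that
      unfolding Gamma_circ_iff by blast
    then show ?thesis by blast
  qed
  then show ?thesis unfolding Gamma_circ_classes_def quotient_def by blast
qed

text \<open>Composition with one fixed isomorphism from \<open>g\<close> to \<open>h\<close> makes
  the isomorphisms a coset of the automorphism group.\<close>

lemma card_isos:
  assumes "is_wgraph g" "h \<in> iso_class g"
  shows "card (isos g h) = card (sym_group g)"
proof -
  obtain \<pi> \<rho> where p: "(\<pi>, \<rho>) \<in> relabellings g" and h: "h = relabel \<pi> \<rho> g"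
    using assms(2) by (auto simp: iso_class_def)
  have wh: "is_wgraph h" using is_wgraph_relabel[OF assms(1) p] h by simp
  have b: "bij \<pi>" "bij \<rho>" using p by (auto simp: relabellings_def permutes_bij)
  have c: "inv \<pi> \<circ> \<pi> = id" "\<pi> \<circ> inv \<pi> = id" "inv \<rho> \<circ> \<rho> = id" "\<rho> \<circ> inv \<rho> = id"
    using p by (auto simp: relabellings_def permutes_inv_o)
  have "bij_betw (\<lambda>(\<alpha>, \<beta>). (\<pi> \<circ> \<alpha>, \<rho> \<circ> \<beta>)) (sym_group g) (isos g h)"
  proof (rule bij_betw_byWitness[where f' = "\<lambda>(\<alpha>, \<beta>). (inv \<pi> \<circ> \<alpha>, inv \<rho> \<circ> \<beta>)"])
    have o: "inv \<pi> \<circ> (\<pi> \<circ> \<alpha>) = \<alpha>" "\<pi> \<circ> (inv \<pi> \<circ> \<alpha>) = \<alpha>" "inv \<rho> \<circ> (\<rho> \<circ> \<alpha>) = \<alpha>" "\<rho> \<circ> (inv \<rho> \<circ> \<alpha>) = \<alpha>" for \<alpha>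
      by (simp_all only: o_assoc c id_o)
    show "\<forall>a\<in>sym_group g. (\<lambda>(\<alpha>, \<beta>). (inv \<pi> \<circ> \<alpha>, inv \<rho> \<circ> \<beta>)) ((\<lambda>(\<alpha>, \<beta>). (\<pi> \<circ> \<alpha>, \<rho> \<circ> \<beta>)) a) = a"
      by (auto simp: o)
    show "\<forall>a\<in>isos g h. (\<lambda>(\<alpha>, \<beta>). (\<pi> \<circ> \<alpha>, \<rho> \<circ> \<beta>)) ((\<lambda>(\<alpha>, \<beta>). (inv \<pi> \<circ> \<alpha>, inv \<rho> \<circ> \<beta>)) a) = a"
      by (auto simp: o)
    show "(\<lambda>(\<alpha>, \<beta>). (\<pi> \<circ> \<alpha>, \<rho> \<circ> \<beta>)) ` sym_group g \<subseteq> isos g h"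
    proof clarify
      fix \<alpha> \<beta> assume "(\<alpha>, \<beta>) \<in> sym_group g"
      then have a: "(\<alpha>, \<beta>) \<in> relabellings g" "relabel \<alpha> \<beta> g = g"
        using isos_iff[OF assms(1) assms(1)] by auto
      then show "(\<pi> \<circ> \<alpha>, \<rho> \<circ> \<beta>) \<in> isos g h"
        unfolding isos_iff[OF assms(1) wh]
        using relabellings_comp[OF a(1) p] relabel_comp[OF a(1) p] h by simp
    qed
    show "(\<lambda>(\<alpha>, \<beta>). (inv \<pi> \<circ> \<alpha>, inv \<rho> \<circ> \<beta>)) ` isos g h \<subseteq> sym_group g"
    proof clarify
      fix \<alpha> \<beta> assume "(\<alpha>, \<beta>) \<in> isos g h"
      then have a: "(\<alpha>, \<beta>) \<in> relabellings g" "relabel \<alpha> \<beta> g = h"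
        using isos_iff[OF assms(1) wh] by auto
      then show "(inv \<pi> \<circ> \<alpha>, inv \<rho> \<circ> \<beta>) \<in> sym_group g"
        unfolding isos_iff[OF assms(1) assms(1)]
        using relabellings_comp[OF a(1) relabellings_inv[OF p]] relabel_comp[OF a(1) relabellings_inv[OF p]]
          relabel_inv[OF p] h by simp
    qed
  qed
  then show ?thesis by (simp add: bij_betw_same_card)
qed

text \<open>All relabellings of \<open>g\<close> are sorted by their result; each fibre is a set of
  isomorphisms and has the size of the automorphism group.\<close>

lemma orbit_stabilizer:
  assumes "is_wgraph g"
  shows "card (iso_class g) * card (sym_group g) = fact (num_black g) * fact (num_white g)"
proof -
  have "card (relabellings g) = (\<Sum>h\<in>iso_class g. \<Sum>p | p \<in> relabellings g \<and> (case p of (\<pi>, \<rho>) \<Rightarrow> relabel \<pi> \<rho> g) = h. 1)"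
    unfolding iso_class_def card_eq_sum by (rule sum.image_gen) (rule finite_relabellings)
  also have "\<dots> = (\<Sum>h\<in>iso_class g. card (sym_group g))"
  proof (rule sum.cong[OF refl])
    fix h assume h: "h \<in> iso_class g"
    then have wh: "is_wgraph h" using is_wgraph_relabel[OF assms] by (auto simp: iso_class_def)
    have "{p. p \<in> relabellings g \<and> (case p of (\<pi>, \<rho>) \<Rightarrow> relabel \<pi> \<rho> g) = h} = isos g h"
      using isos_iff[OF assms wh] by auto
    then show "(\<Sum>p | p \<in> relabellings g \<and> (case p of (\<pi>, \<rho>) \<Rightarrow> relabel \<pi> \<rho> g) = h. 1) = card (sym_group g)"
      using card_isos[OF assms h] by simp
  qed
  finally show ?thesis by (simp add: card_relabellings)
qed

text \<open>By \<open>orbit_stabilizer\<close>, \<open>1 / |sym|\<close> is the number of members of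
  a class divided by the factorials of the vertex numbers, so the weight of a class can be spread
  evenly over its members. Invariance of \<open>y\<close> makes the chosen representative
  irrelevant, and \<open>\<G>\<close> confines the sum to finitely many graphs.\<close>

lemma sum_iso_classes:
  fixes y :: "wgraph \<Rightarrow> 'r::field_char_0"
  assumes fin: "finite \<G>" and sub: "\<G> \<subseteq> Gamma_circ"
    and closed: "\<And>g h. g \<in> \<G> \<Longrightarrow> h \<in> iso_class g \<Longrightarrow> h \<in> \<G>"
    and inv: "\<And>g h. g \<in> \<G> \<Longrightarrow> h \<in> iso_class g \<Longrightarrow> y h = y g"
    and zero: "\<And>g. g \<in> Gamma_circ \<Longrightarrow> g \<notin> \<G> \<Longrightarrow> y g = 0"
    and t: "\<And>C. t C = 1 / of_nat (card (sym_group (SOME g. g \<in> C))) * y (SOME g. g \<in> C)"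
  shows "(\<Sum>C | C \<in> Gamma_circ_classes \<and> t C \<noteq> 0. t C) =
    (\<Sum>g\<in>\<G>. y g / (fact (num_black g) * fact (num_white g)))"
proof -
  have some: "(SOME h. h \<in> iso_class g) \<in> iso_class g" for g
    using iso_class_refl by (rule someI)
  have "(\<Sum>C | C \<in> Gamma_circ_classes \<and> t C \<noteq> 0. t C) = (\<Sum>C\<in>iso_class ` \<G>. t C)"
  proof (rule sum.mono_neutral_left)
    show "{C. C \<in> Gamma_circ_classes \<and> t C \<noteq> 0} \<subseteq> iso_class ` \<G>"
    proof
      fix C assume "C \<in> {C. C \<in> Gamma_circ_classes \<and> t C \<noteq> 0}"
      then obtain g where g: "g \<in> Gamma_circ" "C = iso_class g" and nz: "t C \<noteq> 0"
        by (auto simp: Gamma_circ_classes_eq)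
      let ?h = "SOME h. h \<in> C"
      have h: "?h \<in> iso_class g" using some g by simp
      then have "?h \<in> Gamma_circ" using iso_class_Gamma_circ g by blast
      moreover have "y ?h \<noteq> 0" using nz by (auto simp: t)
      ultimately have "?h \<in> \<G>" using zero by blast
      then show "C \<in> iso_class ` \<G>" using iso_class_eq[OF h] g by blast
    qed
    show "\<forall>C\<in>iso_class ` \<G> - {C. C \<in> Gamma_circ_classes \<and> t C \<noteq> 0}. t C = 0"
      using sub by (auto simp: Gamma_circ_classes_eq)
  qed (use fin in simp)
  also have "\<dots> = (\<Sum>C\<in>iso_class ` \<G>. \<Sum>g | g \<in> \<G> \<and> iso_class g = C. y g / (fact (num_black g) * fact (num_white g)))"
  proof (rule sum.cong[OF refl])
    fix C assume "C \<in> iso_class ` \<G>"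
    then obtain g where g: "g \<in> \<G>" "C = iso_class g" by auto
    define k where "k = (SOME h. h \<in> C)"
    have k: "k \<in> iso_class g" using some g by (simp add: k_def)
    have kG: "k \<in> \<G>" using closed g k by blast
    have Ck: "C = iso_class k" using iso_class_eq[OF k] g by simp
    have wk: "is_wgraph k" using kG sub by (auto simp: Gamma_circ_iff)
    have set: "{g. g \<in> \<G> \<and> iso_class g = C} = C"
      using iso_class_eq iso_class_refl closed kG Ck by blast
    have eq: "y h / (fact (num_black h) * fact (num_white h)) = y k / (fact (num_black k) * fact (num_white k))"
      if "h \<in> C" for h
    proof -
      have "num_black h = num_black k" "num_white h = num_white k"
        using that Ck by (auto simp: iso_class_def)
      moreover have "y h = y k" using inv[OF kG] that Ck by simp
      ultimately show ?thesis by simp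
    qed
    have os: "of_nat (card C) * of_nat (card (sym_group k)) = (fact (num_black k) * fact (num_white k) :: 'r)"
      using orbit_stabilizer[OF wk] unfolding Ck by (metis of_nat_fact of_nat_mult)
    have nz: "(of_nat (card C) :: 'r) \<noteq> 0" "(of_nat (card (sym_group k)) :: 'r) \<noteq> 0"
      using os by (metis fact_nonzero mult_eq_0_iff)+
    have "(\<Sum>g | g \<in> \<G> \<and> iso_class g = C. y g / (fact (num_black g) * fact (num_white g))) =
      of_nat (card C) * (y k / (fact (num_black k) * fact (num_white k)))"
      unfolding set by (simp add: eq)
    also have "\<dots> = t C"
      unfolding os[symmetric] using nz by (simp add: t k_def[symmetric] field_simps)
    finally show "t C = (\<Sum>g | g \<in> \<G> \<and> iso_class g = C. y g / (fact (num_black g) * fact (num_white g)))" ..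
  qed
  also have "\<dots> = (\<Sum>g\<in>\<G>. y g / (fact (num_black g) * fact (num_white g)))"
    by (rule sum.image_gen[OF fin, symmetric])
  finally show ?thesis .
qed

section \<open>Brackets in terms of enumerations of the edges\<close>

text \<open>
  \<open>n! / edge_mult g\<close> is the number of enumerations of the \<open>n\<close> edges, while the product of the denominators
  of the bracket over all black vertices is \<open>edge_mult g\<close>.
\<close>

definition edge_mult :: "wgraph \<Rightarrow> nat" where
  "edge_mult g = (\<Prod>e\<in>blacks g \<times> whites g. fact (count (edges g) e))"

text \<open>\<open>\<phi> i\<close> and \<open>\<psi> i\<close> are the black and the white end of
  the \<open>i\<close>-th edge.\<close>

definition enumerates :: "(nat \<Rightarrow> int) \<Rightarrow> (nat \<Rightarrow> int) \<Rightarrow> wgraph \<Rightarrow> bool" where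
  "enumerates \<phi> \<psi> g \<longleftrightarrow> edges g = image_mset (\<lambda>i. (\<phi> i, \<psi> i)) (mset_set {..<size (edges g)})"

definition white_derivative :: "('b::finite \<Rightarrow> complex fps) \<Rightarrow> (real^'b \<Rightarrow> 'c::finite list \<Rightarrow> complex fps) \<Rightarrow>
    'c list \<Rightarrow> 'b multiset \<Rightarrow> complex fps" where
  "white_derivative c G I N = taylor_at c (foldr partial_fps (list_of_mset N) (\<lambda>y. G y I))"

text \<open>The bracket without its combinatorial factors. The edges at a vertex are a fibre of
  \<open>\<phi>\<close> or \<open>\<psi>\<close>, so the list of its indices becomes the multiset of
  colours on that fibre.\<close>

definition bracket_sum :: "(real^'a::finite \<Rightarrow> 'b::finite list \<Rightarrow> complex fps) \<Rightarrow>
    (real^'b \<Rightarrow> 'c::finite list \<Rightarrow> complex fps) \<Rightarrow> real^'a \<Rightarrow> int set \<Rightarrow> int set \<Rightarrow> nat \<Rightarrow>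
    (nat \<Rightarrow> int) \<Rightarrow> (nat \<Rightarrow> int) \<Rightarrow> (int \<Rightarrow> 'c list) \<Rightarrow> complex fps" where
  "bracket_sum F G x V W n \<phi> \<psi> \<alpha> = (\<Sum>\<sigma>\<in>{..<n} \<rightarrow>\<^sub>E UNIV.
     (\<Prod>v\<in>V. F x (list_of_mset (restr \<sigma> (fibre {..<n} \<phi> v)))) *
     (\<Prod>w\<in>W. white_derivative (formal_map F x) G (\<alpha> w) (restr \<sigma> (fibre {..<n} \<psi> w))))"

lemma enumerates_exists: "\<exists>\<phi> \<psi>. enumerates \<phi> \<psi> g"
proof (intro exI)
  let ?e = "list_of_mset (edges g)"
  have l: "length ?e = size (edges g)" by (metis mset_list_of_mset size_mset)
  have "edges g = mset (map (\<lambda>i. ?e ! i) [0..<length ?e])" by (simp only: map_nth mset_list_of_mset)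
  then show "enumerates (\<lambda>i. fst (?e ! i)) (\<lambda>i. snd (?e ! i)) g"
    by (simp add: enumerates_def l lessThan_atLeast0)
qed

lemma enumerates_mem:
  assumes "is_wgraph g" "enumerates \<phi> \<psi> g" "i < size (edges g)"
  shows "\<phi> i \<in> blacks g" "\<psi> i \<in> whites g"
proof -
  have "(\<phi> i, \<psi> i) \<in># edges g"
    by (subst assms(2)[unfolded enumerates_def]) (use assms(3) in auto)
  then show "\<phi> i \<in> blacks g" "\<psi> i \<in> whites g" using assms(1) by (auto simp: is_wgraph_def)
qed

lemma valency_fibre:
  assumes "is_wgraph g" "enumerates \<phi> \<psi> g" "v \<in> blacks g"
  shows "valency g v = card (fibre {..<size (edges g)} \<phi> v)"
proof -
  have "valency g v = size {#e \<in># image_mset (\<lambda>i. (\<phi> i, \<psi> i)) (mset_set {..<size (edges g)}). fst e = v#}"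
    using valency_black[OF assms(1,3)] assms(2) unfolding enumerates_def by metis
  then show ?thesis by (simp add: filter_mset_image_mset fibre_def o_def)
qed

text \<open>White vertices are grouped by the number of edges they share with \<open>v\<close>; the
  group for \<open>i\<close> supplies a power of \<open>fact i\<close>.\<close>

lemma prod_num_neighbours:
  assumes "is_wgraph g" "v \<in> blacks g"
  shows "(\<Prod>i=1..valency g v. fact i ^ num_neighbours g v i) =
    (\<Prod>w\<in>whites g. fact (count (edges g) (v, w)) :: 'r::field_char_0)"
proof -
  have le: "count (edges g) (v, w) \<le> valency g v" for w
  proof -
    have "count (edges g) (v, w) = count {#e \<in># edges g. fst e = v#} (v, w)" by simp
    also have "\<dots> \<le> size {#e \<in># edges g. fst e = v#}" by (rule count_le_size)
    finally show ?thesis by (simp add: valency_black[OF assms])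
  qed
  have "(\<Prod>w\<in>whites g. fact (count (edges g) (v, w)) :: 'r) =
    (\<Prod>i\<in>{..valency g v}. \<Prod>w | w \<in> whites g \<and> count (edges g) (v, w) = i. fact (count (edges g) (v, w)))"
    by (rule prod.group[symmetric]) (use le in auto)
  also have "\<dots> = (\<Prod>i\<in>{..valency g v}. fact i ^ num_neighbours g v i)"
    by (rule prod.cong) (auto simp: num_neighbours_def)
  \<comment> \<open>The non-neighbours, \<open>i = 0\<close>, drop out because
    \<open>fact 0 = 1\<close>.\<close>
  also have "\<dots> = (\<Prod>i\<in>{1..valency g v}. fact i ^ num_neighbours g v i)"
    by (rule prod.mono_neutral_right) (auto simp: not_le)
  finally show ?thesis by simp
qed

lemma mset_indices_at:
  fixes \<sigma> :: "nat \<Rightarrow> 'b" and g :: wgraph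
  defines "e \<equiv> list_of_mset (edges g)"
  assumes "n = size (edges g)"
  shows "mset (indices_at g (map \<sigma> [0..<n]) v) = restr \<sigma> {i. i < n \<and> attached v (e ! i)}"
proof -
  have l: "length e = n" by (metis e_def assms(2) mset_list_of_mset size_mset)
  have z: "zip e (map \<sigma> [0..<n]) = map (\<lambda>i. (e ! i, \<sigma> i)) [0..<n]"
    by (rule nth_equalityI) (simp_all add: l)
  have "indices_at g (map \<sigma> [0..<n]) v = map \<sigma> (filter (\<lambda>i. attached v (e ! i)) [0..<n])"
    unfolding indices_at_def e_def[symmetric] z by (simp add: filter_map o_def)
  then show ?thesis by (simp add: conj_commute)
qed

lemma fps_const_prod_eq: "fps_const (prod f A) = (\<Prod>a\<in>A. fps_const (f a :: complex))"
  by (induction A rule: infinite_finite_induct) (simp_all flip: fps_const_mult)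

text \<open>The bracket uses the enumeration picked by \<open>list_of_mset\<close>. Any other
  enumeration differs from it by a permutation of positions, which the sum over all index
  assignments absorbs. The factor \<open>edge_mult g\<close> clears the denominators.\<close>

lemma graph_bracket_eq:
  fixes F :: "real^'a::finite \<Rightarrow> 'b::finite list \<Rightarrow> complex fps"
    and G :: "real^'b \<Rightarrow> 'c::finite list \<Rightarrow> complex fps"
  assumes U: "open U" "base_point (formal_map F x) \<in> U"
    and sm: "\<And>I. smooth_fps U (\<lambda>y. G y I)"
    and sym: "\<And>I J. mset I = mset J \<Longrightarrow> F x I = F x J"
    and g: "is_wgraph g" and en: "enumerates \<phi> \<psi> g"
  shows "fps_const (of_nat (edge_mult g)) * graph_bracket F G g \<alpha> x =
    fps_const (\<Prod>v\<in>blacks g. fact (card (fibre {..<size (edges g)} \<phi> v))) *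
    bracket_sum F G x (blacks g) (whites g) (size (edges g)) \<phi> \<psi> \<alpha>"
proof -
  define n where "n = size (edges g)"
  define e where "e = list_of_mset (edges g)"
  define A where "A v = {i. i < n \<and> attached v (e ! i)}" for v
  let ?D = "white_derivative (formal_map F x) G"
  define \<kappa> where "\<kappa> v = (fact (valency g v) / (\<Prod>i=1..valency g v. fact i ^ num_neighbours g v i) :: complex)" for v
  have l: "length e = n" by (metis e_def n_def mset_list_of_mset size_mset)
  have D: "taylor_at (formal_map F x) (foldr partial_fps J (\<lambda>y. G y I)) = ?D I (mset J)" for I J
    unfolding white_derivative_def
    by (rule taylor_at_cong[OF U], intro fps_ext, unfold fps_nth_foldr_partial, rule foldr_partial_perm[OF U(1)])
      (use sm in \<open>auto simp: smooth_fps_def\<close>)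
  have Fs: "F x J = F x (list_of_mset (mset J))" for J by (rule sym) simp
  have "mset e = mset (map (\<lambda>i. (\<phi> i, \<psi> i)) [0..<n])"
    using en by (simp add: e_def enumerates_def n_def lessThan_atLeast0)
  then obtain p where p: "p permutes {..<n}" "permute_list p (map (\<lambda>i. (\<phi> i, \<psi> i)) [0..<n]) = e"
    using mset_eq_permutation[of e "map (\<lambda>i. (\<phi> i, \<psi> i)) [0..<n]"] by auto
  have ep: "e ! i = (\<phi> (p i), \<psi> (p i))" if "i < n" for i
  proof -
    have "p i < n" using permutes_in_image[OF p(1), of i] that by simp
    then show ?thesis using that p(1) unfolding p(2)[symmetric] by (simp add: permute_list_nth)
  qed
  have mem: "\<phi> (p i) \<in> blacks g" "\<psi> (p i) \<in> whites g" if "i < n" for i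
  proof -
    have "p i < size (edges g)" using permutes_in_image[OF p(1), of i] that by (simp add: n_def)
    then show "\<phi> (p i) \<in> blacks g" "\<psi> (p i) \<in> whites g" using enumerates_mem[OF g en] by auto
  qed
  have inj: "inj_on p B" for B using permutes_inj[OF p(1)] by (rule inj_on_subset) simp
  have pA: "p ` {i. i < n \<and> R (p i)} = {i. i < n \<and> R i}" for R
  proof -
    have "p ` {i. i < n \<and> R (p i)} = {i \<in> p ` {..<n}. R i}" by auto
    then show ?thesis using permutes_image[OF p(1)] by auto
  qed
  have Ab: "p ` A v = fibre {..<n} \<phi> v" if v: "v \<in> blacks g" for v
  proof -
    have "A v = {i. i < n \<and> \<phi> (p i) = v}"
      using ep mem v whites_disjoint_blacks by (fastforce simp: A_def attached_def)
    then show ?thesis using pA[of "\<lambda>i. \<phi> i = v"] by (simp add: fibre_def)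
  qed
  have Aw: "p ` A w = fibre {..<n} \<psi> w" if w: "w \<in> whites g" for w
  proof -
    have "A w = {i. i < n \<and> \<psi> (p i) = w}"
      using ep mem w whites_disjoint_blacks by (fastforce simp: A_def attached_def)
    then show ?thesis using pA[of "\<lambda>i. \<psi> i = w"] by (simp add: fibre_def)
  qed
  define T where "T \<sigma> = (\<Prod>v\<in>blacks g. F x (list_of_mset (restr \<sigma> (A v)))) *
     (\<Prod>w\<in>whites g. ?D (\<alpha> w) (restr \<sigma> (A w)))" for \<sigma>
  have "graph_bracket F G g \<alpha> x = (\<Sum>\<sigma>\<in>{..<n} \<rightarrow>\<^sub>E UNIV. (\<Prod>v\<in>blacks g. fps_const (\<kappa> v)) * T \<sigma>)"
    unfolding graph_bracket_def n_def[symmetric] sum_lists_PiE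
  proof (rule sum.cong[OF refl])
    fix \<sigma> :: "nat \<Rightarrow> 'b"
    have i: "mset (indices_at g (map \<sigma> [0..<n]) v) = restr \<sigma> (A v)" for v
      using mset_indices_at[OF n_def, of \<sigma> v] by (simp add: A_def e_def)
    have "F x (indices_at g (map \<sigma> [0..<n]) v) = F x (list_of_mset (restr \<sigma> (A v)))" for v
      using Fs[of "indices_at g (map \<sigma> [0..<n]) v"] unfolding i .
    then show "(\<Prod>v\<in>blacks g.
        fps_const (fact (valency g v) / (\<Prod>i=1..valency g v. fact i ^ num_neighbours g v i)) *
        F x (indices_at g (map \<sigma> [0..<n]) v)) *
     (\<Prod>w\<in>whites g.
        taylor_at (formal_map F x) (foldr partial_fps (indices_at g (map \<sigma> [0..<n]) w) (\<lambda>y. G y (\<alpha> w)))) =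
       (\<Prod>v\<in>blacks g. fps_const (\<kappa> v)) * T \<sigma>"
      by (simp add: \<kappa>_def T_def D i prod.distrib mult.assoc)
  qed
  also have "\<dots> = fps_const (\<Prod>v\<in>blacks g. \<kappa> v) * (\<Sum>\<sigma>\<in>{..<n} \<rightarrow>\<^sub>E UNIV. T \<sigma>)"
    by (simp add: fps_const_prod_eq[symmetric] sum_distrib_left)
  also have "(\<Sum>\<sigma>\<in>{..<n} \<rightarrow>\<^sub>E UNIV. T \<sigma>) =
    bracket_sum F G x (blacks g) (whites g) n \<phi> \<psi> \<alpha>"
    unfolding bracket_sum_def
  proof (rule sum.reindex_bij_witness[where j = "\<lambda>\<sigma>. restrict (\<sigma> \<circ> inv p) {..<n}"
        and i = "\<lambda>\<sigma>. restrict (\<sigma> \<circ> p) {..<n}"])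
    have pn: "p i < n \<longleftrightarrow> i < n" "inv p i < n \<longleftrightarrow> i < n" for i
      using permutes_in_image[OF p(1), of i] permutes_in_image[OF permutes_inv[OF p(1)], of i] by auto
    fix \<sigma> :: "nat \<Rightarrow> 'b" assume s: "\<sigma> \<in> {..<n} \<rightarrow>\<^sub>E UNIV"
    show "restrict (restrict (\<sigma> \<circ> inv p) {..<n} \<circ> p) {..<n} = \<sigma>"
      "restrict (restrict (\<sigma> \<circ> p) {..<n} \<circ> inv p) {..<n} = \<sigma>"
      using s pn by (auto simp: fun_eq_iff restrict_def PiE_def extensional_def permutes_inverses[OF p(1)])
    have r: "restr (restrict (\<sigma> \<circ> inv p) {..<n}) (p ` A v) = restr \<sigma> (A v)" for v
    proof -
      have "restr (restrict (\<sigma> \<circ> inv p) {..<n}) (p ` A v) = restr (restrict (\<sigma> \<circ> inv p) {..<n} \<circ> p) (A v)"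
        by (rule restr_image[OF inj])
      also have "\<dots> = restr \<sigma> (A v)"
        by (rule restr_cong[OF _ order.refl]) (auto simp: A_def pn permutes_inverses[OF p(1)])
      finally show ?thesis .
    qed
    show "(\<Prod>v\<in>blacks g. F x (list_of_mset (restr (restrict (\<sigma> \<circ> inv p) {..<n}) (fibre {..<n} \<phi> v)))) *
       (\<Prod>w\<in>whites g. ?D (\<alpha> w) (restr (restrict (\<sigma> \<circ> inv p) {..<n}) (fibre {..<n} \<psi> w))) = T \<sigma>"
      unfolding T_def by (intro arg_cong2[where f = times] prod.cong refl) (simp_all only: Ab[symmetric] Aw[symmetric] r)
  qed auto
  finally have br: "graph_bracket F G g \<alpha> x =
    fps_const (\<Prod>v\<in>blacks g. \<kappa> v) * bracket_sum F G x (blacks g) (whites g) n \<phi> \<psi> \<alpha>" .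
  have "of_nat (edge_mult g) = (\<Prod>v\<in>blacks g. \<Prod>w\<in>whites g. fact (count (edges g) (v, w)) :: complex)"
    by (simp add: edge_mult_def of_nat_prod prod.cartesian_product)
  also have "\<dots> = (\<Prod>v\<in>blacks g. \<Prod>i=1..valency g v. fact i ^ num_neighbours g v i)"
    by (intro prod.cong refl) (rule prod_num_neighbours[OF g, symmetric])
  finally have "of_nat (edge_mult g) * (\<Prod>v\<in>blacks g. \<kappa> v) = (\<Prod>v\<in>blacks g. fact (valency g v) :: complex)"
    by (simp add: \<kappa>_def prod.distrib[symmetric])
  also have "\<dots> = (\<Prod>v\<in>blacks g. fact (card (fibre {..<n} \<phi> v)))"
    using valency_fibre[OF g en] by (simp add: n_def)
  finally have "fps_const (of_nat (edge_mult g)) * fps_const (\<Prod>v\<in>blacks g. \<kappa> v) =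
    fps_const (\<Prod>v\<in>blacks g. fact (card (fibre {..<n} \<phi> v)))"
    by (simp only: fps_const_mult)
  then show ?thesis
    unfolding br n_def[symmetric] by (simp only: mult.assoc[symmetric])
qed

lemma edge_mult_pos: "edge_mult g > 0"
  unfolding edge_mult_def by (intro prod_pos) simp

lemma card_permutations_edges:
  assumes "is_wgraph g"
  shows "card (permutations_of_multiset (edges g)) * edge_mult g = fact (size (edges g))"
proof -
  have "edge_mult g = (\<Prod>e\<in>set_mset (edges g). fact (count (edges g) e))"
    unfolding edge_mult_def
    by (rule prod.mono_neutral_right) (use assms in \<open>auto simp: is_wgraph_def not_in_iff\<close>)
  then show ?thesis using card_permutations_of_multiset_aux[of "edges g"] by simp
qed

text \<open>Coefficient of the momentum monomial \<open>M\<close> in the term of \<open>g\<close>,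
  with the symmetry factor left to \<open>sum_iso_classes\<close>.\<close>

definition graph_coeff :: "(real^'a::finite \<Rightarrow> 'b::finite list \<Rightarrow> complex fps) \<Rightarrow>
    (real^'b \<Rightarrow> 'c::finite list \<Rightarrow> complex fps) \<Rightarrow> real^'a \<Rightarrow> 'c multiset \<Rightarrow> wgraph \<Rightarrow> complex fls" where
  "graph_coeff F G x M g = (\<Sum>\<alpha> | \<alpha> \<in> labellings g \<and> (\<Sum>w\<in>whites g. mset (\<alpha> w)) = M.
     hbar_over_i powi betti g * fps_to_fls (graph_bracket F G g \<alpha> x))"

lemma finite_labellings: "finite (labellings g :: (int \<Rightarrow> 'c::finite list) set)"
  unfolding labellings_def by (intro finite_PiE) (simp_all add: finite_lists_length)

lemma enumerates_relabel: "enumerates \<phi> \<psi> g \<Longrightarrow> enumerates (\<pi> \<circ> \<phi>) (\<rho> \<circ> \<psi>) (relabel \<pi> \<rho> g)"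
proof -
  assume en: "enumerates \<phi> \<psi> g"
  have "image_mset (map_prod \<pi> \<rho>) (edges g) =
      image_mset (map_prod \<pi> \<rho>) (image_mset (\<lambda>i. (\<phi> i, \<psi> i)) (mset_set {..<size (edges g)}))"
    using en unfolding enumerates_def by (rule arg_cong)
  then show ?thesis by (simp add: enumerates_def multiset.map_comp o_def)
qed

lemma fibre_permute: "bij \<pi> \<Longrightarrow> fibre X (\<pi> \<circ> \<phi>) (\<pi> v) = fibre X \<phi> v"
  by (auto simp: fibre_def bij_def inj_eq)

lemma count_image_mset_injective: "inj f \<Longrightarrow> count (image_mset f M) (f x) = count M x"
  by (induction M) (auto simp: inj_eq)

lemma edge_mult_relabel:
  assumes "(\<pi>, \<rho>) \<in> relabellings g"
  shows "edge_mult (relabel \<pi> \<rho> g) = edge_mult g"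
proof -
  have p: "\<pi> permutes blacks g" "\<rho> permutes whites g" using assms by (auto simp: relabellings_def)
  have inj: "inj (map_prod \<pi> \<rho>)" using permutes_inj[OF p(1)] permutes_inj[OF p(2)] by (rule prod.inj_map)
  have "map_prod \<pi> \<rho> ` (blacks g \<times> whites g) = blacks g \<times> whites g"
    using permutes_image[OF p(1)] permutes_image[OF p(2)] by (simp add: map_prod_image)
  then have "edge_mult (relabel \<pi> \<rho> g) =
    (\<Prod>e\<in>map_prod \<pi> \<rho> ` (blacks g \<times> whites g). fact (count (image_mset (map_prod \<pi> \<rho>) (edges g)) e))"
    by (simp add: edge_mult_def)
  also have "\<dots> = edge_mult g"
    using inj_on_subset[OF inj subset_UNIV]
    by (simp add: prod.reindex edge_mult_def count_image_mset_injective[OF inj] o_def)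
  finally show ?thesis .
qed

text \<open>The brackets of \<open>g\<close> and \<open>h\<close> use unrelated enumerations, so
  they are compared through one enumeration and its relabelling. Labels travel with the white
  vertices: \<open>\<alpha>\<close> on \<open>h\<close> corresponds to
  \<open>\<alpha> \<circ> \<rho>\<close> on \<open>g\<close>.\<close>

lemma graph_coeff_relabel:
  fixes F :: "real^'a::finite \<Rightarrow> 'b::finite list \<Rightarrow> complex fps"
    and G :: "real^'b \<Rightarrow> 'c::finite list \<Rightarrow> complex fps"
  assumes U: "open U" "base_point (formal_map F x) \<in> U"
    and sm: "\<And>I. smooth_fps U (\<lambda>y. G y I)"
    and sym: "\<And>I J. mset I = mset J \<Longrightarrow> F x I = F x J"
    and g: "is_wgraph g" and h: "h \<in> iso_class g"
  shows "graph_coeff F G x M h = graph_coeff F G x M g"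
proof -
  obtain \<pi> \<rho> where r: "(\<pi>, \<rho>) \<in> relabellings g" and h: "h = relabel \<pi> \<rho> g" using h by (auto simp: iso_class_def)
  have p: "\<pi> permutes blacks g" "\<rho> permutes whites g" using r by (auto simp: relabellings_def)
  have b: "bij \<pi>" "bij \<rho>" using p by (auto simp: permutes_bij)
  obtain \<phi> \<psi> where en: "enumerates \<phi> \<psi> g" using enumerates_exists by blast
  define n where "n = size (edges g)"
  have sz: "size (edges h) = n" "blacks h = blacks g" "whites h = whites g" "betti h = betti g"
    by (simp_all add: h n_def betti_def)
  have bs: "bracket_sum F G x (blacks g) (whites g) n (\<pi> \<circ> \<phi>) (\<rho> \<circ> \<psi>) \<alpha> =
    bracket_sum F G x (blacks g) (whites g) n \<phi> \<psi> (\<alpha> \<circ> \<rho>)" for \<alpha>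
    unfolding bracket_sum_def
    by (subst prod.permute[OF p(1)], subst prod.permute[OF p(2)]) (simp add: fibre_permute[unfolded o_def] b o_def)
  have br: "graph_bracket F G h \<alpha> x = graph_bracket F G g (restrict (\<alpha> \<circ> \<rho>) (whites g)) x" for \<alpha>
  proof -
    have "fps_const (of_nat (edge_mult g)) * graph_bracket F G h \<alpha> x =
      fps_const (\<Prod>v\<in>blacks g. fact (card (fibre {..<n} (\<pi> \<circ> \<phi>) v))) *
      bracket_sum F G x (blacks g) (whites g) n (\<pi> \<circ> \<phi>) (\<rho> \<circ> \<psi>) \<alpha>"
      using graph_bracket_eq[where F = F and G = G and x = x, OF U sm sym is_wgraph_relabel[OF g r] enumerates_relabel[OF en], where \<alpha> = \<alpha>]
      by (simp only: sz edge_mult_relabel[OF r, folded h] h[symmetric])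
    also have "(\<Prod>v\<in>blacks g. fact (card (fibre {..<n} (\<pi> \<circ> \<phi>) v)) :: complex) =
        (\<Prod>v\<in>blacks g. fact (card (fibre {..<n} \<phi> v)))"
      by (subst prod.permute[OF p(1)]) (simp add: fibre_permute b)
    also note bs
    also have "bracket_sum F G x (blacks g) (whites g) n \<phi> \<psi> (\<alpha> \<circ> \<rho>) =
      bracket_sum F G x (blacks g) (whites g) n \<phi> \<psi> (restrict (\<alpha> \<circ> \<rho>) (whites g))"
      by (simp add: bracket_sum_def)
    also have "fps_const (\<Prod>v\<in>blacks g. fact (card (fibre {..<n} \<phi> v))) * \<dots> =
      fps_const (of_nat (edge_mult g)) * graph_bracket F G g (restrict (\<alpha> \<circ> \<rho>) (whites g)) x"
      unfolding n_def by (rule graph_bracket_eq[where F = F and G = G and x = x, OF U sm sym g en, symmetric])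
    finally show ?thesis using edge_mult_pos[of g] by simp
  qed
  have iw: "inv \<rho> w \<in> whites g \<longleftrightarrow> w \<in> whites g" "\<rho> w \<in> whites g \<longleftrightarrow> w \<in> whites g" for w
    using permutes_in_image[OF p(2)] permutes_in_image[OF permutes_inv[OF p(2)]] by auto
  show ?thesis
    unfolding graph_coeff_def sz br
  proof (rule sum.reindex_bij_witness[where j = "\<lambda>\<alpha>. restrict (\<alpha> \<circ> \<rho>) (whites g)"
        and i = "\<lambda>\<alpha>. restrict (\<alpha> \<circ> inv \<rho>) (whites g)"])
    fix \<alpha> :: "int \<Rightarrow> 'c list" assume a: "\<alpha> \<in> {\<alpha>. \<alpha> \<in> labellings h \<and> (\<Sum>w\<in>whites g. mset (\<alpha> w)) = M}"
    then have e: "\<alpha> \<in> extensional (whites g)" by (simp add: labellings_def sz PiE_def)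
    show "restrict (restrict (\<alpha> \<circ> \<rho>) (whites g) \<circ> inv \<rho>) (whites g) = \<alpha>"
      using e iw by (auto simp: fun_eq_iff extensional_def permutes_inverses[OF p(2)])
    have "(\<Sum>w\<in>whites g. mset (\<alpha> (\<rho> w))) = (\<Sum>w\<in>whites g. mset (\<alpha> w))"
      using sum.permute[OF p(2), of "\<lambda>w. mset (\<alpha> w)"] by (simp add: o_def)
    then show "restrict (\<alpha> \<circ> \<rho>) (whites g) \<in> {\<alpha>. \<alpha> \<in> labellings g \<and> (\<Sum>w\<in>whites g. mset (\<alpha> w)) = M}"
      using a iw by (auto simp: labellings_def sz PiE_iff h permutes_inverses[OF p(2)])
  next
    fix \<alpha> :: "int \<Rightarrow> 'c list" assume a: "\<alpha> \<in> {\<alpha>. \<alpha> \<in> labellings g \<and> (\<Sum>w\<in>whites g. mset (\<alpha> w)) = M}"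
    then have e: "\<alpha> \<in> extensional (whites g)" by (simp add: labellings_def PiE_def)
    show "restrict (restrict (\<alpha> \<circ> inv \<rho>) (whites g) \<circ> \<rho>) (whites g) = \<alpha>"
      using e iw by (auto simp: fun_eq_iff extensional_def permutes_inverses[OF p(2)])
    have "(\<Sum>w\<in>whites g. mset (\<alpha> (inv \<rho> w))) = (\<Sum>w\<in>whites g. mset (\<alpha> w))"
      using sum.permute[OF permutes_inv[OF p(2)], of "\<lambda>w. mset (\<alpha> w)"] by (simp add: o_def)
    then show "restrict (\<alpha> \<circ> inv \<rho>) (whites g) \<in> {\<alpha>. \<alpha> \<in> labellings h \<and> (\<Sum>w\<in>whites g. mset (\<alpha> w)) = M}"
      using a iw by (auto simp: labellings_def sz PiE_iff h)
  qed simp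
qed

section \<open>Coefficients of the graph sum\<close>

text \<open>The number of edges is the degree of a graph and the total weight is the number of
  momenta in its monomials, so this set holds all graphs that contribute to a given
  coefficient.\<close>

definition graphs_of_size :: "nat \<Rightarrow> nat \<Rightarrow> wgraph set" where
  "graphs_of_size n k = {g \<in> Gamma_circ. size (edges g) = n \<and> (\<Sum>w\<in>whites g. weight g w) = k}"

text \<open>The first step of a path to another vertex is an edge at \<open>u\<close>.\<close>

lemma vertex_covered:
  assumes "g \<in> Gamma_circ" "u \<in> verts g" "v \<in> verts g" "u \<noteq> v"
  shows "\<exists>e\<in>#edges g. u = fst e \<or> u = snd e"
proof -
  have "(u, v) \<in> (set_mset (edges g) \<union> (set_mset (edges g))\<inverse>)\<^sup>*"
    using assms by (simp add: Gamma_circ_iff connected_wgraph_def)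
  then obtain y where "(u, y) \<in> set_mset (edges g) \<union> (set_mset (edges g))\<inverse>"
    using assms(4) by (meson converse_rtranclE)
  then show ?thesis by force
qed

lemma Gamma_circ_surj:
  assumes "g \<in> Gamma_circ" "enumerates \<phi> \<psi> g" "size (edges g) > 0"
  shows "blacks g = \<phi> ` {..<size (edges g)}" "whites g = \<psi> ` {..<size (edges g)}"
proof -
  let ?n = "size (edges g)"
  have wf: "is_wgraph g" using assms(1) by (simp add: Gamma_circ_iff)
  note mem = enumerates_mem[OF wf assms(2)]
  have cov: "\<exists>i<?n. u = \<phi> i \<or> u = \<psi> i" if u: "u \<in> verts g" for u
  proof -
    \<comment> \<open>The ends of edge 0 are distinct, so any vertex differs from one of them and
      \<open>vertex_covered\<close> applies.\<close>
    have "\<phi> 0 \<in> verts g" "\<psi> 0 \<in> verts g" "\<phi> 0 \<noteq> \<psi> 0"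
      using mem[OF assms(3)] whites_disjoint_blacks by (auto simp: verts_def)
    then obtain e where e: "e \<in># edges g" "u = fst e \<or> u = snd e"
      using vertex_covered[OF assms(1) u] by metis
    then have "e \<in># image_mset (\<lambda>i. (\<phi> i, \<psi> i)) (mset_set {..<?n})"
      using assms(2) unfolding enumerates_def by simp
    then show ?thesis using e(2) by auto
  qed
  show "blacks g = \<phi> ` {..<?n}"
  proof (intro equalityI subsetI)
    fix u assume u: "u \<in> blacks g"
    then obtain i where "i < ?n" "u = \<phi> i \<or> u = \<psi> i" using cov by (auto simp: verts_def)
    then show "u \<in> \<phi> ` {..<?n}" using mem(2)[of i] u whites_disjoint_blacks by auto
  qed (use mem in auto)
  show "whites g = \<psi> ` {..<?n}"
  proof (intro equalityI subsetI)
    fix u assume u: "u \<in> whites g"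
    then obtain i where "i < ?n" "u = \<phi> i \<or> u = \<psi> i" using cov by (auto simp: verts_def)
    then show "u \<in> \<psi> ` {..<?n}" using mem(1)[of i] u whites_disjoint_blacks by auto
  qed (use mem in auto)
qed

lemma card_verts: "card (verts g) = num_black g + num_white g"
  unfolding verts_def using whites_disjoint_blacks by (subst card_Un_disjoint) auto

lemma Gamma_circ_no_edges:
  assumes "g \<in> Gamma_circ" "size (edges g) = 0"
  shows "(num_black g, num_white g) = (1, 0) \<or> (num_black g, num_white g) = (0, 1)"
proof -
  have e: "edges g = {#}" using assms(2) by simp
  obtain u where u: "u \<in> verts g" using assms(1) by (auto simp: Gamma_circ_iff)
  have "verts g = {u}" using vertex_covered[OF assms(1) u] u by (auto simp: e)
  then show ?thesis using card_verts[of g] by auto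
qed

text \<open>Every vertex is an end of an edge unless the graph is a single vertex; the latter case
  accounts for \<open>Suc\<close>.\<close>

lemma Gamma_circ_bounds:
  assumes "g \<in> Gamma_circ"
  shows "num_black g \<le> Suc (size (edges g))" "num_white g \<le> Suc (size (edges g))"
proof -
  let ?n = "size (edges g)"
  obtain \<phi> \<psi> where en: "enumerates \<phi> \<psi> g" using enumerates_exists by blast
  have "num_black g \<le> Suc ?n \<and> num_white g \<le> Suc ?n"
  proof (cases "?n = 0")
    case True
    then show ?thesis using Gamma_circ_no_edges[OF assms] by auto
  next
    case False
    then have "blacks g = \<phi> ` {..<?n}" "whites g = \<psi> ` {..<?n}" using Gamma_circ_surj[OF assms en] by auto
    then show ?thesis
      by (metis card_blacks card_whites card_image_le card_lessThan finite_lessThan le_SucI)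
  qed
  then show "num_black g \<le> Suc ?n" "num_white g \<le> Suc ?n" by auto
qed

text \<open>The number of edges bounds the vertices and the total weight bounds each weight, so a
  graph is encoded by bounded data.\<close>

lemma finite_graphs_of_size: "finite (graphs_of_size n k)"
proof -
  define Z where "Z = {- int (Suc n)..int (Suc n)}"
  let ?E = "{e. set e \<subseteq> Z \<times> Z \<and> length e = n}"
  let ?L = "{L. \<forall>w. (w \<in> Z \<longrightarrow> L w \<in> {..k}) \<and> (w \<notin> Z \<longrightarrow> L w = (0 :: nat))}"
  let ?f = "\<lambda>(b, w, e, L). \<lparr>num_black = b, num_white = w, edges = mset e, weight = L\<rparr>"
  have "graphs_of_size n k \<subseteq> ?f ` ({..Suc n} \<times> {..Suc n} \<times> ?E \<times> ?L)"
  proof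
    fix g assume "g \<in> graphs_of_size n k"
    then have g: "g \<in> Gamma_circ" "size (edges g) = n" "(\<Sum>w\<in>whites g. weight g w) = k"
      by (auto simp: graphs_of_size_def)
    have wf: "is_wgraph g" using g by (simp add: Gamma_circ_iff)
    have Z: "blacks g \<subseteq> Z" "whites g \<subseteq> Z"
      using Gamma_circ_bounds[OF g(1)] g(2) by (auto simp: blacks_def whites_def Z_def)
    have "length (list_of_mset (edges g)) = n" using g(2) by (metis mset_list_of_mset size_mset)
    moreover have "set (list_of_mset (edges g)) \<subseteq> Z \<times> Z"
      using wf Z by (fastforce simp: is_wgraph_def simp flip: set_mset_mset)
    moreover have "weight g \<in> ?L"
    proof -
      have "weight g w \<le> k" for w
      proof (cases "w \<in> whites g")
        case True
        then show ?thesis using g(3) member_le_sum[of w "whites g" "weight g"] by simp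
      qed (use wf in \<open>simp add: is_wgraph_def\<close>)
      moreover have "weight g w = 0" if "w \<notin> Z" for w using that Z wf by (auto simp: is_wgraph_def)
      ultimately show ?thesis by simp
    qed
    moreover have "num_black g \<le> Suc n" "num_white g \<le> Suc n" using Gamma_circ_bounds[OF g(1)] g(2) by auto
    ultimately show "g \<in> ?f ` ({..Suc n} \<times> {..Suc n} \<times> ?E \<times> ?L)"
      by (intro image_eqI[of _ _ "(num_black g, num_white g, list_of_mset (edges g), weight g)"]) simp_all
  qed
  moreover have "finite ({..Suc n} \<times> {..Suc n} \<times> ?E \<times> ?L)"
  proof -
    have "finite ?E" by (rule finite_lists_length_eq) (simp add: Z_def)
    moreover have "finite ?L" by (rule finite_set_of_finite_funs) (simp_all add: Z_def)
    ultimately show ?thesis by (intro finite_cartesian_product) simp_all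
  qed
  ultimately show ?thesis by (meson finite_imageI finite_subset)
qed

lemma sum_card_fibre:
  assumes "finite X" "finite V" "\<phi> ` X \<subseteq> V"
  shows "(\<Sum>v\<in>V. card (fibre X \<phi> v)) = card X"
  using sum.group[OF assms, of "\<lambda>_. 1 :: nat"] by (simp add: fibre_def)

text \<open>Black leaves are excluded, so restricting to valency at least 2 discards only isolated
  vertices, which contribute 0. Every edge has one black end.\<close>

lemma graph_degree_eq:
  assumes "g \<in> Gamma_circ"
  shows "graph_degree g = size (edges g)"
proof -
  let ?n = "size (edges g)"
  obtain \<phi> \<psi> where en: "enumerates \<phi> \<psi> g" using enumerates_exists by blast
  have wf: "is_wgraph g" using assms by (simp add: Gamma_circ_iff)
  have val: "valency g v \<noteq> 1" if "v \<in> blacks g" for v using assms that by (auto simp: Gamma_circ_iff)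
  have "graph_degree g = (\<Sum>v\<in>blacks g. valency g v)"
    unfolding graph_degree_def
  proof (rule sum.mono_neutral_left)
    show "\<forall>v\<in>blacks g - {v. v \<in> blacks g \<and> 2 \<le> valency g v}. valency g v = 0"
      using val by fastforce
  qed auto
  also have "\<dots> = (\<Sum>v\<in>blacks g. card (fibre {..<?n} \<phi> v))"
    using valency_fibre[OF wf en] by simp
  also have "\<dots> = ?n"
    using sum_card_fibre[of "{..<?n}" "blacks g" \<phi>] enumerates_mem(1)[OF wf en] by auto
  finally show ?thesis .
qed

lemma iso_class_graphs_of_size: "g \<in> graphs_of_size n k \<Longrightarrow> h \<in> iso_class g \<Longrightarrow> h \<in> graphs_of_size n k"
proof -
  assume g: "g \<in> graphs_of_size n k" and h: "h \<in> iso_class g"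
  obtain \<pi> \<rho> where r: "(\<pi>, \<rho>) \<in> relabellings g" and h': "h = relabel \<pi> \<rho> g"
    using h by (auto simp: iso_class_def)
  have "inv \<rho> permutes whites g" using r by (auto simp: relabellings_def permutes_inv)
  from sum.permute[OF this, of "weight g"] have "(\<Sum>w\<in>whites h. weight h w) = (\<Sum>w\<in>whites g. weight g w)"
    by (simp add: h' o_def)
  then show ?thesis using g iso_class_Gamma_circ[OF _ h] by (auto simp: graphs_of_size_def h')
qed

lemma graph_term_nth:
  "mfps_nth (fps_nth (graph_term F G x g) n) M =
    1 / of_nat (card (sym_group g)) * (if graph_degree g = n then graph_coeff F G x M g else 0)"
proof -
  have "mfps_nth (\<Sum>\<alpha>\<in>labellings g. mfps_monom (\<Sum>w\<in>whites g. mset (\<alpha> w))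
      (1 / of_nat (card (sym_group g)) * hbar_over_i powi betti g * fps_to_fls (graph_bracket F G g \<alpha> x))) M =
    (\<Sum>\<alpha>\<in>labellings g. if (\<Sum>w\<in>whites g. mset (\<alpha> w)) = M then
      1 / of_nat (card (sym_group g)) * (hbar_over_i powi betti g * fps_to_fls (graph_bracket F G g \<alpha> x)) else 0)"
    unfolding mfps_nth_sum by (intro sum.cong refl) (auto simp: mfps_monom_nth)
  also have "\<dots> = (\<Sum>\<alpha> | \<alpha> \<in> labellings g \<and> (\<Sum>w\<in>whites g. mset (\<alpha> w)) = M.
      1 / of_nat (card (sym_group g)) * (hbar_over_i powi betti g * fps_to_fls (graph_bracket F G g \<alpha> x)))"
    by (rule sum.inter_filter[OF finite_labellings, symmetric])
  also have "\<dots> = 1 / of_nat (card (sym_group g)) * graph_coeff F G x M g"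
    by (simp only: graph_coeff_def sum_distrib_left)
  finally show ?thesis
    by (auto simp: graph_term_def fps_X_power_mult_nth)
qed

context
  fixes F :: "real^'a::finite \<Rightarrow> 'b::finite list \<Rightarrow> complex fps"
    and G :: "real^'b \<Rightarrow> 'c::finite list \<Rightarrow> complex fps"
    and U :: "(real^'b) set" and x :: "real^'a"
  assumes U: "open U" "base_point (formal_map F x) \<in> U"
    and sm: "\<And>I. smooth_fps U (\<lambda>y. G y I)"
    and sym: "\<And>I J. mset I = mset J \<Longrightarrow> F x I = F x J"
begin

lemma graph_sum_nth:
  "mfps_nth (fps_nth (graph_sum F G x) n) M = (\<Sum>g\<in>graphs_of_size n (size M).
     graph_coeff F G x M g / (fact (num_black g) * fact (num_white g)))"
proof -
  let ?y = "\<lambda>g. if graph_degree g = n then graph_coeff F G x M g else 0"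
  have deg: "graph_degree g = n" if "g \<in> graphs_of_size n k" for g k
    using that graph_degree_eq by (auto simp: graphs_of_size_def)
  have "mfps_nth (fps_nth (graph_sum F G x) n) M =
    (\<Sum>g\<in>graphs_of_size n (size M). ?y g / (fact (num_black g) * fact (num_white g)))"
    unfolding graph_sum_def formal_sum_def fps_nth_Abs_fps mfps_nth_Abs
  proof (rule sum_iso_classes)
    show "finite (graphs_of_size n (size M))" by (rule finite_graphs_of_size)
    show "graphs_of_size n (size M) \<subseteq> Gamma_circ" by (auto simp: graphs_of_size_def)
    show "h \<in> graphs_of_size n (size M)" if "g \<in> graphs_of_size n (size M)" "h \<in> iso_class g" for g h
      using that by (rule iso_class_graphs_of_size)
    show "?y h = ?y g" if g: "g \<in> graphs_of_size n (size M)" and h: "h \<in> iso_class g" for g h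
    proof -
      have wf: "is_wgraph g" using g by (auto simp: graphs_of_size_def Gamma_circ_iff)
      have "graph_coeff F G x M h = graph_coeff F G x M g"
        by (rule graph_coeff_relabel[where F = F and G = G and x = x and U = U])
          (rule U sm wf h | erule sym)+
      then show ?thesis using deg[OF g] deg[OF iso_class_graphs_of_size[OF g h]] by simp
    qed
    show "?y g = 0" if g: "g \<in> Gamma_circ" "g \<notin> graphs_of_size n (size M)" for g
    proof (cases "graph_degree g = n")
      case True
      then have "(\<Sum>w\<in>whites g. weight g w) \<noteq> size M"
        using g graph_degree_eq by (auto simp: graphs_of_size_def)
      \<comment> \<open>A labelling produces a monomial whose size is the total weight, so graphs of
        another total weight miss \<open>M\<close>.\<close>
      moreover have "size (\<Sum>w\<in>whites g. mset (\<alpha> w)) = (\<Sum>w\<in>whites g. weight g w)"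
        if "\<alpha> \<in> labellings g" for \<alpha> :: "int \<Rightarrow> 'c list"
      proof -
        have "size (\<Sum>w\<in>A. mset (\<alpha> w)) = (\<Sum>w\<in>A. length (\<alpha> w))" for A
          by (induction A rule: infinite_finite_induct) auto
        then show ?thesis using that by (auto simp: labellings_def PiE_iff intro!: sum.cong)
      qed
      ultimately have "{\<alpha> :: int \<Rightarrow> 'c list. \<alpha> \<in> labellings g \<and> (\<Sum>w\<in>whites g. mset (\<alpha> w)) = M} = {}"
        by auto
      then show ?thesis by (simp only: graph_coeff_def sum.empty if_cancel)
    qed simp
    show "mfps_nth (fps_nth (graph_term F G x (SOME g. g \<in> C)) n) M =
      1 / of_nat (card (sym_group (SOME g. g \<in> C))) * ?y (SOME g. g \<in> C)" for C
      by (rule graph_term_nth)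
  qed
  also have "\<dots> = (\<Sum>g\<in>graphs_of_size n (size M).
     graph_coeff F G x M g / (fact (num_black g) * fact (num_white g)))"
    by (intro sum.cong refl) (simp add: deg)
  finally show ?thesis .
qed

lemma phase_derivative_eq:
  "phase_derivative (formal_map F x) (\<lambda>y. momentum_series (G y)) N =
    Abs_mfps (\<lambda>M. \<Sum>I | mset I = M. fps_to_fls (white_derivative (formal_map F x) G I N))"
proof (rule mfps_eqI)
  fix M
  let ?c = "formal_map F x"
  have "taylor_at ?c (\<lambda>y. foldr partial_fps (list_of_mset N) (\<lambda>z. \<Sum>I | mset I = M. G z I) y) =
    taylor_at ?c (\<lambda>y. \<Sum>I | mset I = M. foldr partial_fps (list_of_mset N) (\<lambda>z. G z I) y)"
    by (rule taylor_at_cong[OF U], rule partial_fps_sum[OF U(1) finite_lists_mset sm])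
  also have "\<dots> = (\<Sum>I | mset I = M. white_derivative ?c G I N)"
    unfolding white_derivative_def
  proof (rule taylor_at_sum[OF U finite_lists_mset])
    fix I
    show "smooth_fps U (foldr partial_fps J (\<lambda>z. G z I))" for J
      by (induction J) (auto simp: sm smooth_fps_partial)
  qed
  finally show "mfps_nth (phase_derivative ?c (\<lambda>y. momentum_series (G y)) N) M =
     mfps_nth (Abs_mfps (\<lambda>M. \<Sum>I | mset I = M. fps_to_fls (white_derivative ?c G I N))) M"
    by (simp add: phase_derivative_def taylor_at_mfps_def mfps_nth_foldr_partial momentum_series_def
        fps_to_fls_sum)
qed

text \<open>A connected graph without edges is a single vertex. The black one contributes the part
  of \<open>F\<close> without momenta, and the white one of weight \<open>k\<close> the terms of
  \<open>G\<close> with \<open>k\<close> momenta, evaluated at the formal point.\<close>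

lemma graph_sum_nth_0:
  "fps_nth (graph_sum F G x) 0 =
    mfps_const (fps_to_fls (F x [])) + taylor_at_mfps (formal_map F x) (\<lambda>y. momentum_series (G y))"
proof (rule mfps_eqI)
  fix M
  let ?c = "formal_map F x"
  let ?b = "\<lparr>num_black = Suc 0, num_white = 0, edges = {#}, weight = (\<lambda>_. 0)\<rparr>"
  let ?o = "\<lambda>k. \<lparr>num_black = 0, num_white = Suc 0, edges = {#}, weight = (\<lambda>w. if w = - 1 then k else 0)\<rparr>"
  have bsets: "blacks ?b = {1}" "whites ?b = {}" "blacks (?o k) = {}" "whites (?o k) = {- 1}" for k
    by (auto simp: blacks_def whites_def)
  have val: "valency ?b v = 0" for v by (simp add: valency_def)
  have mem: "?b \<in> graphs_of_size 0 0" "?o k \<in> graphs_of_size 0 k" for k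
    by (auto simp: graphs_of_size_def Gamma_circ_iff is_wgraph_def bsets verts_def connected_wgraph_def val)
  \<comment> \<open>The black vertex carries no labels and so occurs for \<open>k = 0\<close>
    only.\<close>
  have cases: "graphs_of_size 0 k = (if k = 0 then {?b, ?o k} else {?o k})" for k
  proof -
    have "(g = ?b \<and> k = 0) \<or> g = ?o k" if g: "g \<in> graphs_of_size 0 k" for g
    proof -
      have G: "g \<in> Gamma_circ" and e: "edges g = {#}" and w: "(\<Sum>w\<in>whites g. weight g w) = k"
        using g by (auto simp: graphs_of_size_def)
      have w0: "weight g w = 0" if "w \<notin> whites g" for w
        using G that by (auto simp: Gamma_circ_iff is_wgraph_def)
      from Gamma_circ_no_edges[OF G] e consider "num_black g = 1" "num_white g = 0" | "num_black g = 0" "num_white g = 1"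
        by auto
      then show ?thesis
      proof cases
        case 1
        then have "whites g = {}" by (simp add: whites_def)
        then show ?thesis using 1 e w w0 by (auto intro!: wgraph.equality)
      next
        case 2
        then have "whites g = {- 1}" by (auto simp: whites_def)
        then have "g = ?o k" using 2 e w w0 by (intro wgraph.equality) (auto simp: fun_eq_iff)
        then show ?thesis ..
      qed
    qed
    then show ?thesis using mem by auto
  qed
  have bb: "graph_coeff F G x M ?b = (if M = {#} then fps_to_fls (F x []) else 0)"
  proof -
    have lab: "(labellings ?b :: (int \<Rightarrow> 'c list) set) = {\<lambda>_. undefined}"
      unfolding labellings_def bsets by (simp only: PiE_empty_domain)
    have "{\<alpha> :: int \<Rightarrow> 'c list. \<alpha> \<in> labellings ?b \<and> (\<Sum>w\<in>whites ?b. mset (\<alpha> w)) = M} =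
        (if M = {#} then {\<lambda>_. undefined} else {})"
      unfolding lab bsets by auto
    moreover have "graph_bracket F G ?b \<alpha> x = F x []" for \<alpha>
      unfolding graph_bracket_def bsets val by (simp add: indices_at_def)
    moreover have "betti ?b = 0" by (simp add: betti_def card_verts)
    ultimately show ?thesis by (simp add: graph_coeff_def)
  qed
  have oo: "graph_coeff F G x M (?o (size M)) = mfps_nth (taylor_at_mfps ?c (\<lambda>y. momentum_series (G y))) M"
  proof -
    have br: "graph_bracket F G (?o k) \<alpha> x = taylor_at ?c (\<lambda>y. G y (\<alpha> (- 1)))" for k \<alpha>
      unfolding graph_bracket_def bsets by (simp add: indices_at_def)
    have bt: "betti (?o k) = 0" for k by (simp add: betti_def card_verts)
    have "graph_coeff F G x M (?o (size M)) = (\<Sum>\<alpha> | \<alpha> \<in> labellings (?o (size M)) \<and> mset (\<alpha> (- 1)) = M.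
       fps_to_fls (taylor_at ?c (\<lambda>y. G y (\<alpha> (- 1)))))"
      unfolding graph_coeff_def bsets br bt by simp
    also have "\<dots> = (\<Sum>I | mset I = M. fps_to_fls (taylor_at ?c (\<lambda>y. G y I)))"
      by (rule sum.reindex_bij_witness[where j = "\<lambda>\<alpha>. \<alpha> (- 1)" and i = "\<lambda>I. restrict (\<lambda>_. I) {- 1}"])
        (auto simp: labellings_def bsets PiE_def extensional_def fun_eq_iff)
    also have "\<dots> = mfps_nth (taylor_at_mfps ?c (\<lambda>y. momentum_series (G y))) M"
      by (simp add: taylor_at_mfps_def momentum_series_def taylor_at_sum[OF U finite_lists_mset sm]
          fps_to_fls_sum)
    finally show ?thesis .
  qed
  have "?b \<noteq> ?o k" for k by simp
  then have "mfps_nth (fps_nth (graph_sum F G x) 0) M =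
    (if M = {#} then fps_to_fls (F x []) else 0) + mfps_nth (taylor_at_mfps ?c (\<lambda>y. momentum_series (G y))) M"
    unfolding graph_sum_nth cases using bb oo by auto
  then show "mfps_nth (fps_nth (graph_sum F G x) 0) M =
    mfps_nth (mfps_const (fps_to_fls (F x [])) + taylor_at_mfps ?c (\<lambda>y. momentum_series (G y))) M"
    by (simp add: mfps_monom_nth)
qed

end

text \<open>Graph connectivity joins vertices by paths, connectivity of partitions joins edges by
  common vertices; the two agree when every vertex is the end of an edge.\<close>

lemma connected_wgraph_iff:
  assumes wf: "is_wgraph g" and en: "enumerates \<phi> \<psi> g" and n: "n = size (edges g)" "n > 0"
    and surj: "blacks g = \<phi> ` {..<n}" "whites g = \<psi> ` {..<n}"
  shows "connected_wgraph g \<longleftrightarrow> connected_on {..<n} (kernel {..<n} \<phi> \<union> kernel {..<n} \<psi>)"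
proof -
  define R where "R = set_mset (edges g) \<union> (set_mset (edges g))\<inverse>"
  have E: "set_mset (edges g) = (\<lambda>i. (\<phi> i, \<psi> i)) ` {..<n}"
    by (subst en[unfolded enumerates_def]) (simp add: n(1))
  have ne: "\<phi> i \<noteq> \<psi> j" if "i < n" "j < n" for i j
    using surj that whites_disjoint_blacks by blast
  show ?thesis
  proof
    assume conn: "connected_wgraph g"
    show "connected_on {..<n} (kernel {..<n} \<phi> \<union> kernel {..<n} \<psi>)"
      unfolding connected_on_def
    proof (intro allI impI)
      fix Y assume Y: "Y \<subseteq> {..<n}" "Y \<noteq> {}" and cl: "closed_under (kernel {..<n} \<phi> \<union> kernel {..<n} \<psi>) Y"
      have same: "j \<in> Y" if "l \<in> Y" "j < n" "\<phi> l = \<phi> j \<or> \<psi> l = \<psi> j" for l j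
      proof -
        have "l < n" using that Y by auto
        then have "fibre {..<n} \<phi> (\<phi> l) \<in> kernel {..<n} \<phi>" "fibre {..<n} \<psi> (\<psi> l) \<in> kernel {..<n} \<psi>"
          "l \<in> fibre {..<n} \<phi> (\<phi> l)" "l \<in> fibre {..<n} \<psi> (\<psi> l)"
          by (auto simp: kernel_def fibre_def)
        then have "fibre {..<n} \<phi> (\<phi> l) \<subseteq> Y" "fibre {..<n} \<psi> (\<psi> l) \<subseteq> Y"
          using cl that(1) unfolding closed_under_def by blast+
        then show ?thesis using that by (auto simp: fibre_def)
      qed
      obtain i where i: "i \<in> Y" using Y by auto
      \<comment> \<open>Along any path from \<open>\<phi> i\<close>, all edges at the vertex reached
        belong to \<open>Y\<close>.\<close>
      have reach: "\<forall>j<n. \<phi> j = v \<or> \<psi> j = v \<longrightarrow> j \<in> Y" if "(\<phi> i, v) \<in> R\<^sup>*" for v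
        using that
      proof (induction rule: rtrancl_induct)
        case base
        then show ?case using same[OF i] ne i Y by (metis lessThan_iff subsetD)
      next
        case (step y z)
        then obtain l where l: "l < n" "(y = \<phi> l \<and> z = \<psi> l) \<or> (y = \<psi> l \<and> z = \<phi> l)"
          by (auto simp: R_def E)
        then have "l \<in> Y" using step.IH by auto
        then show ?case using same[of l] l ne by metis
      qed
      have "{..<n} \<subseteq> Y"
      proof
        fix j assume j: "j \<in> {..<n}"
        then have "\<phi> i \<in> verts g" "\<phi> j \<in> verts g" using i Y surj by (auto simp: verts_def)
        then have "(\<phi> i, \<phi> j) \<in> R\<^sup>*" using conn by (simp add: connected_wgraph_def R_def)
        then show "j \<in> Y" using reach j by auto
      qed
      then show "Y = {..<n}" using Y by auto
    qed
  next
    assume conn: "connected_on {..<n} (kernel {..<n} \<phi> \<union> kernel {..<n} \<psi>)"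
    \<comment> \<open>The edges whose black end can be reached from that of edge 0. Being closed and
      nonempty, they are all edges.\<close>
    define Y where "Y = {j. j < n \<and> (\<phi> 0, \<phi> j) \<in> R\<^sup>*}"
    have edge: "(\<phi> j, \<psi> j) \<in> R" "(\<psi> j, \<phi> j) \<in> R" if "j < n" for j
      using that by (auto simp: R_def E)
    have "closed_under (kernel {..<n} \<phi> \<union> kernel {..<n} \<psi>) Y"
      unfolding closed_under_def
    proof (intro ballI impI subsetI)
      fix B l assume B: "B \<in> kernel {..<n} \<phi> \<union> kernel {..<n} \<psi>" "B \<inter> Y \<noteq> {}" and l: "l \<in> B"
      then obtain j where j: "j \<in> B" "j \<in> Y" by auto
      from B(1) j(1) l have "l < n" "\<phi> l = \<phi> j \<or> \<psi> l = \<psi> j"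
        by (auto simp: kernel_def fibre_def)
      moreover have "(\<phi> 0, \<phi> l) \<in> R\<^sup>*" if "\<psi> l = \<psi> j"
      proof -
        have "(\<phi> 0, \<phi> j) \<in> R\<^sup>*" "j < n" using j by (auto simp: Y_def)
        then have "(\<phi> 0, \<psi> l) \<in> R\<^sup>*" using edge(1)[of j] that by (metis rtrancl.rtrancl_into_rtrancl)
        then show ?thesis using edge(2)[OF \<open>l < n\<close>] by (metis rtrancl.rtrancl_into_rtrancl)
      qed
      ultimately show "l \<in> Y" using j by (auto simp: Y_def)
    qed
    moreover have "Y \<noteq> {}" using n by (auto simp: Y_def)
    moreover have "Y \<subseteq> {..<n}" by (auto simp: Y_def)
    ultimately have "Y = {..<n}" using conn unfolding connected_on_def by simp
    then have r: "(\<phi> 0, \<phi> j) \<in> R\<^sup>*" "(\<phi> 0, \<psi> j) \<in> R\<^sup>*" if "j < n" for j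
      using that edge(1)[OF that] unfolding Y_def by (auto intro: rtrancl.rtrancl_into_rtrancl)
    have all: "(\<phi> 0, v) \<in> R\<^sup>*" if "v \<in> verts g" for v
      using that r surj by (auto simp: verts_def)
    have "Relation.sym (R\<^sup>*)" by (rule sym_rtrancl) (auto simp: R_def Relation.sym_def)
    then show "connected_wgraph g"
      unfolding connected_wgraph_def R_def[symmetric]
      using rtrancl_trans[OF symD[OF _ all] all] by blast
  qed
qed

section \<open>Graphs with edges\<close>

definition black_set :: "nat \<Rightarrow> int set" where
  "black_set b = {1..int b}"

definition white_set :: "nat \<Rightarrow> int set" where
  "white_set w = {- int w..- 1}"

lemma black_white_sets [simp]: "finite (black_set b)" "finite (white_set w)" "card (black_set b) = b" "card (white_set w) = w"
  by (simp_all add: black_set_def white_set_def)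

lemma blacks_eq: "blacks g = black_set (num_black g)" and whites_eq: "whites g = white_set (num_white g)"
  by (simp_all add: black_set_def white_set_def blacks_def whites_def)

text \<open>The colours are summed out for a fixed pair of partitions, since a graph corresponds to
  such a pair and not to a coloured one.\<close>

definition pair_weight :: "('b::finite list \<Rightarrow> complex fps) \<Rightarrow> ('b multiset \<Rightarrow> ('c, complex fls) mfps) \<Rightarrow>
    nat \<Rightarrow> nat set set \<Rightarrow> nat set set \<Rightarrow> ('c, complex fls) mfps" where
  "pair_weight f q n P Q = (\<Sum>\<sigma>\<in>{..<n} \<rightarrow>\<^sub>E UNIV.
     (\<Prod>B\<in>P. mfps_const (vertex_weight f (restr \<sigma> B))) * (\<Prod>B\<in>Q. q (restr \<sigma> B)))"

lemma colour_sum_connected_weight: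
  "colour_sum (connected_weight f q) {..<n} =
    (\<Sum>P | partition_on {..<n} P. \<Sum>Q | partition_on {..<n} Q.
      if connected_on {..<n} (P \<union> Q) then pair_weight f q n P Q else 0)"
proof -
  let ?PP = "{P. partition_on {..<n} P}"
  have "colour_sum (connected_weight f q) {..<n} =
    (\<Sum>(P, Q) | partition_on {..<n} P \<and> partition_on {..<n} Q \<and> connected_on {..<n} (P \<union> Q). pair_weight f q n P Q)"
    unfolding colour_sum_def connected_weight_def conn_sum_def pair_weight_def case_prod_unfold
    by (rule sum.swap)
  also have "\<dots> = (\<Sum>(P, Q)\<in>?PP \<times> ?PP. if connected_on {..<n} (P \<union> Q) then pair_weight f q n P Q else 0)"
    by (rule sum.mono_neutral_cong_left) (auto simp: finitely_many_partition_on split: if_splits)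
  finally show ?thesis by (simp add: sum.cartesian_product)
qed

lemma card_partition_le:
  assumes "finite X" "partition_on X P"
  shows "card P \<le> card X"
proof -
  have fin: "finite B" if "B \<in> P" for B using assms that by (auto simp: partition_on_def intro: finite_subset)
  have "card P = (\<Sum>B\<in>P. 1)" by simp
  also have "\<dots> \<le> (\<Sum>B\<in>P. card B)"
    using assms(2) fin by (intro sum_mono) (auto simp: partition_on_def Suc_le_eq card_gt_0_iff)
  also have "\<dots> = card X" by (rule product_partition[OF assms(2) fin, symmetric])
  finally show ?thesis .
qed

lemma sum_partitions_by_card:
  fixes H :: "nat set set \<Rightarrow> 'r::comm_monoid_add"
  shows "(\<Sum>P | partition_on {..<n} P. H P) = (\<Sum>b\<le>n. \<Sum>P | partition_on {..<n} P \<and> card P = b. H P)"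
  using sum.group[of "{P. partition_on {..<n} P}" "{..n}" card H] card_partition_le[of "{..<n}"]
  by (simp add: finitely_many_partition_on image_subset_iff)

lemma hbar_mult_i_over_hbar: "hbar_over_i * i_over_hbar = 1"
proof -
  have inv: "b / a * (a / b) = 1" if "a \<noteq> 0" "b \<noteq> 0" for a b :: "complex fls"
    using that by simp
  show ?thesis by (rule inv) simp_all
qed

lemma fps_to_fls_prod: "fps_to_fls (prod f A) = (\<Prod>a\<in>A. fps_to_fls (f a :: complex fps))"
  by (induction A rule: infinite_finite_induct) (simp_all add: fls_times_fps_to_fls)

lemma fps_to_fls_const_of_nat: "fps_to_fls (fps_const (of_nat m :: complex)) = of_nat m"
  by (metis fps_of_nat fps_to_fls_of_nat)

lemma pair_weight_fibres:
  assumes "\<phi> \<in> surj_maps {..<n} V" "\<psi> \<in> surj_maps {..<n} W"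
  shows "pair_weight f q n (kernel {..<n} \<phi>) (kernel {..<n} \<psi>) = (\<Sum>\<sigma>\<in>{..<n} \<rightarrow>\<^sub>E UNIV.
     (\<Prod>v\<in>V. mfps_const (vertex_weight f (restr \<sigma> (fibre {..<n} \<phi> v)))) *
     (\<Prod>w\<in>W. q (restr \<sigma> (fibre {..<n} \<psi> w))))"
  unfolding pair_weight_def
  by (simp only: prod_kernel[OF assms(1), of "\<lambda>B. mfps_const (vertex_weight f (restr _ B))"]
      prod_kernel[OF assms(2), of "\<lambda>B. q (restr _ B)"])

lemma finite_fibre: "finite X \<Longrightarrow> finite (fibre X \<phi> v)"
  by (simp add: fibre_def)

text \<open>A black vertex with one edge would stem from the linear part of \<open>F\<close>, for
  which \<open>vertex_weight\<close> is 0. So all partitions may be summed although black leaves are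
  excluded from the graphs.\<close>

lemma pair_weight_eq_0:
  fixes f :: "'b::finite list \<Rightarrow> complex fps" and q :: "'b multiset \<Rightarrow> ('c, complex fls) mfps"
  assumes "\<phi> \<in> surj_maps {..<n} V" "\<psi> \<in> surj_maps {..<n} W" "finite V" "v \<in> V" "card (fibre {..<n} \<phi> v) = 1"
  shows "pair_weight f q n (kernel {..<n} \<phi>) (kernel {..<n} \<psi>) = 0"
  unfolding pair_weight_fibres[OF assms(1,2)]
proof (rule sum.neutral, rule ballI)
  fix \<sigma> :: "nat \<Rightarrow> 'b"
  have "mfps_const (vertex_weight f (restr \<sigma> (fibre {..<n} \<phi> v))) = (0 :: ('c, complex fls) mfps)"
    using assms(5) by (simp add: vertex_weight_def finite_fibre)
  then have "(\<Prod>v\<in>V. mfps_const (vertex_weight f (restr \<sigma> (fibre {..<n} \<phi> v)))) = (0 :: ('c, complex fls) mfps)"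
    by (intro prod_zero[OF assms(3)] bexI[OF _ assms(4)])
  then show "(\<Prod>v\<in>V. mfps_const (vertex_weight f (restr \<sigma> (fibre {..<n} \<phi> v)))) *
     (\<Prod>w\<in>W. q (restr \<sigma> (fibre {..<n} \<psi> w))) = 0" by simp
qed

text \<open>Forgets the numbering of the edges; of the labels it keeps the lengths, which are the
  weights.\<close>

definition graph_of :: "nat \<Rightarrow> nat \<Rightarrow> nat \<Rightarrow> (nat \<Rightarrow> int) \<Rightarrow> (nat \<Rightarrow> int) \<Rightarrow> (int \<Rightarrow> 'c list) \<Rightarrow> wgraph" where
  "graph_of n b w \<phi> \<psi> \<alpha> = \<lparr>num_black = b, num_white = w,
     edges = mset (map (\<lambda>i. (\<phi> i, \<psi> i)) [0..<n]),
     weight = (\<lambda>v. if v \<in> white_set w then length (\<alpha> v) else 0)\<rparr>"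

lemma graph_of_simps [simp]:
  "num_black (graph_of n b w \<phi> \<psi> \<alpha>) = b" "num_white (graph_of n b w \<phi> \<psi> \<alpha>) = w"
  "blacks (graph_of n b w \<phi> \<psi> \<alpha>) = black_set b" "whites (graph_of n b w \<phi> \<psi> \<alpha>) = white_set w"
  "size (edges (graph_of n b w \<phi> \<psi> \<alpha>)) = n"
  by (simp_all add: graph_of_def blacks_eq whites_eq)

lemma enumerates_graph_of: "enumerates \<phi> \<psi> (graph_of n b w \<phi> \<psi> \<alpha>)"
  by (simp add: enumerates_def graph_of_def lessThan_atLeast0)

text \<open>The end maps of numbered edges that arise from graphs in \<open>Gamma_circ\<close> with
  \<open>n\<close> edges.\<close>

definition admissible :: "nat \<Rightarrow> nat \<Rightarrow> nat \<Rightarrow> ((nat \<Rightarrow> int) \<times> (nat \<Rightarrow> int)) set" where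
  "admissible n b w = {(\<phi>, \<psi>). \<phi> \<in> surj_maps {..<n} (black_set b) \<and> \<psi> \<in> surj_maps {..<n} (white_set w) \<and>
     connected_on {..<n} (kernel {..<n} \<phi> \<union> kernel {..<n} \<psi>) \<and>
     (\<forall>v\<in>black_set b. card (fibre {..<n} \<phi> v) \<noteq> 1)}"

definition labels :: "'c multiset \<Rightarrow> nat \<Rightarrow> (int \<Rightarrow> 'c list) set" where
  "labels M w = {\<alpha>. \<alpha> \<in> white_set w \<rightarrow>\<^sub>E UNIV \<and> (\<Sum>v\<in>white_set w. mset (\<alpha> v)) = M}"

lemma finite_labels: "finite (labels M w)"
  unfolding labels_def by (rule finite_subset[OF _ finite_label_functions[of "white_set w" M]]) auto

lemma finite_admissible: "finite (admissible n b w)"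
  by (rule finite_subset[of _ "surj_maps {..<n} (black_set b) \<times> surj_maps {..<n} (white_set w)"])
    (auto simp: admissible_def finite_surj_maps)

lemma graph_of_Gamma_circ:
  assumes "n > 0" "(\<phi>, \<psi>) \<in> admissible n b w"
  shows "graph_of n b w \<phi> \<psi> \<alpha> \<in> Gamma_circ"
proof -
  let ?g = "graph_of n b w \<phi> \<psi> \<alpha>"
  have a: "\<phi> ` {..<n} = black_set b" "\<psi> ` {..<n} = white_set w"
    "connected_on {..<n} (kernel {..<n} \<phi> \<union> kernel {..<n} \<psi>)"
    "\<And>v. v \<in> black_set b \<Longrightarrow> card (fibre {..<n} \<phi> v) \<noteq> 1"
    using assms(2) by (auto simp: admissible_def surj_maps_def)
  have "set_mset (edges ?g) \<subseteq> blacks ?g \<times> whites ?g"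
    using a(1,2) unfolding graph_of_simps by (auto simp: graph_of_def)
  then have wf: "is_wgraph ?g" by (simp add: is_wgraph_def) (simp add: graph_of_def)
  have "\<phi> 0 \<in> verts ?g" using a(1) assms(1) by (auto simp: verts_def)
  then have "verts ?g \<noteq> {}" by blast
  moreover have "connected_wgraph ?g"
    using connected_wgraph_iff[OF wf enumerates_graph_of, of n] a assms(1) by simp
  moreover have "valency ?g v \<noteq> 1" if "v \<in> blacks ?g" for v
    using valency_fibre[OF wf enumerates_graph_of that] a(4) that by simp
  ultimately show ?thesis using wf by (simp add: Gamma_circ_iff)
qed

lemma admissible_enumeration:
  assumes "n > 0" "g \<in> graphs_of_size n k" "enumerates \<phi> \<psi> g" "\<phi> \<in> extensional {..<n}" "\<psi> \<in> extensional {..<n}"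
  shows "(\<phi>, \<psi>) \<in> admissible n (num_black g) (num_white g)"
    "num_black g \<le> n" "num_white g \<le> n"
proof -
  have g: "g \<in> Gamma_circ" "size (edges g) = n" using assms(2) by (auto simp: graphs_of_size_def)
  have wf: "is_wgraph g" using g by (simp add: Gamma_circ_iff)
  have s: "blacks g = \<phi> ` {..<n}" "whites g = \<psi> ` {..<n}"
    using Gamma_circ_surj[OF g(1) assms(3)] g(2) assms(1) by auto
  have "connected_on {..<n} (kernel {..<n} \<phi> \<union> kernel {..<n} \<psi>)"
    using connected_wgraph_iff[OF wf assms(3) g(2)[symmetric] assms(1) s] g(1) by (simp add: Gamma_circ_iff)
  moreover have "card (fibre {..<n} \<phi> v) \<noteq> 1" if "v \<in> blacks g" for v
    using valency_fibre[OF wf assms(3) that] g that by (auto simp: Gamma_circ_iff)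
  ultimately show "(\<phi>, \<psi>) \<in> admissible n (num_black g) (num_white g)"
    using s assms(4,5) by (auto simp: admissible_def surj_maps_def blacks_eq whites_eq PiE_def)
  show "num_black g \<le> n" "num_white g \<le> n"
    using s by (metis card_blacks card_whites card_image_le card_lessThan finite_lessThan)+
qed

text \<open>A bijection behind the change of summation: a graph with labels and an ordering of its
  edges is the same as an admissible pair of end maps with labels. Orderings of a multiset of edges
  do not distinguish parallel edges, just as equal pairs of ends do not.\<close>

lemma sum_graphs_enumerations:
  fixes v :: "nat \<Rightarrow> nat \<Rightarrow> (nat \<Rightarrow> int) \<Rightarrow> (nat \<Rightarrow> int) \<Rightarrow> (int \<Rightarrow> 'c::finite list) \<Rightarrow> 'r::comm_ring_1"
  assumes n: "n > 0"
  defines "fe \<equiv> \<lambda>e :: (int \<times> int) list. restrict (\<lambda>i. fst (e ! i)) {..<n}"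
    and "se \<equiv> \<lambda>e :: (int \<times> int) list. restrict (\<lambda>i. snd (e ! i)) {..<n}"
  shows "(\<Sum>g\<in>graphs_of_size n (size M).
      \<Sum>\<alpha> | \<alpha> \<in> labellings g \<and> (\<Sum>w\<in>whites g. mset (\<alpha> w)) = M.
      \<Sum>e\<in>permutations_of_multiset (edges g). v (num_black g) (num_white g) (fe e) (se e) \<alpha>) =
    (\<Sum>b\<le>n. \<Sum>w\<le>n. \<Sum>(\<phi>, \<psi>)\<in>admissible n b w. \<Sum>\<alpha>\<in>labels M w. v b w \<phi> \<psi> \<alpha>)"
proof -
  let ?\<G> = "graphs_of_size n (size M)"
  let ?L = "\<lambda>g. {\<alpha>. \<alpha> \<in> labellings g \<and> (\<Sum>w\<in>whites g. mset (\<alpha> w)) = M}"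
  have finL: "finite (?L g)" for g by (rule finite_subset[OF _ finite_labellings[of g]]) auto
  define A where "A = (SIGMA g:?\<G>. SIGMA \<alpha>:?L g. permutations_of_multiset (edges g))"
  define B where "B = (SIGMA b:{..n}. SIGMA w:{..n}. SIGMA p:admissible n b w. labels M w)"
  define j where "j = (\<lambda>(g :: wgraph, \<alpha> :: int \<Rightarrow> 'c list, e). (num_black g, num_white g, (fe e, se e), \<alpha>))"
  define i where "i = (\<lambda>(b, w, (\<phi>, \<psi>), \<alpha> :: int \<Rightarrow> 'c list). (graph_of n b w \<phi> \<psi> \<alpha>, \<alpha>, map (\<lambda>i. (\<phi> i, \<psi> i)) [0..<n]))"
  have "(\<Sum>g\<in>?\<G>. \<Sum>\<alpha>\<in>?L g. \<Sum>e\<in>permutations_of_multiset (edges g).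
      v (num_black g) (num_white g) (fe e) (se e) \<alpha>) =
    (\<Sum>(g, \<alpha>, e)\<in>A. v (num_black g) (num_white g) (fe e) (se e) \<alpha>)"
    unfolding A_def
    by (simp add: sum.Sigma finite_graphs_of_size finL finite_SigmaI)
  also have "\<dots> = (\<Sum>(b, w, p, \<alpha>)\<in>B. v b w (fst p) (snd p) \<alpha>)"
  proof (rule sum.reindex_bij_witness[where j = j and i = i])
    fix z assume "z \<in> A"
    then obtain g \<alpha> e where z: "z = (g, \<alpha>, e)" and g: "g \<in> ?\<G>" and \<alpha>: "\<alpha> \<in> ?L g"
      and e: "mset e = edges g"
      by (auto simp: A_def permutations_of_multiset_def)
    have gG: "g \<in> Gamma_circ" "size (edges g) = n" using g by (auto simp: graphs_of_size_def)
    have wf: "is_wgraph g" using gG by (simp add: Gamma_circ_iff)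
    have le: "length e = n" using e gG by (metis size_mset)
    have em: "map (\<lambda>i. (fe e i, se e i)) [0..<n] = e"
      by (rule nth_equalityI) (simp_all add: le fe_def se_def)
    have "mset (map (\<lambda>i. (fe e i, se e i)) [0..<n]) = edges g" using em e by simp
    then have en: "enumerates (fe e) (se e) g"
      using gG(2) by (simp add: enumerates_def lessThan_atLeast0)
    have ext: "fe e \<in> extensional {..<n}" "se e \<in> extensional {..<n}" by (simp_all add: fe_def se_def)
    note adm = admissible_enumeration[OF n g en ext]
    \<comment> \<open>Weights are the lengths of the label lists, so nothing is lost when
      \<open>j\<close> drops the graph.\<close>
    have "weight g v = (if v \<in> white_set (num_white g) then length (\<alpha> v) else 0)" for v
      using \<alpha> wf by (auto simp: labellings_def PiE_iff whites_eq is_wgraph_def)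
    then have "graph_of n (num_black g) (num_white g) (fe e) (se e) \<alpha> = g"
      unfolding graph_of_def em e by (intro wgraph.equality) (simp_all add: fun_eq_iff)
    then show "i (j z) = z" by (simp add: z i_def j_def em)
    have "\<alpha> \<in> labels M (num_white g)" using \<alpha> by (simp add: labels_def labellings_def whites_eq PiE_iff)
    then show "j z \<in> B" using adm by (simp add: B_def z j_def)
    show "(case j z of (b, w, p, \<alpha>) \<Rightarrow> v b w (fst p) (snd p) \<alpha>) =
      (case z of (g, \<alpha>, e) \<Rightarrow> v (num_black g) (num_white g) (fe e) (se e) \<alpha>)"
      by (simp add: z j_def)
  next
    fix z assume "z \<in> B"
    then obtain b w \<phi> \<psi> \<alpha> where z: "z = (b, w, (\<phi>, \<psi>), \<alpha>)" and ad: "(\<phi>, \<psi>) \<in> admissible n b w"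
      and \<alpha>: "\<alpha> \<in> labels M w"
      by (auto simp: B_def)
    let ?g = "graph_of n b w \<phi> \<psi> \<alpha>"
    have ext: "\<phi> \<in> extensional {..<n}" "\<psi> \<in> extensional {..<n}"
      using ad by (auto simp: admissible_def surj_maps_def PiE_def)
    then have "fe (map (\<lambda>i. (\<phi> i, \<psi> i)) [0..<n]) = \<phi>" "se (map (\<lambda>i. (\<phi> i, \<psi> i)) [0..<n]) = \<psi>"
      by (auto simp: fe_def se_def fun_eq_iff extensional_def restrict_def)
    then show "j (i z) = z" by (simp add: z i_def j_def)
    have w: "weight ?g v = (if v \<in> white_set w then length (\<alpha> v) else 0)" for v
      by (simp add: graph_of_def)
    have "size (\<Sum>v\<in>C. mset (\<alpha> v)) = (\<Sum>v\<in>C. length (\<alpha> v))" for C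
      by (induction C rule: infinite_finite_induct) auto
    then have "(\<Sum>v\<in>white_set w. weight ?g v) = size M" using \<alpha> by (auto simp: labels_def w)
    then have "?g \<in> ?\<G>"
      using graph_of_Gamma_circ[OF n ad] by (simp add: graphs_of_size_def)
    moreover have "\<alpha> \<in> ?L ?g" using \<alpha> by (simp add: labels_def labellings_def PiE_iff w)
    moreover have "map (\<lambda>i. (\<phi> i, \<psi> i)) [0..<n] \<in> permutations_of_multiset (edges ?g)"
      by (simp add: permutations_of_multiset_def graph_of_def)
    ultimately show "i z \<in> A" by (simp add: A_def z i_def)
  qed
  also have "\<dots> = (\<Sum>b\<le>n. \<Sum>w\<le>n. \<Sum>p\<in>admissible n b w. \<Sum>\<alpha>\<in>labels M w. v b w (fst p) (snd p) \<alpha>)"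
    unfolding B_def
    by (simp add: sum.Sigma finite_admissible finite_labels finite_SigmaI)
  finally show ?thesis by (simp only: case_prod_unfold)
qed

context
  fixes F :: "real^'a::finite \<Rightarrow> 'b::finite list \<Rightarrow> complex fps"
    and G :: "real^'b \<Rightarrow> 'c::finite list \<Rightarrow> complex fps"
    and U :: "(real^'b) set" and x :: "real^'a"
  assumes U: "open U" "base_point (formal_map F x) \<in> U"
    and sm: "\<And>I. smooth_fps U (\<lambda>y. G y I)"
    and sym: "\<And>I J. mset I = mset J \<Longrightarrow> F x I = F x J"
begin

text \<open>Here the powers of \<hbar> and the factorials of the valencies match: the exponent on
  the left is \<open>b_\<gamma>\<close>, the right-hand side collects the vertex weights and the
  factor \<open>\<hbar>/i\<close> of the logarithm.\<close>

lemma sum_labels_bracket: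
  assumes \<phi>: "\<phi> \<in> surj_maps {..<n} (black_set b)" and \<psi>: "\<psi> \<in> surj_maps {..<n} (white_set w)"
    and val: "\<And>v. v \<in> black_set b \<Longrightarrow> card (fibre {..<n} \<phi> v) \<noteq> 1"
  shows "(\<Sum>\<alpha>\<in>labels M w. hbar_over_i powi (int n - int (b + w) + 1) *
      fps_to_fls (fps_const (\<Prod>v\<in>black_set b. fact (card (fibre {..<n} \<phi> v))) *
        bracket_sum F G x (black_set b) (white_set w) n \<phi> \<psi> \<alpha>)) =
    hbar_over_i * mfps_nth (pair_weight (F x) (phase_cumulant (formal_map F x) (\<lambda>y. momentum_series (G y))) n
      (kernel {..<n} \<phi>) (kernel {..<n} \<psi>)) M"
proof -
  let ?h = hbar_over_i and ?V = "black_set b" and ?W = "white_set w" and ?c = "formal_map F x"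
  let ?D = "white_derivative ?c G" and ?S = "\<lambda>y. momentum_series (G y)"
  let ?A = "\<lambda>v. fibre {..<n} \<phi> v" and ?B = "\<lambda>v. fibre {..<n} \<psi> v"
  define m where "m = (\<Prod>v\<in>?V. fact (card (?A v)) :: nat)"
  \<comment> \<open>Surjectivity excludes valency 0 and the hypothesis excludes 1, so
    \<open>vertex_weight\<close> takes its first branch.\<close>
  have card: "card (?A v) \<ge> 2" if "v \<in> ?V" for v
  proof -
    have "v \<in> \<phi> ` {..<n}" using \<phi> that by (simp add: surj_maps_def)
    then have "?A v \<noteq> {}" by (auto simp: fibre_def)
    then have "card (?A v) \<noteq> 0" by (simp add: finite_fibre)
    then show ?thesis using val[OF that] by linarith
  qed
  have cardB: "card (?B v) \<ge> 1" if "v \<in> ?W" for v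
  proof -
    have "v \<in> \<psi> ` {..<n}" using \<psi> that by (simp add: surj_maps_def)
    then have "?B v \<noteq> {}" by (auto simp: fibre_def)
    then show ?thesis by (simp add: finite_fibre Suc_le_eq card_gt_0_iff)
  qed
  have sumB: "(\<Sum>v\<in>?W. card (?B v) - 1) = n - w" "w \<le> n"
  proof -
    have "(\<Sum>v\<in>?W. card (?B v)) = n"
      using sum_card_fibre[of "{..<n}" ?W \<psi>] \<psi> by (auto simp: surj_maps_def)
    moreover have "(\<Sum>v\<in>?W. card (?B v)) = (\<Sum>v\<in>?W. (card (?B v) - 1) + 1)"
    proof (rule sum.cong[OF refl])
      fix v assume "v \<in> ?W"
      then show "card (?B v) = (card (?B v) - 1) + 1" using cardB[of v] by simp
    qed
    ultimately have "(\<Sum>v\<in>?W. card (?B v) - 1) + w = n"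
      by (simp only: sum.distrib sum_constant black_white_sets mult_1_right of_nat_id)
    then show "(\<Sum>v\<in>?W. card (?B v) - 1) = n - w" "w \<le> n" by auto
  qed
  \<comment> \<open>White blocks give \<open>n - w\<close> factors \<open>\<hbar>/i\<close>, black
    ones \<open>b\<close> factors \<open>i/\<hbar>\<close>, and one \<open>\<hbar>/i\<close> remains
    for the logarithm. Multiplication by \<open>?h ^ b\<close> first brings the integer exponent to
    a natural number.\<close>
  have scal: "?h powi (int n - int (b + w) + 1) = ?h * (?h ^ (n - w) * i_over_hbar ^ b)"
  proof -
    have "?h powi (int n - int (b + w) + 1) * ?h ^ b = ?h powi (int n - int (b + w) + 1 + int b)"
      unfolding power_int_of_nat[symmetric] by (rule power_int_add[symmetric]) simp
    also have "int n - int (b + w) + 1 + int b = int (Suc (n - w))" using sumB(2) by simp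
    finally have "?h powi (int n - int (b + w) + 1) * ?h ^ b = ?h * ?h ^ (n - w)"
      by (simp only: power_int_of_nat power_Suc)
    then have "?h powi (int n - int (b + w) + 1) * (?h * i_over_hbar) ^ b = ?h * ?h ^ (n - w) * i_over_hbar ^ b"
      by (simp only: power_mult_distrib mult.assoc[symmetric])
    then show ?thesis by (simp only: hbar_mult_i_over_hbar power_one mult_1_right mult.assoc)
  qed
  have vw: "(\<Prod>v\<in>?V. vertex_weight (F x) (restr \<sigma> (?A v))) =
      of_nat m * (i_over_hbar ^ b * (\<Prod>v\<in>?V. fps_to_fls (F x (list_of_mset (restr \<sigma> (?A v))))))" for \<sigma>
  proof -
    have "(\<Prod>v\<in>?V. vertex_weight (F x) (restr \<sigma> (?A v))) = (\<Prod>v\<in>?V. fact (card (?A v)) *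
        (i_over_hbar * fps_to_fls (F x (list_of_mset (restr \<sigma> (?A v))))))"
      using card by (intro prod.cong) (simp_all add: vertex_weight_def finite_fibre)
    also have "\<dots> = (\<Prod>v\<in>?V. fact (card (?A v))) * ((\<Prod>v\<in>?V. i_over_hbar) *
        (\<Prod>v\<in>?V. fps_to_fls (F x (list_of_mset (restr \<sigma> (?A v))))))"
      by (simp only: prod.distrib)
    also have "(\<Prod>v\<in>?V. fact (card (?A v)) :: complex fls) = of_nat m"
      by (simp add: m_def of_nat_prod)
    finally show ?thesis by (simp only: prod_constant black_white_sets)
  qed
  have pc: "(\<Prod>v\<in>?W. phase_cumulant ?c ?S (restr \<sigma> (?B v))) =
      mfps_const (?h ^ (n - w)) * (\<Prod>v\<in>?W. Abs_mfps (\<lambda>N. \<Sum>I | mset I = N. fps_to_fls (?D I (restr \<sigma> (?B v)))))" for \<sigma>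
  proof -
    have "(\<Prod>v\<in>?W. phase_cumulant ?c ?S (restr \<sigma> (?B v))) =
      (\<Prod>v\<in>?W. mfps_const (?h ^ (card (?B v) - 1))) * (\<Prod>v\<in>?W. phase_derivative ?c ?S (restr \<sigma> (?B v)))"
      by (simp add: phase_cumulant_def prod.distrib finite_fibre)
    also have "(\<Prod>v\<in>?W. mfps_const (?h ^ (card (?B v) - 1))) = (mfps_const (?h ^ (n - w)) :: ('c, complex fls) mfps)"
      by (simp only: mfps_const_prod[symmetric] power_sum[symmetric] sumB(1))
    finally show ?thesis
      by (simp only: phase_derivative_eq[where F = F and G = G and x = x and U = U, OF U sm sym])
  qed
  have "mfps_nth (pair_weight (F x) (phase_cumulant ?c ?S) n (kernel {..<n} \<phi>) (kernel {..<n} \<psi>)) M =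
    (\<Sum>\<sigma>\<in>{..<n} \<rightarrow>\<^sub>E UNIV. \<Sum>\<alpha>\<in>labels M w. (?h ^ (n - w) * i_over_hbar ^ b) * (of_nat m *
      ((\<Prod>v\<in>?V. fps_to_fls (F x (list_of_mset (restr \<sigma> (?A v))))) *
       (\<Prod>v\<in>?W. fps_to_fls (?D (\<alpha> v) (restr \<sigma> (?B v)))))))"
    unfolding pair_weight_fibres[OF \<phi> \<psi>] mfps_nth_sum
  proof (rule sum.cong[OF refl])
    fix \<sigma> :: "nat \<Rightarrow> 'b"
    have "mfps_nth ((\<Prod>v\<in>?V. mfps_const (vertex_weight (F x) (restr \<sigma> (?A v)))) *
       (\<Prod>v\<in>?W. phase_cumulant ?c ?S (restr \<sigma> (?B v)))) M =
      (\<Prod>v\<in>?V. vertex_weight (F x) (restr \<sigma> (?A v))) * (?h ^ (n - w) *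
        (\<Sum>\<alpha>\<in>labels M w. \<Prod>v\<in>?W. fps_to_fls (?D (\<alpha> v) (restr \<sigma> (?B v)))))"
      unfolding pc mfps_const_prod[symmetric] mfps_nth_const_mult labels_def
      by (subst mfps_nth_prod_labels) simp_all
    then show "mfps_nth ((\<Prod>v\<in>?V. mfps_const (vertex_weight (F x) (restr \<sigma> (?A v)))) *
       (\<Prod>v\<in>?W. phase_cumulant ?c ?S (restr \<sigma> (?B v)))) M =
      (\<Sum>\<alpha>\<in>labels M w. (?h ^ (n - w) * i_over_hbar ^ b) * (of_nat m *
      ((\<Prod>v\<in>?V. fps_to_fls (F x (list_of_mset (restr \<sigma> (?A v))))) *
       (\<Prod>v\<in>?W. fps_to_fls (?D (\<alpha> v) (restr \<sigma> (?B v)))))))"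
      unfolding vw sum_distrib_left by (simp only: mult_ac)
  qed
  also have "\<dots> = (\<Sum>\<alpha>\<in>labels M w. (?h ^ (n - w) * i_over_hbar ^ b) * (of_nat m *
      fps_to_fls (bracket_sum F G x ?V ?W n \<phi> \<psi> \<alpha>)))"
    unfolding bracket_sum_def fps_to_fls_sum fls_times_fps_to_fls fps_to_fls_prod sum_distrib_left
    by (rule sum.swap)
  finally have eq: "mfps_nth (pair_weight (F x) (phase_cumulant ?c ?S) n (kernel {..<n} \<phi>) (kernel {..<n} \<psi>)) M = \<dots>" .
  have m: "(\<Prod>v\<in>?V. fact (card (?A v)) :: complex) = of_nat m" by (simp add: m_def of_nat_prod)
  show ?thesis
    unfolding eq m scal fls_times_fps_to_fls fps_to_fls_const_of_nat sum_distrib_left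
    by (simp only: mult.assoc)
qed

text \<open>The bracket is averaged over the orderings of the edges: there are
  \<open>fact n / edge_mult g\<close> of them, and each term on the right is
  \<open>edge_mult g\<close> times the bracket, so \<open>1 / fact n\<close> is the
  normalisation.\<close>

lemma graph_coeff_enumerations:
  assumes n: "n > 0" and g: "g \<in> graphs_of_size n k"
  defines "fe \<equiv> \<lambda>e :: (int \<times> int) list. restrict (\<lambda>i. fst (e ! i)) {..<n}"
    and "se \<equiv> \<lambda>e :: (int \<times> int) list. restrict (\<lambda>i. snd (e ! i)) {..<n}"
  shows "graph_coeff F G x M g / (fact (num_black g) * fact (num_white g)) =
    (\<Sum>\<alpha> | \<alpha> \<in> labellings g \<and> (\<Sum>w\<in>whites g. mset (\<alpha> w)) = M.
      \<Sum>e\<in>permutations_of_multiset (edges g).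
        1 / (fact n * (fact (num_black g) * fact (num_white g))) *
        (hbar_over_i powi (int n - int (num_black g + num_white g) + 1) *
        fps_to_fls (fps_const (\<Prod>v\<in>black_set (num_black g). fact (card (fibre {..<n} (fe e) v))) *
        bracket_sum F G x (black_set (num_black g)) (white_set (num_white g)) n (fe e) (se e) \<alpha>)))"
proof -
  let ?d = "fact (num_black g) * fact (num_white g) :: complex fls"
  let ?N = "card (permutations_of_multiset (edges g))"
  have gG: "g \<in> Gamma_circ" "size (edges g) = n" using g by (auto simp: graphs_of_size_def)
  have wf: "is_wgraph g" using gG by (simp add: Gamma_circ_iff)
  have bt: "betti g = int n - int (num_black g + num_white g) + 1"
    using gG by (simp add: betti_def card_verts)
  have N: "of_nat ?N * of_nat (edge_mult g) = (fact n :: complex fls)"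
    using card_permutations_edges[OF wf] gG(2) by (metis of_nat_fact of_nat_mult)
  have br: "fps_to_fls (fps_const (\<Prod>v\<in>black_set (num_black g). fact (card (fibre {..<n} (fe e) v))) *
        bracket_sum F G x (black_set (num_black g)) (white_set (num_white g)) n (fe e) (se e) \<alpha>) =
      of_nat (edge_mult g) * fps_to_fls (graph_bracket F G g \<alpha> x)"
    if e: "e \<in> permutations_of_multiset (edges g)" for e \<alpha>
  proof -
    have me: "mset e = edges g" using e by (simp add: permutations_of_multiset_def)
    then have le: "length e = n" using gG by (metis size_mset)
    have "map (\<lambda>i. (fe e i, se e i)) [0..<n] = e"
      by (rule nth_equalityI) (simp_all add: le fe_def se_def)
    then have "mset (map (\<lambda>i. (fe e i, se e i)) [0..<n]) = edges g" using me by simp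
    then have en: "enumerates (fe e) (se e) g"
      using gG(2) by (simp add: enumerates_def lessThan_atLeast0)
    have "fps_const (of_nat (edge_mult g)) * graph_bracket F G g \<alpha> x =
      fps_const (\<Prod>v\<in>blacks g. fact (card (fibre {..<n} (fe e) v))) *
      bracket_sum F G x (blacks g) (whites g) n (fe e) (se e) \<alpha>"
      using graph_bracket_eq[where F = F and G = G and x = x and U = U, OF U sm sym wf en, of \<alpha>]
      unfolding gG(2) .
    from arg_cong[OF this, of fps_to_fls] show ?thesis
      unfolding fls_times_fps_to_fls fps_to_fls_const_of_nat blacks_eq whites_eq by simp
  qed
  have one: "(\<Sum>e\<in>permutations_of_multiset (edges g). 1 / (fact n * ?d) * (p * (of_nat (edge_mult g) * y))) = p * y / ?d"
    for p y :: "complex fls"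
  proof -
    have nz: "(fact n :: complex fls) \<noteq> 0" "?d \<noteq> 0" by simp_all
    have "(\<Sum>e\<in>permutations_of_multiset (edges g). 1 / (fact n * ?d) * (p * (of_nat (edge_mult g) * y))) =
        (of_nat ?N * of_nat (edge_mult g)) * (1 / (fact n * ?d) * (p * y))"
      by (simp only: sum_constant mult_ac)
    also have "\<dots> = p * y / ?d" unfolding N using nz by (simp add: field_simps)
    finally show ?thesis .
  qed
  show ?thesis
    unfolding graph_coeff_def sum_divide_distrib
    by (intro sum.cong refl) (simp only: br one bt cong: sum.cong)
qed

text \<open>Vertex factorials cancel against the number of surjections with a given kernel. What
  remains is the sum over connected pairs of partitions with the factor \<open>1 / fact n\<close>,
  which is a coefficient of \<open>connected_series\<close>.\<close>

lemma graph_sum_nth_pos: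
  assumes n: "n > 0"
  shows "fps_nth (graph_sum F G x) n = mfps_const hbar_over_i *
    fps_nth (connected_series (F x) (phase_cumulant (formal_map F x) (\<lambda>y. momentum_series (G y)))) n"
proof (rule mfps_eqI)
  fix M
  let ?h = hbar_over_i and ?q = "phase_cumulant (formal_map F x) (\<lambda>y. momentum_series (G y))"
  let ?K = "kernel {..<n} :: (nat \<Rightarrow> int) \<Rightarrow> _"
  define Z where "Z P Q = (if connected_on {..<n} (P \<union> Q) then mfps_nth (pair_weight (F x) ?q n P Q) M else 0)" for P Q
  let ?v = "\<lambda>b w \<phi> \<psi> \<alpha>. 1 / (fact n * (fact b * fact w)) * (?h powi (int n - int (b + w) + 1) *
        fps_to_fls (fps_const (\<Prod>v\<in>black_set b. fact (card (fibre {..<n} \<phi> v))) *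
        bracket_sum F G x (black_set b) (white_set w) n \<phi> \<psi> \<alpha>))"
  have inner: "(\<Sum>(\<phi>, \<psi>)\<in>admissible n b w. \<Sum>\<alpha>\<in>labels M w. ?v b w \<phi> \<psi> \<alpha>) =
     ?h / fact n * (\<Sum>P | partition_on {..<n} P \<and> card P = b. \<Sum>Q | partition_on {..<n} Q \<and> card Q = w. Z P Q)" for b w
  proof -
    let ?s = "surj_maps {..<n} (black_set b)" and ?t = "surj_maps {..<n} (white_set w)"
    let ?C = "?h / (fact n * (fact b * fact w))"
    have "(\<Sum>(\<phi>, \<psi>)\<in>admissible n b w. \<Sum>\<alpha>\<in>labels M w. ?v b w \<phi> \<psi> \<alpha>) =
      (\<Sum>(\<phi>, \<psi>)\<in>admissible n b w. ?C * Z (?K \<phi>) (?K \<psi>))"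
    proof (rule sum.cong[OF refl], clarify)
      fix \<phi> \<psi> assume ad: "(\<phi>, \<psi>) \<in> admissible n b w"
      then have "(\<Sum>\<alpha>\<in>labels M w. ?v b w \<phi> \<psi> \<alpha>) = 1 / (fact n * (fact b * fact w)) *
          (?h * mfps_nth (pair_weight (F x) ?q n (?K \<phi>) (?K \<psi>)) M)"
        using sum_labels_bracket[of \<phi> n b \<psi> w M]
        by (simp only: sum_distrib_left[symmetric, of "1 / (fact n * (fact b * fact w))"])
          (simp add: admissible_def)
      then show "(\<Sum>\<alpha>\<in>labels M w. ?v b w \<phi> \<psi> \<alpha>) = ?C * Z (?K \<phi>) (?K \<psi>)"
        using ad by (simp add: Z_def admissible_def)
    qed
    \<comment> \<open>The sum may be extended to all pairs of surjections: the added ones are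
      disconnected, where \<open>Z\<close> is 0 by definition, or have a black leaf, where the
      weight vanishes.\<close>
    also have "\<dots> = (\<Sum>(\<phi>, \<psi>)\<in>?s \<times> ?t. ?C * Z (?K \<phi>) (?K \<psi>))"
    proof (rule sum.mono_neutral_left)
      show "\<forall>z\<in>?s \<times> ?t - admissible n b w. (case z of (\<phi>, \<psi>) \<Rightarrow> ?C * Z (?K \<phi>) (?K \<psi>)) = 0"
      proof clarify
        fix \<phi> \<psi> assume s: "\<phi> \<in> ?s" "\<psi> \<in> ?t" "(\<phi>, \<psi>) \<notin> admissible n b w"
        then consider "\<not> connected_on {..<n} (?K \<phi> \<union> ?K \<psi>)"
          | v where "v \<in> black_set b" "card (fibre {..<n} \<phi> v) = 1"
          by (auto simp: admissible_def)
        then show "?C * Z (?K \<phi>) (?K \<psi>) = 0"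
          by cases (simp_all add: Z_def pair_weight_eq_0[OF s(1,2)])
      qed
    qed (auto simp: finite_surj_maps admissible_def)
    also have "\<dots> = ?C * (\<Sum>\<phi>\<in>?s. \<Sum>\<psi>\<in>?t. Z (?K \<phi>) (?K \<psi>))"
      by (simp add: sum_distrib_left sum.cartesian_product case_prod_unfold)
    also have "(\<Sum>\<phi>\<in>?s. \<Sum>\<psi>\<in>?t. Z (?K \<phi>) (?K \<psi>)) =
      of_nat (fact b) * (\<Sum>P | partition_on {..<n} P \<and> card P = b. of_nat (fact w) *
        (\<Sum>Q | partition_on {..<n} Q \<and> card Q = w. Z P Q))"
      using sum_surj_maps_kernel[of "{..<n}" "white_set w" "Z _"]
        sum_surj_maps_kernel[of "{..<n}" "black_set b"
          "\<lambda>P. of_nat (fact w) * (\<Sum>Q | partition_on {..<n} Q \<and> card Q = w. Z P Q)"]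
      by simp
    also have "?C * \<dots> = ?h / fact n * (\<Sum>P | partition_on {..<n} P \<and> card P = b.
        \<Sum>Q | partition_on {..<n} Q \<and> card Q = w. Z P Q)"
      by (simp add: sum_distrib_left[symmetric])
    finally show ?thesis .
  qed
  have "mfps_nth (fps_nth (graph_sum F G x) n) M = (\<Sum>g\<in>graphs_of_size n (size M).
     graph_coeff F G x M g / (fact (num_black g) * fact (num_white g)))"
    by (rule graph_sum_nth[where F = F and G = G and x = x and U = U]) (rule U sm | erule sym)+
  also have "\<dots> = (\<Sum>b\<le>n. \<Sum>w\<le>n. \<Sum>(\<phi>, \<psi>)\<in>admissible n b w. \<Sum>\<alpha>\<in>labels M w. ?v b w \<phi> \<psi> \<alpha>)"
    unfolding sum_graphs_enumerations[OF n, symmetric]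
    by (rule sum.cong[OF refl]) (rule graph_coeff_enumerations[OF n])
  also have "\<dots> = ?h / fact n * (\<Sum>P | partition_on {..<n} P. \<Sum>Q | partition_on {..<n} Q. Z P Q)"
  proof -
    \<comment> \<open>Sums over the numbers of black and white vertices reassemble into sums over
      all partitions, which have at most \<open>n\<close> blocks.\<close>
    have "(\<Sum>b\<le>n. \<Sum>w\<le>n. \<Sum>P | partition_on {..<n} P \<and> card P = b. \<Sum>Q | partition_on {..<n} Q \<and> card Q = w. Z P Q) =
      (\<Sum>b\<le>n. \<Sum>P | partition_on {..<n} P \<and> card P = b. \<Sum>w\<le>n. \<Sum>Q | partition_on {..<n} Q \<and> card Q = w. Z P Q)"
      by (intro sum.cong refl sum.swap)
    also have "\<dots> = (\<Sum>P | partition_on {..<n} P. \<Sum>Q | partition_on {..<n} Q. Z P Q)"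
      by (simp only: sum_partitions_by_card[symmetric])
    finally have eq: "(\<Sum>b\<le>n. \<Sum>w\<le>n. \<Sum>P | partition_on {..<n} P \<and> card P = b.
        \<Sum>Q | partition_on {..<n} Q \<and> card Q = w. Z P Q) = \<dots>" .
    show ?thesis unfolding inner by (simp only: sum_distrib_left[symmetric] eq)
  qed
  also have "(\<Sum>P | partition_on {..<n} P. \<Sum>Q | partition_on {..<n} Q. Z P Q) =
    mfps_nth (colour_sum (connected_weight (F x) ?q) {..<n}) M"
    unfolding colour_sum_connected_weight mfps_nth_sum Z_def by (intro sum.cong refl) simp
  finally show "mfps_nth (fps_nth (graph_sum F G x) n) M =
    mfps_nth (mfps_const ?h * fps_nth (connected_series (F x) ?q) n) M"
    using n by (simp add: connected_series_def mfps_nth_const_mult)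
qed

end

text \<open>The first conjunct certifies that the formal logarithm is a genuine one:
  \<open>osc_exp\<close> takes \<open>H\<close> back to the integral. The second follows from the
  third by applying \<open>osc_exp\<close>.\<close>

theorem mainTheorem7:
  fixes U1 :: "(real^'a::finite) set" and U2 :: "(real^'b::finite) set"
    and U3 :: "(real^'c::finite) set"
    and F :: "real^'a \<Rightarrow> 'b list \<Rightarrow> complex fps"
    and G :: "real^'b \<Rightarrow> 'c list \<Rightarrow> complex fps"
    and H :: "real^'a \<Rightarrow> 'c series"
    and x :: "real^'a"
  assumes "open U1" "open U2" "open U3"
    and "quantum_thick_morphism U1 U2 F"
    and "quantum_thick_morphism U2 U3 G"
    and "x \<in> U1"
  defines "H \<equiv> composition_generating_function F G"
  shows "osc_exp (H x) = composition_integral F G x \<and>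
    osc_exp (H x) = osc_exp (graph_sum F G x) \<and>
    H x = graph_sum F G x"
proof -
  let ?c = "formal_map F x" and ?S = "\<lambda>y. momentum_series (G y)"
  let ?Z = "connected_series (F x) (phase_cumulant ?c ?S)"
  let ?p = "mfps_const (fps_to_fls (F x [])) + taylor_at_mfps ?c ?S"
  have base: "base_point ?c \<in> U2" and sym: "\<And>I J. mset I = mset J \<Longrightarrow> F x I = F x J"
    using assms(4,6) unfolding quantum_thick_morphism_def quantum_generating_function_def by blast+
  have sm: "smooth_fps U2 (\<lambda>y. G y I)" for I
    using assms(5) by (simp add: quantum_thick_morphism_def quantum_generating_function_def smooth_fps_def)
  have S: "smooth_mfps U2 ?S"
    unfolding smooth_mfps_def momentum_series_def mfps_nth_Abs
    by (intro allI smooth_fps_sum assms(2) sm)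
  have phase: "osc_phase (composition_integral F G x) = ?p"
    by (simp add: composition_integral_def Let_def)
  have amplitude: "osc_amplitude (composition_integral F G x) = series_exp ?Z"
    using assms(2) base S sym by (rule amplitude_eq)
  have Z0: "fps_nth ?Z 0 = 0" by (simp add: connected_series_def)
  \<comment> \<open>The amplitude is already an exponential, so the logarithm returns its exponent
    and the phase becomes the term of degree 0.\<close>
  have H: "H x = fps_const ?p + scalar hbar_over_i * ?Z"
    unfolding H_def composition_generating_function_def osc_ln_def phase amplitude series_ln_exp[OF Z0] ..
  have H0: "fps_nth (H x) 0 = ?p" by (simp add: H Z0)
  \<comment> \<open>The factor \<open>i/\<hbar>\<close> of \<open>osc_exp\<close> cancels the
    \<open>\<hbar>/i\<close> of \<open>osc_ln\<close>.\<close>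
  have "scalar i_over_hbar * (H x - fps_const ?p) = scalar (hbar_over_i * i_over_hbar) * ?Z"
    unfolding H mfps_const_mult by (simp add: mult_ac flip: fps_const_mult)
  then have "osc_exp (H x) = composition_integral F G x"
    unfolding osc_exp_def H0 hbar_mult_i_over_hbar
    using phase amplitude by (simp add: osc.expand)
  moreover have "H x = graph_sum F G x"
  proof (rule fps_ext)
    \<comment> \<open>Degree 0 compares the one-vertex graphs with the phase, positive degree the
      graphs with edges with the logarithm of the amplitude.\<close>
    fix n show "fps_nth (H x) n = fps_nth (graph_sum F G x) n"
    proof (cases "n = 0")
      case True
      have "fps_nth (graph_sum F G x) 0 = ?p"
        using assms(2) base sm sym by (rule graph_sum_nth_0)
      then show ?thesis using H0 True by simp
    next
      case False
      then have "n > 0" by simp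
      with assms(2) base sm sym have "fps_nth (graph_sum F G x) n = mfps_const hbar_over_i * fps_nth ?Z n"
        by (rule graph_sum_nth_pos)
      then show ?thesis using False by (simp add: H)
    qed
  qed
  ultimately show ?thesis by simp
qed

end
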